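(* Let $\mathcal{N}$ be one of the following structures: (i) the linear order expansion $\mathcal{M}^{<}$ of a non-trivial free homogeneous structure $\mathcal{M}$; (ii) the universal $n$-linear order $\mathcal{M}_n$ for $n\geq 2$. Then the group $\mathrm{Aut}(\mathcal{N})$ is simple.
   Context: Let $L$ be a relational language. A countable $L$-structure $\mathcal{M}$ is homogeneous if every isomorphism between finite substructures of $\mathcal{M}$ extends to an automorphism of $\mathcal{M}$. Its age is the class of finite $L$-structures embeddable in $\mathcal{M}$. A homogeneous structure is determined up to isomorphism by its age, which is an amalgamation class, and is called the Fraïssé limit of that class. All homogeneous structures considered are countable and have ages with the strong amalgamation property. An amalgamation class $\mathcal{C}$ is a free amalgamation class if, whenever $A,C\in\mathcal{C}$ have common substructure $B=A\cap C$ (possibly empty), the structure on $A\cup C$ in which every relation is the union of the corresponding relations of $A$ and of $C$ belongs to $\mathcal{C}$. A homogeneous structure is free if it is the Fraïssé limit of a free amalgamation class. Non-trivial means that $\mathcal{M}$ carries a non-trivial relation of $L$, that is, $\mathrm{Aut}(\mathcal{M})\neq\mathrm{Sym}(\mathcal{M})$. Linear order expansion: let $\mathcal{C}$ be the age of $\mathcal{M}$ and let $\mathcal{C}^{<}$ be the class of all finite $L\cup\{<\}$-structures $(A,<)$ with $A\in\mathcal{C}$ and $<$ an arbitrary strict linear order on $A$. Then $\mathcal{C}^{<}$ is an amalgamation class, and $\mathcal{M}^{<}$ denotes its Fraïssé limit. Universal $n$-linear order: $\mathcal{M}_n$ is the Fraïssé limit of the class of all finite $\{<_1,\dots,<_n\}$-structures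 in which each $<_i$ is interpreted as a linear order. A group is simple if it is nontrivial and its only normal subgroups are the trivial subgroup and the whole group.
   Formalization: Non-trivial is taken to mean that some relation of M holds of a tuple with two distinct entries, as well as Aut(M) ≠ Sym(M); with the latter alone the claim fails, e.g. for a generic unary predicate, where automorphisms fixing a final segment form a proper normal subgroup. *)

theory Defs
  imports Main "HOL-Library.Countable_Set" "HOL-Algebra.Bij" "HOL-Algebra.Coset"
begin

section \<open>Relational languages and structures\<close>

text \<open>A relational language is a partial map: its domain is the set of relation symbols and its
  values are the arities.  A relation is a set of lists.  A structure does not interpret names
  outside the language, which is encoded by giving them the empty relation.\<close>

type_synonym 'r lang = "'r \<rightharpoonup> nat"

record ('a, 'r) struc =
  univ :: "'a set"
  rel :: "'r \<Rightarrow> 'a list set"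

definition structure_of :: "'r lang \<Rightarrow> ('a, 'r) struc \<Rightarrow> bool" where
  "structure_of L M \<longleftrightarrow>
     (\<forall>R. case L R of
            None \<Rightarrow> rel M R = {}
          | Some k \<Rightarrow> rel M R \<subseteq> {t. length t = k \<and> set t \<subseteq> univ M})"

definition substruc :: "('a, 'r) struc \<Rightarrow> 'a set \<Rightarrow> ('a, 'r) struc" where
  "substruc M X = \<lparr>univ = X, rel = (\<lambda>R. {t \<in> rel M R. set t \<subseteq> X})\<rparr>"

definition embedding :: "('a, 'r) struc \<Rightarrow> ('b, 'r) struc \<Rightarrow> ('a \<Rightarrow> 'b) \<Rightarrow> bool" where
  "embedding A B f \<longleftrightarrow>
     inj_on f (univ A) \<and> f ` univ A \<subseteq> univ B \<and>
     (\<forall>R t. set t \<subseteq> univ A \<longrightarrow> (t \<in> rel A R \<longleftrightarrow> map f t \<in> rel B R))"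

definition isomorphism :: "('a, 'r) struc \<Rightarrow> ('b, 'r) struc \<Rightarrow> ('a \<Rightarrow> 'b) \<Rightarrow> bool" where
  "isomorphism A B f \<longleftrightarrow> embedding A B f \<and> f ` univ A = univ B"

section \<open>Automorphism groups\<close>

text \<open>Automorphisms are extensional functions on the universe, as in \<^const>\<open>BijGroup\<close>.\<close>

definition Aut :: "('a, 'r) struc \<Rightarrow> ('a \<Rightarrow> 'a) set" where
  "Aut M = {f \<in> Bij (univ M). isomorphism M M f}"

definition Aut_group :: "('a, 'r) struc \<Rightarrow> ('a \<Rightarrow> 'a) monoid" where
  "Aut_group M = (BijGroup (univ M))\<lparr>carrier := Aut M\<rparr>"

text \<open>The library locale \<open>simple_group\<close> demands \<^term>\<open>1 < order G\<close>, and \<^const>\<open>order\<close> is a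
  \<^const>\<open>card\<close>, hence 0 for infinite groups; so that locale only covers finite groups.\<close>

definition is_simple_group :: "'g monoid \<Rightarrow> bool" where
  "is_simple_group G \<longleftrightarrow>
     group G \<and> carrier G \<noteq> {\<one>\<^bsub>G\<^esub>} \<and>
     (\<forall>H. H \<lhd> G \<longrightarrow> H = {\<one>\<^bsub>G\<^esub>} \<or> H = carrier G)"

section \<open>Homogeneous structures, ages and amalgamation\<close>

definition homogeneous :: "'r lang \<Rightarrow> ('a, 'r) struc \<Rightarrow> bool" where
  "homogeneous L M \<longleftrightarrow>
     structure_of L M \<and> countable (univ M) \<and>
     (\<forall>X Y f. finite X \<and> X \<subseteq> univ M \<and> finite Y \<and> Y \<subseteq> univ M \<and>
        isomorphism (substruc M X) (substruc M Y) f \<longrightarrow>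
        (\<exists>g \<in> Aut M. \<forall>x \<in> X. g x = f x))"

text \<open>Classes of finite structures are represented by sets of structures with universe a finite
  set of natural numbers, so that every isomorphism type of finite structures is available.\<close>

type_synonym 'r fin_class = "(nat, 'r) struc set"

definition fin_strucs :: "'r lang \<Rightarrow> 'r fin_class" where
  "fin_strucs L = {A. structure_of L A \<and> finite (univ A)}"

definition age :: "'r lang \<Rightarrow> ('a, 'r) struc \<Rightarrow> 'r fin_class" where
  "age L M = {A \<in> fin_strucs L. \<exists>f. embedding A M f}"

definition strong_amalgamation :: "'r fin_class \<Rightarrow> bool" where
  "strong_amalgamation K \<longleftrightarrow>
     (\<forall>A \<in> K. \<forall>B \<in> K. \<forall>C \<in> K. \<forall>i j. embedding B A i \<and> embedding B C j \<longrightarrow>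
        (\<exists>D \<in> K. \<exists>f g. embedding A D f \<and> embedding C D g \<and>
           (\<forall>b \<in> univ B. f (i b) = g (j b)) \<and>
           f ` univ A \<inter> g ` univ C = f ` i ` univ B))"

text \<open>Following the convention that all ages considered have the strong amalgamation property,
  amalgamation classes are required to be strong.\<close>

definition amalgamation_class :: "'r lang \<Rightarrow> 'r fin_class \<Rightarrow> bool" where
  "amalgamation_class L K \<longleftrightarrow>
     K \<noteq> {} \<and> K \<subseteq> fin_strucs L \<and>
     (\<forall>A \<in> K. \<forall>B \<in> fin_strucs L. (\<exists>f. isomorphism A B f) \<longrightarrow> B \<in> K) \<and>
     (\<forall>A \<in> K. \<forall>X \<subseteq> univ A. substruc A X \<in> K) \<and>
     (\<exists>T \<subseteq> K. countable T \<and> (\<forall>A \<in> K. \<exists>B \<in> T. \<exists>f. isomorphism A B f)) \<and>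
     (\<forall>A \<in> K. \<forall>B \<in> K. \<exists>D \<in> K. \<exists>f g. embedding A D f \<and> embedding B D g) \<and>
     strong_amalgamation K"

definition free_join :: "('a, 'r) struc \<Rightarrow> ('a, 'r) struc \<Rightarrow> ('a, 'r) struc" where
  "free_join A C = \<lparr>univ = univ A \<union> univ C, rel = (\<lambda>R. rel A R \<union> rel C R)\<rparr>"

definition free_amalgamation_class :: "'r lang \<Rightarrow> 'r fin_class \<Rightarrow> bool" where
  "free_amalgamation_class L K \<longleftrightarrow>
     amalgamation_class L K \<and>
     (\<forall>A \<in> K. \<forall>C \<in> K.
        substruc A (univ A \<inter> univ C) = substruc C (univ A \<inter> univ C) \<longrightarrow> free_join A C \<in> K)"

definition fraisse_limit :: "'r lang \<Rightarrow> 'r fin_class \<Rightarrow> ('a, 'r) struc \<Rightarrow> bool" where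
  "fraisse_limit L K M \<longleftrightarrow> homogeneous L M \<and> age L M = K"

definition free_homogeneous :: "'r lang \<Rightarrow> ('a, 'r) struc \<Rightarrow> bool" where
  "free_homogeneous L M \<longleftrightarrow> (\<exists>K. free_amalgamation_class L K \<and> fraisse_limit L K M)"

text \<open>The structure carries a non-trivial relation and \<open>Aut(M) \<noteq> Sym(M)\<close>.  A relation all of
  whose tuples are constant (such as a unary predicate) merely colours the points and counts as
  trivial.  If \<open>M\<close> is free and \<open>Aut(M)\<close> is transitive on points, each of the two conditions implies
  the other; for free \<open>M\<close> in general the first implies the second.  The first cannot be dropped:
  the linear order expansion of a set with a generic unary predicate is the rational order with a
  dense and codense subset, and its automorphisms that are the identity on some final segment
  form a proper non-trivial normal subgroup.\<close>

definition nontrivial :: "('a, 'r) struc \<Rightarrow> bool" where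
  "nontrivial M \<longleftrightarrow>
     (\<exists>R. \<exists>t \<in> rel M R. \<exists>x \<in> set t. \<exists>y \<in> set t. x \<noteq> y) \<and> Aut M \<noteq> Bij (univ M)"

section \<open>Linear order expansions and several linear orders\<close>

definition strict_order_by :: "('a, 'r) struc \<Rightarrow> 'r \<Rightarrow> bool" where
  "strict_order_by A R \<longleftrightarrow> strict_linear_order_on (univ A) {(x, y). [x, y] \<in> rel A R}"

text \<open>The symbol \<open><\<close> added to a language is \<^const>\<open>None\<close>.\<close>

definition order_lang :: "'r lang \<Rightarrow> 'r option lang" where
  "order_lang L = (\<lambda>S. case S of None \<Rightarrow> Some 2 | Some R \<Rightarrow> L R)"

definition reduct :: "('a, 'r option) struc \<Rightarrow> ('a, 'r) struc" where
  "reduct A = \<lparr>univ = univ A, rel = (\<lambda>R. rel A (Some R))\<rparr>"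

definition order_expansions :: "'r lang \<Rightarrow> 'r fin_class \<Rightarrow> 'r option fin_class" where
  "order_expansions L K =
     {A \<in> fin_strucs (order_lang L). reduct A \<in> K \<and> strict_order_by A None}"

definition linear_order_expansion ::
    "'r lang \<Rightarrow> ('a, 'r) struc \<Rightarrow> ('b, 'r option) struc \<Rightarrow> bool" where
  "linear_order_expansion L M N \<longleftrightarrow>
     fraisse_limit (order_lang L) (order_expansions L (age L M)) N"

definition orders_lang :: "nat \<Rightarrow> nat lang" where
  "orders_lang n = (\<lambda>i. if i \<in> {1..n} then Some 2 else None)"

definition universal_linear_orders :: "nat \<Rightarrow> ('b, nat) struc \<Rightarrow> bool" where
  "universal_linear_orders n N \<longleftrightarrow>
     fraisse_limit (orders_lang n)
       {A \<in> fin_strucs (orders_lang n). \<forall>i \<in> {1..n}. strict_order_by A i} N"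

end

theory Submission
  imports Defs
begin

text \<open>Let \<open>H \<noteq> 1\<close> be a normal subgroup of \<open>G = Aut(N)\<close>.  A back-and-forth construction yields
  \<open>g\<close> such that a commutator \<open>h = [h\<^sub>0, g] \<in> H\<close> has no fixed points, and a Baire category argument yields
  \<open>g\<close> such that \<open>k = [h, g] \<in> H\<close> moves points of every type over a finite set freely, and moves points
  both up and down arbitrarily near each end that it fixes.  Call finite sets \<open>A\<close> and \<open>C\<close> independent over \<open>B\<close> if they are
  freely amalgamated over \<open>B\<close> and, inside each cut of \<open>B\<close> and for each order, \<open>A\<close> lies to the right of
  \<open>C\<close>.  This relation is stationary but not symmetric.  Conjugates of \<open>k\<close> can be moved into
  independent position, so that in a product of two conjugates of \<open>k\<close> and two of \<open>k\<inverse>\<close> the conjugators can be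
  adjusted to approximate any automorphism that agrees with the product on a suitable finite set.  Playing
  this as a Banach--Mazur game for two such products \<open>\<phi>(a)\<close> and \<open>\<phi>(b)\<close> shows that every automorphism
  has the form \<open>\<phi>(a) \<circ> \<phi>(b)\<inverse>\<close>, hence \<open>H = G\<close>.

  The free relations or the second order enter once more at the start: they prevent \<open>h\<^sub>0 \<noteq> 1\<close> from fixing an
  interval pointwise.\<close>

unbundle no m_inv_syntax

text \<open>Independence puts images to the right of their sources, and near the ends that it fixes
  \<open>k\<close> pushes suitable points to the right. An arbitrary automorphism moves points in
  both directions, so conjugates of \<open>k\<close> alone cannot approximate it. The word therefore
  approaches from both sides: conjugates of \<open>k\<close> carry a tuple and its intended image,
  through one intermediate set each, to a common place to the right of both, and the second pair is
  inverted. Auxiliary points can be removed from the base of free independence, but not from that of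
  order independence, where they may be the only separators. So the two parts are treated apart, and
  the order part rests on explicit witness points near the ends. Density of words is obtained only
  locally and on finite sets; the game turns it into an exact identity at the price of a second
  word.\<close>

locale ordered_struc =
  fixes N :: "('b, 's) struc" and I :: "'s set"
  assumes countable_U: "countable (univ N)"
    and U_ne: "univ N \<noteq> {}"
    and finite_I: "finite I"
    and rel_U: "t \<in> rel N R \<Longrightarrow> set t \<subseteq> univ N"
    and order_I: "i \<in> I \<Longrightarrow> strict_order_by N i"
    and pairs_I: "i \<in> I \<Longrightarrow> t \<in> rel N i \<Longrightarrow> length t = 2"
begin

abbreviation U :: "'b set" where "U \<equiv> univ N"

text \<open>Automorphisms are taken as total permutations fixing every point off \<open>U\<close>,
  so that composition and \<open>inv\<close> are the plain ones. \<open>Aut_eq\<close> translates to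
  the extensional functions of the statement.\<close>

definition G :: "('b \<Rightarrow> 'b) set" where
  "G = {g. bij g \<and> (\<forall>x. x \<notin> U \<longrightarrow> g x = x) \<and> (\<forall>R t. map g t \<in> rel N R \<longleftrightarrow> t \<in> rel N R)}"

definition stab :: "'b set \<Rightarrow> ('b \<Rightarrow> 'b) set" where
  "stab B = {g \<in> G. \<forall>b\<in>B. g b = b}"

text \<open>The orientation \<open>b\<close> selects between an order (\<open>True\<close>) and its reverse.\<close>

definition lt :: "bool \<Rightarrow> 's \<Rightarrow> 'b \<Rightarrow> 'b \<Rightarrow> bool" where
  "lt b i x y \<longleftrightarrow> (if b then [x, y] else [y, x]) \<in> rel N i"

definition le :: "bool \<Rightarrow> 's \<Rightarrow> 'b \<Rightarrow> 'b \<Rightarrow> bool" where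
  "le b i x y \<longleftrightarrow> x = y \<or> lt b i x y"

definition conj_by :: "('b \<Rightarrow> 'b) \<Rightarrow> ('b \<Rightarrow> 'b) \<Rightarrow> 'b \<Rightarrow> 'b" where
  "conj_by a k = a \<circ> k \<circ> inv a"

lemma G_bij: "g \<in> G \<Longrightarrow> bij g"
  and G_out: "g \<in> G \<Longrightarrow> x \<notin> U \<Longrightarrow> g x = x"
  and G_rel: "g \<in> G \<Longrightarrow> map g t \<in> rel N R \<longleftrightarrow> t \<in> rel N R"
  by (auto simp: G_def)

lemma G_inj: "g \<in> G \<Longrightarrow> g x = g y \<longleftrightarrow> x = y"
  using G_bij by (metis bij_pointE)

lemma G_id [simp]: "id \<in> G"
  by (simp add: G_def)

lemma G_comp [simp]: "g \<in> G \<Longrightarrow> h \<in> G \<Longrightarrow> g \<circ> h \<in> G"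
  by (auto simp: G_def bij_comp simp flip: map_map)

lemma inv_f_G [simp]: "g \<in> G \<Longrightarrow> inv g (g x) = x"
  by (simp add: G_bij bij_is_inj)

lemma f_inv_G [simp]: "g \<in> G \<Longrightarrow> g (inv g x) = x"
  by (meson G_bij bij_is_surj surj_f_inv_f)

lemma G_inv [simp]: assumes "g \<in> G" shows "inv g \<in> G"
proof -
  have "map (inv g) t \<in> rel N R \<longleftrightarrow> t \<in> rel N R" for R t
    using G_rel[OF assms, of "map (inv g) t"] assms by (simp add: o_def)
  moreover have "inv g x = x" if "x \<notin> U" for x
    using G_out[OF assms that] assms by (metis inv_f_G)
  ultimately show ?thesis
    using assms by (simp add: G_def bij_imp_bij_inv)
qed

lemma inv_inv_G [simp]: "g \<in> G \<Longrightarrow> inv (inv g) = g"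
  by (simp add: G_bij inv_inv_eq)

lemma inv_eq_G: "g \<in> G \<Longrightarrow> inv g y = x \<longleftrightarrow> y = g x"
  by auto

lemma G_U [simp]: "g \<in> G \<Longrightarrow> g x \<in> U \<longleftrightarrow> x \<in> U"
  by (metis G_out inv_f_G G_inv)

lemma G_image_U [simp]: "g \<in> G \<Longrightarrow> A \<subseteq> U \<Longrightarrow> g ` A \<subseteq> U"
  by auto

lemma G_image_mem: "g \<in> G \<Longrightarrow> g x \<in> g ` A \<longleftrightarrow> x \<in> A"
  by (auto simp: G_inj)

lemma inv_image_cancel [simp]:
  "g \<in> G \<Longrightarrow> inv g ` g ` A = A" "g \<in> G \<Longrightarrow> g ` inv g ` A = A"
  by (auto simp: image_image)

lemma conj_by_G [simp]: "a \<in> G \<Longrightarrow> k \<in> G \<Longrightarrow> conj_by a k \<in> G"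
  by (simp add: conj_by_def)

lemma conj_by_comp: "a \<in> G \<Longrightarrow> b \<in> G \<Longrightarrow> conj_by a (conj_by b k) = conj_by (a \<circ> b) k"
  using o_inv_distrib[of a b] by (simp add: conj_by_def G_bij fun_eq_iff)

lemma conj_by_apply: "a \<in> G \<Longrightarrow> conj_by a k (a x) = a (k x)"
  by (simp add: conj_by_def)

lemma conj_by_inv: "a \<in> G \<Longrightarrow> k \<in> G \<Longrightarrow> inv (conj_by a k) = conj_by a (inv k)"
  by (rule ext) (simp add: inv_eq_G, simp add: conj_by_def)

lemma conj_by_image: "a \<in> G \<Longrightarrow> conj_by a k ` a ` A = a ` k ` A"
  by (simp add: image_image conj_by_apply)

lemma stab_G [simp]: "g \<in> stab B \<Longrightarrow> g \<in> G"
  and stab_fix [simp]: "g \<in> stab B \<Longrightarrow> b \<in> B \<Longrightarrow> g b = b"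
  unfolding stab_def by auto

lemma stab_mono: "g \<in> stab B \<Longrightarrow> A \<subseteq> B \<Longrightarrow> g \<in> stab A"
  unfolding stab_def by auto

lemma stab_id [simp]: "id \<in> stab B"
  unfolding stab_def by simp

lemma stab_comp [simp]: "g \<in> stab B \<Longrightarrow> h \<in> stab B \<Longrightarrow> g \<circ> h \<in> stab B"
  unfolding stab_def by auto

lemma stab_inv [simp]: "g \<in> stab B \<Longrightarrow> inv g \<in> stab B"
  unfolding stab_def by (auto simp: inv_eq_G)

lemma stab_image: "g \<in> stab B \<Longrightarrow> A \<subseteq> B \<Longrightarrow> g ` A = A"
  by force

lemma conj_stab_eq: "c \<in> stab B \<Longrightarrow> x \<in> B \<Longrightarrow> k x \<in> B \<Longrightarrow> conj_by c k x = k x"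
  using conj_by_apply[of c k x] by simp

lemma conj_stab_image: "c \<in> stab B \<Longrightarrow> X \<subseteq> B \<Longrightarrow> k ` X \<subseteq> B \<Longrightarrow> conj_by c k ` X = k ` X"
  by (rule image_cong[OF refl]) (auto intro!: conj_stab_eq[of c B])

text \<open>Membership in \<open>G\<close> is a condition on finite tuples and passes to pointwise
  limits. Bijectivity has to be assumed: a limit of automorphisms need not be onto.\<close>

lemma G_limit:
  assumes "bij g" and "\<And>X. finite X \<Longrightarrow> \<exists>h\<in>G. \<forall>x\<in>X. g x = h x"
  shows "g \<in> G"
proof -
  have "g x = x" if "x \<notin> U" for x
    using assms(2)[of "{x}"] G_out that by auto
  moreover have "map g t \<in> rel N R \<longleftrightarrow> t \<in> rel N R" for R t
  proof -
    obtain h where "h \<in> G" "\<forall>x\<in>set t. g x = h x" using assms(2)[of "set t"] by auto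
    then show ?thesis using G_rel[of h t R] by (metis map_eq_conv)
  qed
  ultimately show ?thesis using assms(1) by (simp add: G_def)
qed

lemma lt_flip: "lt (\<not> b) i x y \<longleftrightarrow> lt b i y x"
  by (simp add: lt_def)

lemma lt_False: "lt False i x y \<longleftrightarrow> lt True i y x"
  by (simp add: lt_def)

lemma le_flip: "le (\<not> b) i x y \<longleftrightarrow> le b i y x"
  by (auto simp: le_def lt_flip)

lemma lt_U: "lt b i x y \<Longrightarrow> x \<in> U \<and> y \<in> U"
  using rel_U[of "[x, y]" i] rel_U[of "[y, x]" i] by (auto simp: lt_def split: if_splits)

lemma lt_G [simp]: "g \<in> G \<Longrightarrow> lt b i (g x) (g y) \<longleftrightarrow> lt b i x y"
  using G_rel[of g "[x, y]" i] G_rel[of g "[y, x]" i] by (simp add: lt_def)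

lemma le_G [simp]: "g \<in> G \<Longrightarrow> le b i (g x) (g y) \<longleftrightarrow> le b i x y"
  by (simp add: le_def G_inj)

lemma le_refl [simp]: "le b i x x"
  by (simp add: le_def)

context
  fixes i assumes i: "i \<in> I"
begin

lemma slo: "strict_linear_order_on U {(x, y). [x, y] \<in> rel N i}"
  using order_I[OF i] by (simp add: strict_order_by_def)

lemma lt_irrefl [simp]: "\<not> lt b i x x"
  using slo by (auto simp: lt_def strict_linear_order_on_def irrefl_def)

lemma lt_trans: "lt b i x y \<Longrightarrow> lt b i y z \<Longrightarrow> lt b i x z"
  using slo by (auto simp: lt_def strict_linear_order_on_def trans_def split: if_splits)

lemma lt_total: "x \<in> U \<Longrightarrow> y \<in> U \<Longrightarrow> lt b i x y \<or> x = y \<or> lt b i y x"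
  using slo by (auto simp: lt_def strict_linear_order_on_def total_on_def)

lemma lt_asym: "lt b i x y \<Longrightarrow> \<not> lt b i y x"
  using lt_trans lt_irrefl by blast

lemma not_lt: "x \<in> U \<Longrightarrow> y \<in> U \<Longrightarrow> \<not> lt b i x y \<longleftrightarrow> le b i y x"
  using lt_total lt_asym by (auto simp: le_def)

lemma not_le: "x \<in> U \<Longrightarrow> y \<in> U \<Longrightarrow> \<not> le b i x y \<longleftrightarrow> lt b i y x"
  using lt_total lt_asym by (auto simp: le_def)

lemma le_trans: "le b i x y \<Longrightarrow> le b i y z \<Longrightarrow> le b i x z"
  unfolding le_def using lt_trans by metis

lemma le_lt_trans: "le b i x y \<Longrightarrow> lt b i y z \<Longrightarrow> lt b i x z"
  unfolding le_def using lt_trans by metis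

lemma lt_le_trans: "lt b i x y \<Longrightarrow> le b i y z \<Longrightarrow> lt b i x z"
  unfolding le_def using lt_trans by metis

lemma le_antisym: "le b i x y \<Longrightarrow> le b i y x \<Longrightarrow> x = y"
  unfolding le_def using lt_asym by metis

lemma finite_has_max:
  assumes "finite S" "S \<noteq> {}" "S \<subseteq> U"
  shows "\<exists>m\<in>S. \<forall>s\<in>S. le b i s m"
  using assms
proof (induction S rule: finite_ne_induct)
  case (insert x F)
  then obtain m where m: "m \<in> F" "\<forall>s\<in>F. le b i s m" by auto
  have "le b i x m \<or> lt b i m x" using insert.prems m not_le by blast
  then show ?case
    using m by (metis insert_iff le_def le_lt_trans)
qed simp

end

end

section \<open>Independence\<close>

definition (in ordered_struc) free_ind :: "'b set \<Rightarrow> 'b set \<Rightarrow> 'b set \<Rightarrow> bool" where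
  "free_ind A B C \<longleftrightarrow> A \<inter> C \<subseteq> B \<and>
     (\<forall>R t. R \<notin> I \<and> t \<in> rel N R \<and> set t \<subseteq> A \<union> B \<union> C \<longrightarrow> set t \<subseteq> A \<union> B \<or> set t \<subseteq> B \<union> C)"

text \<open>\<open>s\<close> gives each order its own orientation. The comparison is non-strict, so
  as soon as there is an order, a common point of \<open>A\<close> and \<open>C\<close> must lie in
  \<open>B\<close>.\<close>

definition (in ordered_struc) ord_ind :: "('s \<Rightarrow> bool) \<Rightarrow> 'b set \<Rightarrow> 'b set \<Rightarrow> 'b set \<Rightarrow> bool" where
  "ord_ind s A B C \<longleftrightarrow>
     (\<forall>i\<in>I. \<forall>a\<in>A. \<forall>c\<in>C. le (s i) i a c \<longrightarrow> (\<exists>b\<in>B. le (s i) i a b \<and> le (s i) i b c))"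

definition (in ordered_struc) ind :: "'b set \<Rightarrow> 'b set \<Rightarrow> 'b set \<Rightarrow> bool" where
  "ind A B C \<longleftrightarrow> free_ind A B C \<and> ord_ind (\<lambda>_. True) A B C"

text \<open>In the axiom \<open>ext\<close> the sets \<open>D i\<close> are the cuts of \<open>C\<close> to be filled by the image of \<open>x\<close>.\<close>

locale generic_struc = ordered_struc N I for N :: "('b, 's) struc" and I +
  assumes hom: "\<lbrakk>finite X; X \<subseteq> U; inj_on f X; f ` X \<subseteq> U;
      \<And>R t. R \<notin> I \<Longrightarrow> set t \<subseteq> X \<Longrightarrow> map f t \<in> rel N R \<longleftrightarrow> t \<in> rel N R;
      \<And>i x y. i \<in> I \<Longrightarrow> x \<in> X \<Longrightarrow> y \<in> X \<Longrightarrow> lt True i (f x) (f y) \<longleftrightarrow> lt True i x y\<rbrakk>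
      \<Longrightarrow> \<exists>g\<in>G. \<forall>x\<in>X. g x = f x"
    and ext: "\<lbrakk>finite C; C \<subseteq> U; B \<subseteq> C; x \<in> U; x \<notin> B;
      \<And>i. i \<in> I \<Longrightarrow> D i \<subseteq> C;
      \<And>i c d. i \<in> I \<Longrightarrow> c \<in> C \<Longrightarrow> d \<in> D i \<Longrightarrow> lt True i c d \<Longrightarrow> c \<in> D i;
      \<And>i b. i \<in> I \<Longrightarrow> b \<in> B \<Longrightarrow> b \<in> D i \<longleftrightarrow> lt True i b x\<rbrakk>
      \<Longrightarrow> \<exists>g\<in>stab B. g x \<notin> C \<and> (\<forall>i\<in>I. \<forall>c\<in>C. lt True i c (g x) \<longleftrightarrow> c \<in> D i) \<and>
            free_ind {g x} B C"
begin

section \<open>Calculus of free and order independence\<close>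

lemma free_ind_sym: "free_ind A B C \<Longrightarrow> free_ind C B A"
  unfolding free_ind_def by (simp add: Un_ac) blast

lemma free_ind_mono:
  assumes "free_ind A B C" "A' \<subseteq> A" "C' \<subseteq> C"
  shows "free_ind A' B C'"
  unfolding free_ind_def
proof (intro conjI allI impI)
  have AC: "A \<inter> C \<subseteq> B" using assms(1) unfolding free_ind_def by blast
  then show "A' \<inter> C' \<subseteq> B" using assms(2,3) by blast
  fix R t assume t: "R \<notin> I \<and> t \<in> rel N R \<and> set t \<subseteq> A' \<union> B \<union> C'"
  then have "set t \<subseteq> A \<union> B \<or> set t \<subseteq> B \<union> C"
    using assms unfolding free_ind_def by (meson Un_mono order_trans subset_refl)
  then show "set t \<subseteq> A' \<union> B \<or> set t \<subseteq> B \<union> C'"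
    using t assms(2,3) AC by blast
qed

lemma free_ind_left_trans:
  assumes "free_ind A (B \<union> D) C" "free_ind D B C"
  shows "free_ind (A \<union> D) B C"
  unfolding free_ind_def
proof (intro conjI allI impI)
  show "(A \<union> D) \<inter> C \<subseteq> B" using assms unfolding free_ind_def by blast
  fix R t assume t: "R \<notin> I \<and> t \<in> rel N R \<and> set t \<subseteq> A \<union> D \<union> B \<union> C"
  then have "set t \<subseteq> A \<union> (B \<union> D) \<or> set t \<subseteq> (B \<union> D) \<union> C"
    using assms(1) unfolding free_ind_def by (metis Un_ac(1) Un_ac(3))
  then show "set t \<subseteq> A \<union> D \<union> B \<or> set t \<subseteq> B \<union> C"
    using t assms(2) unfolding free_ind_def by (metis Un_ac(1) Un_ac(3) le_supI1 le_supI2 Un_upper1 order_trans)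
qed

lemma free_ind_right_trans:
  "free_ind A B D \<Longrightarrow> free_ind A (B \<union> D) C \<Longrightarrow> free_ind A B (C \<union> D)"
  using free_ind_left_trans free_ind_sym by blast

lemma free_ind_base_mono:
  assumes "free_ind A B (C \<union> D)" shows "free_ind A (B \<union> D) C"
  using assms unfolding free_ind_def by (simp add: Un_ac) blast

text \<open>A tuple on \<open>A \<union> B \<union> C\<close> cannot contain a point of
  \<open>E\<close> outside \<open>B\<close>. There is no counterpart for \<open>ord_ind\<close>,
  where a point of \<open>E\<close> may be the only one separating two others.\<close>

lemma free_ind_drop_base:
  assumes "free_ind A (B \<union> E) C" "E \<inter> (A \<union> C) \<subseteq> B" shows "free_ind A B C"
  unfolding free_ind_def
proof (intro conjI allI impI)
  show "A \<inter> C \<subseteq> B" using assms unfolding free_ind_def by blast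
  fix R t assume t: "R \<notin> I \<and> t \<in> rel N R \<and> set t \<subseteq> A \<union> B \<union> C"
  then have "set t \<subseteq> A \<union> (B \<union> E) \<or> set t \<subseteq> (B \<union> E) \<union> C"
    using assms(1) unfolding free_ind_def by blast
  then show "set t \<subseteq> A \<union> B \<or> set t \<subseteq> B \<union> C"
    using t assms(2) by blast
qed

lemma free_ind_add_base: "free_ind A B C \<Longrightarrow> free_ind (A \<union> B) B (C \<union> B)"
  unfolding free_ind_def by (simp add: Un_ac) blast

lemma free_ind_G:
  assumes "g \<in> G" "free_ind A B C" shows "free_ind (g ` A) (g ` B) (g ` C)"
  unfolding free_ind_def
proof (intro conjI allI impI)
  show "g ` A \<inter> g ` C \<subseteq> g ` B"
    using assms unfolding free_ind_def by (auto simp: G_inj)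
  fix R t assume t: "R \<notin> I \<and> t \<in> rel N R \<and> set t \<subseteq> g ` A \<union> g ` B \<union> g ` C"
  have sub: "set (map (inv g) t) \<subseteq> X \<longleftrightarrow> set t \<subseteq> g ` X" for X
    using inv_image_cancel[OF assms(1)] by (metis image_mono set_map)
  have "map (inv g) t \<in> rel N R" using assms t G_rel[of "inv g" t R] by simp
  then show "set t \<subseteq> g ` A \<union> g ` B \<or> set t \<subseteq> g ` B \<union> g ` C"
    using t assms(2) sub unfolding free_ind_def by (metis image_Un)
qed

lemma ord_ind_mono: "ord_ind s A B C \<Longrightarrow> A' \<subseteq> A \<Longrightarrow> C' \<subseteq> C \<Longrightarrow> ord_ind s A' B C'"
  unfolding ord_ind_def by blast

lemma ord_indD:
  "ord_ind s A B C \<Longrightarrow> i \<in> I \<Longrightarrow> a \<in> A \<Longrightarrow> c \<in> C \<Longrightarrow> le (s i) i a c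
    \<Longrightarrow> \<exists>b\<in>B. le (s i) i a b \<and> le (s i) i b c"
  unfolding ord_ind_def by blast

lemma ord_ind_left_trans:
  assumes "ord_ind s A (B \<union> D) C" "ord_ind s D B C" shows "ord_ind s (A \<union> D) B C"
  unfolding ord_ind_def
proof (intro ballI impI)
  fix i a c assume i: "i \<in> I" and a: "a \<in> A \<union> D" and c: "c \<in> C" "le (s i) i a c"
  then obtain d where d: "d \<in> B \<union> D" "le (s i) i a d" "le (s i) i d c"
    using ord_indD[OF assms(1) i _ c] le_refl by blast
  then obtain b where "b \<in> B" "le (s i) i d b" "le (s i) i b c"
    using ord_indD[OF assms(2) i _ c(1)] le_refl by blast
  then show "\<exists>b\<in>B. le (s i) i a b \<and> le (s i) i b c"
    using le_trans[OF i d(2)] by blast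
qed

lemma ord_ind_right_trans:
  assumes "ord_ind s A B D" "ord_ind s A (B \<union> D) C" shows "ord_ind s A B (C \<union> D)"
  unfolding ord_ind_def
proof (intro ballI impI)
  fix i a c assume i: "i \<in> I" and a: "a \<in> A" and c: "c \<in> C \<union> D" "le (s i) i a c"
  then obtain d where d: "d \<in> B \<union> D" "le (s i) i a d" "le (s i) i d c"
    using ord_indD[OF assms(2) i a _ c(2)] le_refl by blast
  then obtain b where "b \<in> B" "le (s i) i a b" "le (s i) i b d"
    using ord_indD[OF assms(1) i a] le_refl by blast
  then show "\<exists>b\<in>B. le (s i) i a b \<and> le (s i) i b c"
    using le_trans[OF i _ d(3)] by blast
qed

lemma ord_ind_add_base: "ord_ind s A B C \<Longrightarrow> ord_ind s (A \<union> B) B (C \<union> B)"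
  unfolding ord_ind_def using le_refl by blast

lemma ord_ind_G: "g \<in> G \<Longrightarrow> ord_ind s A B C \<Longrightarrow> ord_ind s (g ` A) (g ` B) (g ` C)"
  unfolding ord_ind_def by simp

lemma ind_mono: "ind A B C \<Longrightarrow> A' \<subseteq> A \<Longrightarrow> C' \<subseteq> C \<Longrightarrow> ind A' B C'"
  unfolding ind_def by (blast intro: free_ind_mono ord_ind_mono)

lemma ind_left_trans: "ind A (B \<union> D) C \<Longrightarrow> ind D B C \<Longrightarrow> ind (A \<union> D) B C"
  unfolding ind_def by (blast intro: free_ind_left_trans ord_ind_left_trans)

lemma ind_add_base: "ind A B C \<Longrightarrow> ind (A \<union> B) B (C \<union> B)"
  unfolding ind_def by (blast intro: free_ind_add_base ord_ind_add_base)

lemma ind_G: "g \<in> G \<Longrightarrow> ind A B C \<Longrightarrow> ind (g ` A) (g ` B) (g ` C)"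
  unfolding ind_def by (blast intro: free_ind_G ord_ind_G)

lemma existence_point:
  assumes "finite B" "finite C" "B \<subseteq> U" "C \<subseteq> U" "x \<in> U"
  shows "\<exists>g\<in>stab B. free_ind {g x} B C \<and> ord_ind s {g x} B C"
proof (cases "x \<in> B")
  case True
  then show ?thesis
    by (intro bexI[of _ id]) (auto simp: free_ind_def ord_ind_def intro!: bexI[of _ x])
next
  case False
  \<comment> \<open>Within the cut of \<open>x\<close> over \<open>B\<close> the copy of
    \<open>x\<close> goes to an extreme position: above all points of \<open>C\<close> there if
    \<open>s i\<close> holds, below all of them otherwise.\<close>
  define D where "D i = (if s i then {c \<in> C \<union> B. \<forall>b\<in>B. lt True i x b \<longrightarrow> lt True i c b}
     else {c \<in> C \<union> B. \<exists>b\<in>B. lt True i b x \<and> le True i c b})" for i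
  have "\<exists>g\<in>stab B. g x \<notin> C \<union> B \<and> (\<forall>i\<in>I. \<forall>c\<in>C \<union> B. lt True i c (g x) \<longleftrightarrow> c \<in> D i) \<and>
            free_ind {g x} B (C \<union> B)"
  proof (rule ext)
    fix i c d assume i: "i \<in> I" and c: "c \<in> C \<union> B" and d: "d \<in> D i" and cd: "lt True i c d"
    show "c \<in> D i"
    proof (cases "s i")
      case True
      then show ?thesis using c d lt_trans[OF i cd] unfolding D_def by force
    next
      case False
      then obtain b where b: "b \<in> B" "lt True i b x" "le True i d b" using d by (auto simp: D_def)
      then have "le True i c b" using lt_le_trans[OF i cd] by (simp add: le_def)
      then show ?thesis using c False b unfolding D_def by auto
    qed
  next
    fix i b assume i: "i \<in> I" and b: "b \<in> B"
    then have tot: "lt True i b x \<or> lt True i x b"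
      using lt_total[of i b x True] False assms by blast
    show "b \<in> D i \<longleftrightarrow> lt True i b x"
    proof (cases "s i")
      case True
      then have "b \<in> D i \<longleftrightarrow> (\<forall>b'\<in>B. lt True i x b' \<longrightarrow> lt True i b b')"
        using b by (simp add: D_def)
      then show ?thesis using tot lt_trans[OF i, of True b x] lt_irrefl[OF i] b by blast
    next
      case False
      then have "b \<in> D i \<longleftrightarrow> (\<exists>b'\<in>B. lt True i b' x \<and> le True i b b')"
        using b by (simp add: D_def)
      then show ?thesis using le_lt_trans[OF i, of True b] b le_refl by blast
    qed
  next
    fix i show "D i \<subseteq> C \<union> B" by (auto simp: D_def)
  qed (use assms False in \<open>simp_all add: Un_least\<close>)
  then obtain g where g: "g \<in> stab B" "g x \<notin> C \<union> B"
      "\<And>i c. i \<in> I \<Longrightarrow> c \<in> C \<union> B \<Longrightarrow> lt True i c (g x) \<longleftrightarrow> c \<in> D i" "free_ind {g x} B (C \<union> B)"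
    by blast
  have gU: "g x \<in> U" using g assms by simp
  have "\<exists>b\<in>B. le (s i) i (g x) b \<and> le (s i) i b c" if "i \<in> I" "c \<in> C" "le (s i) i (g x) c" for i c
  proof -
    have ne: "g x \<noteq> c" using g that by auto
    have cU: "c \<in> U" using assms that by auto
    have lt: "lt (s i) i (g x) c" using that ne by (simp add: le_def)
    show ?thesis
    proof (cases "s i")
      case True
      then have "lt True i (g x) c" using lt by simp
      then have "c \<notin> D i" using g(3)[of i c] lt_asym[OF that(1)] that(1,2) by blast
      then obtain b where b: "b \<in> B" "lt True i x b" "\<not> lt True i c b"
        using True \<open>c \<in> C\<close> unfolding D_def by auto
      then have "lt True i (g x) b" using lt_G[of g True i x b] g by simp
      then show ?thesis using b True not_lt[of i c b] that cU assms by (auto simp: le_def)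
    next
      case False
      then have "lt True i c (g x)" using lt lt_flip[of True] by simp
      then have "c \<in> D i" using g(3)[of i c] that by auto
      then obtain b where b: "b \<in> B" "lt True i b x" "le True i c b"
        using False by (auto simp: D_def)
      then have "lt True i b (g x)" using lt_G[of g True i b x] g by simp
      then show ?thesis using b False le_flip[of True] by (auto simp: le_def)
    qed
  qed
  then have "ord_ind s {g x} B C" by (auto simp: ord_ind_def)
  then show ?thesis using g free_ind_mono[OF g(4), of "{g x}" C] by auto
qed

text \<open>Points are moved one at a time, each over \<open>B\<close> together with the images
  found before; left transitivity assembles the results.\<close>

lemma existence_oriented:
  assumes "finite A" "finite B" "finite C" "A \<subseteq> U" "B \<subseteq> U" "C \<subseteq> U"
  shows "\<exists>g\<in>stab B. free_ind (g ` A) B C \<and> ord_ind s (g ` A) B C"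
  using assms(1,4)
proof (induction A rule: finite_induct)
  case empty
  show ?case by (intro bexI[of _ id]) (auto simp: free_ind_def ord_ind_def)
next
  case (insert x A)
  then obtain g where g: "g \<in> stab B" "free_ind (g ` A) B C" "ord_ind s (g ` A) B C" by auto
  have "finite (B \<union> g ` A)" "B \<union> g ` A \<subseteq> U" "g x \<in> U" using assms insert g by auto
  then obtain h where h: "h \<in> stab (B \<union> g ` A)" "free_ind {h (g x)} (B \<union> g ` A) C"
      "ord_ind s {h (g x)} (B \<union> g ` A) C"
    using existence_point assms by metis
  have "(h \<circ> g) ` insert x A = {h (g x)} \<union> g ` A"
    using stab_image[OF h(1), of "g ` A"] by (auto simp: image_comp[symmetric])
  moreover have "h \<circ> g \<in> stab B" using g stab_mono[OF h(1), of B] by simp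
  ultimately show ?case
    using free_ind_left_trans[OF h(2) g(2)] ord_ind_left_trans[OF h(3) g(3)] by metis
qed

lemma existence:
  assumes "finite A" "finite B" "finite C" "A \<subseteq> U" "B \<subseteq> U" "C \<subseteq> U"
  shows "\<exists>g\<in>stab B. ind (g ` A) B C"
  using existence_oriented[OF assms] by (auto simp: ind_def)

text \<open>The map that is \<open>\<tau>\<close> on \<open>S\<close> and the identity on
  \<open>B \<union> C\<close> is a partial isomorphism: crossing tuples are unrelated before and
  after, and the order between \<open>S\<close> and \<open>C\<close> is decided by \<open>B\<close>.
  Then \<open>hom\<close> extends it.\<close>

lemma stationarity:
  assumes fin: "finite S" "finite B" "finite C" and sub: "S \<subseteq> U" "B \<subseteq> U" "C \<subseteq> U"
    and \<tau>: "\<tau> \<in> stab B" and S: "ind S B C" and T: "ind (\<tau> ` S) B C"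
  shows "\<exists>g\<in>stab (B \<union> C). \<forall>x\<in>S. g x = \<tau> x"
proof -
  define f where "f x = (if x \<in> S then \<tau> x else x)" for x
  have fB: "f x = \<tau> x" if "x \<in> S \<union> B" for x using that \<tau> by (auto simp: f_def)
  have fC: "f x = x" if "x \<in> C \<union> B" for x
    using that S \<tau> by (auto simp: f_def ind_def free_ind_def)
  have disj: "\<tau> x \<in> C \<union> B \<longleftrightarrow> x \<in> B" if "x \<in> S" for x
    using T that \<tau> G_image_mem[of \<tau> x B] stab_image[OF \<tau>, of B]
    by (auto simp: ind_def free_ind_def)
  \<comment> \<open>By independence \<open>x \<le> c\<close> holds exactly if some \<open>b\<close>
    in \<open>B\<close> has \<open>x \<le> b \<le> c\<close>, and this is invariant because
    \<open>\<tau>\<close> fixes \<open>B\<close>.\<close>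
  have oS: "lt True i x c \<longleftrightarrow> lt True i (\<tau> x) c" if "i \<in> I" "x \<in> S" "c \<in> C \<union> B" for i x c
  proof -
    have ord: "ord_ind (\<lambda>_. True) S B (C \<union> B)" "ord_ind (\<lambda>_. True) (\<tau> ` S) B (C \<union> B)"
      using S T ind_add_base[of S B C] ind_add_base[of "\<tau> ` S" B C]
      by (auto simp: ind_def intro: ord_ind_mono)
    have "le True i x c \<longleftrightarrow> (\<exists>b\<in>B. le True i x b \<and> le True i b c)"
      using ord(1) that le_trans[OF that(1)] unfolding ord_ind_def by blast
    moreover have "le True i (\<tau> x) c \<longleftrightarrow> (\<exists>b\<in>B. le True i (\<tau> x) b \<and> le True i b c)"
      using ord(2) that le_trans[OF that(1)] unfolding ord_ind_def by blast
    moreover have "le True i (\<tau> x) b \<longleftrightarrow> le True i x b" if "b \<in> B" for b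
      using le_G[of \<tau> True i x b] \<tau> that by simp
    ultimately have le: "le True i x c \<longleftrightarrow> le True i (\<tau> x) c" by auto
    have "x = c \<longleftrightarrow> \<tau> x = c" using disj[OF that(2)] that \<tau> S
      by (metis IntI UnE f_def fC free_ind_def ind_def stab_G G_inj stab_fix subsetD)
    then show ?thesis using le that by (auto simp: le_def)
  qed
  have oS': "lt True i c x \<longleftrightarrow> lt True i c (\<tau> x)" if "i \<in> I" "x \<in> S" "c \<in> C \<union> B" for i x c
  proof -
    have "x \<in> U" "c \<in> U" "\<tau> x \<in> U" using that sub \<tau> by auto
    moreover have "x = c \<longleftrightarrow> \<tau> x = c" using disj[OF that(2)] that \<tau> S
      by (metis IntI UnE f_def fC free_ind_def ind_def stab_G G_inj stab_fix subsetD)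
    ultimately show ?thesis using oS[OF that] lt_total[OF that(1)] lt_asym[OF that(1)]
      by metis
  qed
  have "\<exists>g\<in>G. \<forall>x\<in>S \<union> (C \<union> B). g x = f x"
  proof (rule hom)
    show "inj_on f (S \<union> (C \<union> B))"
    proof (rule inj_onI)
      fix x y assume xy: "x \<in> S \<union> (C \<union> B)" "y \<in> S \<union> (C \<union> B)" "f x = f y"
      consider "x \<in> S \<union> B" "y \<in> S \<union> B" | "x \<in> C \<union> B" "y \<in> C \<union> B" | "x \<in> S" "y \<in> C" | "y \<in> S" "x \<in> C"
        using xy by auto
      then show "x = y"
      proof cases
        case 1 then show ?thesis using fB xy \<tau> by (simp add: G_inj)
      next
        case 2 then show ?thesis using fC xy by simp
      next
        case 3 then show ?thesis using fC[of y] fB[of x] disj[of x] xy \<tau> by auto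
      next
        case 4 then show ?thesis using fC[of x] fB[of y] disj[of y] xy \<tau> by auto
      qed
    qed
    show "f ` (S \<union> (C \<union> B)) \<subseteq> U" using sub \<tau> by (auto simp: f_def)
  next
    fix R t assume R: "R \<notin> I" and t: "set t \<subseteq> S \<union> (C \<union> B)"
    consider (l) "set t \<subseteq> S \<union> B" | (r) "set t \<subseteq> C \<union> B" | (n) "\<not> set t \<subseteq> S \<union> B" "\<not> set t \<subseteq> C \<union> B"
      by auto
    then show "map f t \<in> rel N R \<longleftrightarrow> t \<in> rel N R"
    proof cases
      case l
      then have eq: "map f t = map \<tau> t" using fB by (auto intro!: map_cong)
      show ?thesis unfolding eq using G_rel[of \<tau> t R] \<tau> by simp
    next
      case r
      then have "map f t = t" using fC by (auto intro!: map_idI)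
      then show ?thesis by simp
    next
      case n
      have "t \<notin> rel N R" using S n t R unfolding ind_def free_ind_def by (metis Un_ac(1) Un_ac(3))
      moreover have "map f t \<notin> rel N R"
      proof
        assume m: "map f t \<in> rel N R"
        have "set (map f t) \<subseteq> \<tau> ` S \<union> B \<union> C"
        proof
          fix y assume "y \<in> set (map f t)"
          then obtain x where x: "x \<in> set t" "y = f x" by auto
          then have "x \<in> S \<or> x \<in> C \<union> B" using t by auto
          then show "y \<in> \<tau> ` S \<union> B \<union> C" using x fC[of x] fB[of x] by auto
        qed
        then have "set (map f t) \<subseteq> \<tau> ` S \<union> B \<or> set (map f t) \<subseteq> B \<union> C"
          using T R m unfolding ind_def free_ind_def by blast
        then show False
        proof
          assume a: "set (map f t) \<subseteq> \<tau> ` S \<union> B"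
          obtain x where x: "x \<in> set t" "x \<notin> S \<union> B" using n by auto
          then have "x \<in> C" "f x = x" using t fC by auto
          then have "x \<in> \<tau> ` S \<union> B" using a x by force
          then show False using x disj \<open>x \<in> C\<close> \<tau> by force
        next
          assume a: "set (map f t) \<subseteq> B \<union> C"
          obtain x where x: "x \<in> set t" "x \<notin> C \<union> B" using n by auto
          then have "x \<in> S" "f x = \<tau> x" using t fB by auto
          then have "\<tau> x \<in> B \<union> C" using a x by force
          then show False using x disj \<open>x \<in> S\<close> by auto
        qed
      qed
      ultimately show ?thesis by simp
    qed
  next
    fix i x y assume i: "i \<in> I" and xy: "x \<in> S \<union> (C \<union> B)" "y \<in> S \<union> (C \<union> B)"
    consider "x \<in> S \<union> B" "y \<in> S \<union> B" | "x \<in> C \<union> B" "y \<in> C \<union> B" | "x \<in> S" "y \<in> C" | "y \<in> S" "x \<in> C"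
      using xy by auto
    then show "lt True i (f x) (f y) \<longleftrightarrow> lt True i x y"
    proof cases
      case 1 then show ?thesis using fB \<tau> by simp
    next
      case 2 then show ?thesis using fC by simp
    next
      case 3 then show ?thesis using fC[of y] fB[of x] oS[OF i, of x y] by auto
    next
      case 4 then show ?thesis using fC[of x] fB[of y] oS'[OF i, of y x] by auto
    qed
  qed (use fin sub in auto)
  then obtain g where g: "g \<in> G" "\<And>x. x \<in> S \<union> (C \<union> B) \<Longrightarrow> g x = f x" by blast
  have "g \<in> stab (B \<union> C)" using g fC unfolding stab_def by auto
  moreover have "\<forall>x\<in>S. g x = \<tau> x" using g fB by auto
  ultimately show ?thesis by blast
qed

end

section \<open>Generic commutators\<close>

context generic_struc
begin

section \<open>Limits of finite approximations and Baire category in \<open>G\<close>\<close>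

lemma free_existence_point:
  assumes "finite B" "finite C" "B \<subseteq> U" "C \<subseteq> U" "x \<in> U"
  shows "\<exists>g\<in>stab B. free_ind {g x} B C"
  using existence_point[OF assms] by blast

text \<open>Values on the increasing sets are final; exhausting \<open>U\<close> both as domain and
  as range makes the limit a bijection.\<close>

lemma G_fusion:
  fixes a :: "nat \<Rightarrow> 'b \<Rightarrow> 'b"
  assumes a: "\<And>n. a n \<in> G" and mono: "\<And>n. A n \<subseteq> A (Suc n)"
    and agree: "\<And>n x. x \<in> A n \<Longrightarrow> a (Suc n) x = a n x"
    and dom: "\<And>x. x \<in> U \<Longrightarrow> \<exists>n. x \<in> A n"
    and ran: "\<And>x. x \<in> U \<Longrightarrow> \<exists>n. x \<in> a n ` A n"
  shows "\<exists>g\<in>G. \<forall>n. \<forall>x\<in>A n. g x = a n x"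
proof -
  have up: "n \<le> m \<Longrightarrow> A n \<subseteq> A m" for n m
    by (rule lift_Suc_mono_le[of A, OF mono])
  have stable: "n \<le> m \<Longrightarrow> x \<in> A n \<Longrightarrow> a m x = a n x" for n m x
  proof (induction m rule: dec_induct)
    case (step m)
    then show ?case using agree[of x m] up[of n m] by auto
  qed simp
  define g where "g x = (if x \<in> U then a (SOME n. x \<in> A n) x else x)" for x
  have g: "g x = a n x" if "x \<in> A n" for n x
  proof (cases "x \<in> U")
    case True
    let ?m = "SOME n. x \<in> A n"
    have "x \<in> A ?m" using someI[of "\<lambda>n. x \<in> A n" n] that by simp
    then have "a ?m x = a n x"
      using stable[of n ?m x] stable[of ?m n x] that by (metis nat_le_linear)
    then show ?thesis using True by (simp add: g_def)
  qed (simp add: g_def G_out[OF a])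
  have gU: "g x \<in> U \<longleftrightarrow> x \<in> U" for x
  proof (cases "x \<in> U")
    case True
    then obtain n where "x \<in> A n" using dom by blast
    then show ?thesis using g[of x n] a[of n] True by simp
  qed (simp add: g_def)
  have "g x = g y \<Longrightarrow> x = y" for x y
  proof -
    assume eq: "g x = g y"
    show "x = y"
    proof (cases "x \<in> U")
      case True
      then have "y \<in> U" using eq gU by metis
      then obtain n m where "x \<in> A n" "y \<in> A m" using dom True by blast
      then have "x \<in> A (max n m)" "y \<in> A (max n m)"
        using up[of n "max n m"] up[of m "max n m"] by auto
      then show ?thesis using g eq G_inj[OF a] by metis
    next
      case False
      then have "y \<notin> U" using eq gU by metis
      then show ?thesis using False eq by (simp add: g_def)
    qed
  qed
  moreover have "\<exists>x. y = g x" for y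
  proof (cases "y \<in> U")
    case True
    then obtain n x where "x \<in> A n" "y = a n x" using ran by blast
    then show ?thesis using g by metis
  next
    case False
    then have "g y = y" by (simp add: g_def)
    then show ?thesis by metis
  qed
  ultimately have "bij g" by (metis bijI injI surjI)
  moreover have "\<exists>h\<in>G. \<forall>x\<in>X. g x = h x" if "finite X" for X
  proof -
    have "\<exists>n. X \<inter> U \<subseteq> A n" using that
    proof (induction X rule: finite_induct)
      case (insert x X)
      then obtain n where n: "X \<inter> U \<subseteq> A n" by auto
      show ?case
      proof (cases "x \<in> U")
        case True
        then obtain m where "x \<in> A m" using dom by blast
        then have "insert x X \<inter> U \<subseteq> A (max n m)"
          using n up[of n "max n m"] up[of m "max n m"] by auto
        then show ?thesis by blast
      qed (use n in auto)
    qed simp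
    then obtain n where n: "X \<inter> U \<subseteq> A n" by blast
    have "g x = a n x" if "x \<in> X" for x
      using that n g[of x n] G_out[OF a, of x n] by (cases "x \<in> U") (auto simp: g_def)
    then show ?thesis using a by blast
  qed
  ultimately have "g \<in> G" by (rule G_limit)
  then show ?thesis using g by blast
qed

text \<open>A pair \<open>(g, A)\<close> stands for the finite partial map \<open>g\<close> on
  \<open>A\<close>; the rest of \<open>g\<close> is provisional. \<open>P\<close> is the invariant
  and \<open>Q n\<close> the requirement met at stage \<open>n\<close>. The limit itself is known
  only through its finite restrictions, which is why the conclusion speaks of approximating
  \<open>h\<close>.\<close>

lemma G_construct:
  assumes start: "P id {}"
    and step: "\<And>n g A. \<lbrakk>g \<in> G; finite A; A \<subseteq> U; P g A\<rbrakk> \<Longrightarrow>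
      \<exists>g'\<in>G. \<exists>A'. finite A' \<and> A' \<subseteq> U \<and> A \<subseteq> A' \<and> (\<forall>x\<in>A. g' x = g x) \<and> P g' A' \<and> Q (n::nat) g' A'"
    and dom: "\<And>x. x \<in> U \<Longrightarrow> \<exists>n. \<forall>g A. Q n g A \<longrightarrow> x \<in> A"
    and ran: "\<And>x. x \<in> U \<Longrightarrow> \<exists>n. \<forall>g A. Q n g A \<longrightarrow> x \<in> g ` A"
  shows "\<exists>g\<in>G. (\<forall>n. \<exists>h\<in>G. \<exists>A. Q n h A \<and> (\<forall>x\<in>A. g x = h x)) \<and>
    (\<forall>X. finite X \<longrightarrow> X \<subseteq> U \<longrightarrow> (\<exists>h\<in>G. \<exists>A. P h A \<and> X \<subseteq> A \<and> (\<forall>x\<in>A. g x = h x)))"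
proof -
  define S where "S = (\<lambda>(g, A). g \<in> G \<and> finite A \<and> A \<subseteq> U \<and> P g A)"
  define T where "T = (\<lambda>n (g, A) (g', A'). A \<subseteq> A' \<and> (\<forall>x\<in>A. g' x = g x) \<and> Q (n::nat) g' (A' :: 'b set))"
  have "\<exists>f. \<forall>n. S (f n) \<and> T n (f n) (f (Suc n))"
  proof (rule dependent_nat_choice)
    show "\<exists>x. S x" using start by (intro exI[of _ "(id, {})"]) (simp add: S_def)
  next
    fix x n assume "S x"
    then show "\<exists>y. S y \<and> T n x y"
      using step[of "fst x" "snd x" n] by (fastforce simp: S_def T_def split: prod.splits)
  qed
  then obtain f where f: "\<And>n. S (f n)" "\<And>n. T n (f n) (f (Suc n))" by blast
  define a where "a n = fst (f n)" for n
  define A where "A n = snd (f n)" for n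
  have aG: "a n \<in> G" and AP: "P (a n) (A n)" for n
    using f(1)[of n] by (auto simp: S_def a_def A_def split: prod.splits)
  have mono: "A n \<subseteq> A (Suc n)" and ag: "x \<in> A n \<Longrightarrow> a (Suc n) x = a n x"
    and AQ: "Q n (a (Suc n)) (A (Suc n))" for n x
    using f(2)[of n] by (auto simp: T_def a_def A_def split: prod.splits)
  have domA: "\<exists>n. x \<in> A n" if "x \<in> U" for x using dom[OF that] AQ by blast
  have "\<exists>g\<in>G. \<forall>n. \<forall>x\<in>A n. g x = a n x"
    by (rule G_fusion) (use aG mono ag domA in \<open>auto dest!: ran intro: AQ\<close>, use AQ in blast)
  then obtain g where g: "g \<in> G" "\<And>n x. x \<in> A n \<Longrightarrow> g x = a n x" by blast
  have "\<exists>n. X \<subseteq> A n" if "finite X" "X \<subseteq> U" for X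
    using that
  proof (induction X rule: finite_induct)
    case (insert x X)
    then obtain n m where "X \<subseteq> A n" "x \<in> A m" using domA by blast
    moreover have "A n \<subseteq> A (max n m)" "A m \<subseteq> A (max n m)"
      by (simp_all add: lift_Suc_mono_le[of A, OF mono])
    ultimately show ?case by (meson insert_subset order_trans subsetD)
  qed simp
  then have "\<exists>h\<in>G. \<exists>A. P h A \<and> X \<subseteq> A \<and> (\<forall>x\<in>A. g x = h x)" if "finite X" "X \<subseteq> U" for X
    using that g(2) aG AP by meson
  moreover have "\<exists>h\<in>G. \<exists>A. Q n h A \<and> (\<forall>x\<in>A. g x = h x)" for n
    using g(2) aG AQ by meson
  ultimately show ?thesis using g(1) by blast
qed

lemma enumerate_U: obtains u :: "nat \<Rightarrow> 'b" where "range u = U"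
  using countable_U U_ne range_from_nat_into by metis

text \<open>The Baire category theorem for \<open>G\<close> under pointwise convergence, where basic
  open sets are given by an element and a finite set. Putting \<open>u n\<close> into domain and
  range at stage \<open>n\<close> keeps the limit a permutation.\<close>

lemma G_baire:
  assumes count: "countable \<O>"
    and opn: "\<And>V g. V \<in> \<O> \<Longrightarrow> g \<in> V \<Longrightarrow> g \<in> G \<Longrightarrow>
      \<exists>A. finite A \<and> A \<subseteq> U \<and> (\<forall>g'\<in>G. (\<forall>x\<in>A. g' x = g x) \<longrightarrow> g' \<in> V)"
    and dense: "\<And>V g A. V \<in> \<O> \<Longrightarrow> g \<in> G \<Longrightarrow> finite A \<Longrightarrow> A \<subseteq> U \<Longrightarrow>
      \<exists>g'\<in>G. (\<forall>x\<in>A. g' x = g x) \<and> g' \<in> V"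
  shows "\<exists>g\<in>G. \<forall>V\<in>\<O>. g \<in> V"
proof (cases "\<O> = {}")
  case True then show ?thesis using G_id by blast
next
  case False
  then obtain v :: "nat \<Rightarrow> ('b \<Rightarrow> 'b) set" where v: "range v = \<O>"
    using range_from_nat_into[OF False count] by metis
  obtain u :: "nat \<Rightarrow> 'b" where u: "range u = U" by (rule enumerate_U)
  define Q where "Q n g A \<longleftrightarrow> u n \<in> A \<and> u n \<in> g ` A \<and> (\<forall>g'\<in>G. (\<forall>x\<in>A. g' x = g x) \<longrightarrow> g' \<in> v n)"
    for n and g :: "'b \<Rightarrow> 'b" and A
  have "\<exists>g\<in>G. (\<forall>n. \<exists>h\<in>G. \<exists>A. Q n h A \<and> (\<forall>x\<in>A. g x = h x)) \<and>
    (\<forall>X. finite X \<longrightarrow> X \<subseteq> U \<longrightarrow> (\<exists>h\<in>G. \<exists>A. True \<and> X \<subseteq> A \<and> (\<forall>x\<in>A. g x = h x)))"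
  proof (rule G_construct)
    fix n g A assume g: "g \<in> G" "finite A" "A \<subseteq> U"
    have vn: "v n \<in> \<O>" and un: "u n \<in> U" using v u by auto
    obtain g' where g': "g' \<in> G" "\<forall>x\<in>A. g' x = g x" "g' \<in> v n" using dense[OF vn g] by blast
    obtain B where B: "finite B" "B \<subseteq> U" "\<forall>h\<in>G. (\<forall>x\<in>B. h x = g' x) \<longrightarrow> h \<in> v n"
      using opn[OF vn g'(3,1)] by blast
    let ?A = "A \<union> B \<union> {u n, inv g' (u n)}"
    have "u n \<in> g' ` ?A" using f_inv_G[OF g'(1), of "u n"] by (metis UnI2 image_eqI insertCI)
    moreover have "\<forall>h\<in>G. (\<forall>x\<in>?A. h x = g' x) \<longrightarrow> h \<in> v n" using B(3) by (metis UnCI)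
    ultimately have Qn: "Q n g' ?A" unfolding Q_def by simp
    have fin: "finite ?A" "?A \<subseteq> U" using g(2,3) B(1,2) un g'(1) by simp_all
    show "\<exists>g'\<in>G. \<exists>A'. finite A' \<and> A' \<subseteq> U \<and> A \<subseteq> A' \<and> (\<forall>x\<in>A. g' x = g x) \<and> True \<and> Q n g' A'"
      by (rule bexI[of _ g'], rule exI[of _ ?A]) (intro conjI fin Qn g' TrueI, blast, rule g'(1))
  next
    fix x assume "x \<in> U"
    then obtain n where "x = u n" using u by blast
    then show "\<exists>n. \<forall>g A. Q n g A \<longrightarrow> x \<in> A" "\<exists>n. \<forall>g A. Q n g A \<longrightarrow> x \<in> g ` A"
      unfolding Q_def by blast+
  qed simp
  then obtain g where g: "g \<in> G" "\<And>n. \<exists>h\<in>G. \<exists>A. Q n h A \<and> (\<forall>x\<in>A. g x = h x)" by blast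
  have "g \<in> v n" for n using g(2)[of n] g(1) unfolding Q_def by blast
  then show ?thesis using g(1) v by blast
qed

text \<open>The equation \<open>g (h x) = h (g x)\<close> has to fail everywhere. Each new value or
  argument of \<open>g\<close> must avoid finitely many points and be moved by \<open>h\<close>;
  \<open>moves\<close> offers such points in every type over \<open>W\<close> of a point outside
  \<open>W\<close>.\<close>

lemma fixed_point_free_commutator:
  assumes h: "h \<in> G"
    and moves: "\<And>W x. \<lbrakk>finite W; W \<subseteq> U; x \<in> U; x \<notin> W\<rbrakk> \<Longrightarrow> \<exists>c\<in>stab W. h (c x) \<noteq> c x"
  shows "\<exists>g\<in>G. \<forall>x\<in>U. g (h x) \<noteq> h (g x)"
proof -
  obtain u :: "nat \<Rightarrow> 'b" where u: "range u = U" by (rule enumerate_U)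
  define P where "P g A \<longleftrightarrow> (\<forall>x\<in>A. h x \<in> A \<longrightarrow> g (h x) \<noteq> h (g x))" for g :: "'b \<Rightarrow> 'b" and A
  define Q where "Q n g A \<longleftrightarrow> u n \<in> A \<and> u n \<in> g ` A" for n and g :: "'b \<Rightarrow> 'b" and A
  \<comment> \<open>To avoid \<open>C\<close> as well, the point is first made free from
    \<open>C\<close>, and \<open>moves\<close> is then applied over
    \<open>W \<union> C\<close>.\<close>
  have moves': "\<exists>c\<in>stab W. h (c x) \<noteq> c x \<and> c x \<notin> C"
    if W: "finite W" "W \<subseteq> U" "x \<in> U" "x \<notin> W" and C: "finite C" "C \<subseteq> U" for W x C
  proof -
    obtain c where c: "c \<in> stab W" "free_ind {c x} W C" using free_existence_point[of W C x] W C by blast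
    have cW: "c x \<notin> W" using c W G_image_mem[of c x W] stab_image[OF c(1), of W] by auto
    then have "c x \<notin> W \<union> C" using c by (auto simp: free_ind_def)
    then obtain d where d: "d \<in> stab (W \<union> C)" "h (d (c x)) \<noteq> d (c x)"
      using moves[of "W \<union> C" "c x"] W C c by auto
    have "d (c x) \<notin> C"
      using \<open>c x \<notin> W \<union> C\<close> G_image_mem[of d "c x" C] stab_image[OF d(1), of C] d(1) by auto
    then show ?thesis
      using d c stab_mono[OF d(1), of W] by (intro bexI[of _ "d \<circ> c"]) auto
  qed
  have fwd: "\<exists>g'\<in>G. (\<forall>y\<in>A. g' y = g y) \<and> P g' (insert x A)"
    if g: "g \<in> G" "finite A" "A \<subseteq> U" "P g A" and x: "x \<in> U" for g A x
  proof (cases "x \<in> A")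
    case True
    then show ?thesis using g by (metis insert_absorb)
  next
    case False
    have "g x \<notin> g ` A" using False g by (simp add: G_image_mem)
    \<comment> \<open>The two excluded values would cause the equality at \<open>x\<close> when
      \<open>h x\<close> is in \<open>A\<close>, and at \<open>inv h x\<close> when that is in
      \<open>A\<close>. The case \<open>h x = x\<close> is harmless because \<open>h\<close> moves
      the new value.\<close>
    then obtain c where c: "c \<in> stab (g ` A)" "h (c (g x)) \<noteq> c (g x)"
        "c (g x) \<notin> {inv h (g (h x)), h (g (inv h x))}"
      using moves'[of "g ` A" "g x" "{inv h (g (h x)), h (g (inv h x))}"] g x h by auto
    define g' where "g' = c \<circ> g"
    have g': "g' \<in> G" "\<forall>y\<in>A. g' y = g y" using c g by (auto simp: g'_def)
    have "g' (h y) \<noteq> h (g' y)" if y: "y \<in> insert x A" "h y \<in> insert x A" for y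
    proof -
      consider "y = x" "h y = x" | "y = x" "h y \<in> A" | "y \<in> A" "h y = x" | "y \<in> A" "h y \<in> A"
        using y by auto
      then show ?thesis
      proof cases
        case 1 then show ?thesis using c by (auto simp: g'_def)
      next
        case 2
        then have "g' (h y) = g (h x)" "g' y = c (g x)" using g' by (auto simp: g'_def)
        then show ?thesis using c(3) h by auto
      next
        case 3
        then have "y = inv h x" using h by auto
        then show ?thesis using c(3) 3 g' by (auto simp: g'_def)
      next
        case 4 then show ?thesis using g g' by (auto simp: P_def)
      qed
    qed
    then have "P g' (insert x A)" unfolding P_def by blast
    then show ?thesis using g' by blast
  qed
  have bwd: "\<exists>g'\<in>G. \<exists>x\<in>U. (\<forall>y\<in>A. g' y = g y) \<and> P g' (insert x A) \<and> g' x = z"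
    if g: "g \<in> G" "finite A" "A \<subseteq> U" "P g A" and z: "z \<in> U" for g A z
  proof (cases "inv g z \<in> A")
    case True
    then show ?thesis using g z by (intro bexI[of _ g] bexI[of _ "inv g z"]) (auto simp: insert_absorb)
  next
    case False
    \<comment> \<open>The new argument is kept off \<open>inv h\<close> A\<open>and\<close>h
      \<open>A\<close>, so no point of \<open>A\<close> is its image or preimage under
      \<open>h\<close>; since \<open>h\<close> moves it, \<open>P\<close> gets no new
      instance.\<close>
    obtain c where c: "c \<in> stab A" "h (c (inv g z)) \<noteq> c (inv g z)" "c (inv g z) \<notin> inv h ` A \<union> h ` A"
      using moves'[of A "inv g z" "inv h ` A \<union> h ` A"] g z h False by auto
    define x where "x = c (inv g z)"
    define g' where "g' = g \<circ> inv c"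
    have g': "g' \<in> G" "\<forall>y\<in>A. g' y = g y" "g' x = z"
      using c g stab_fix[OF stab_inv[OF c(1)]] by (auto simp: g'_def x_def)
    have "h x \<notin> A" using c(3) h by (auto simp: x_def image_iff)
    moreover have "h y \<noteq> x" if "y \<in> A" for y
      using c(3) that unfolding x_def by (metis UnI2 image_eqI)
    ultimately have "P g' (insert x A)" using g g' c(2) unfolding P_def x_def by auto
    then show ?thesis using g' c z g by (intro bexI[of _ g'] bexI[of _ x]) (auto simp: x_def)
  qed
  have "\<exists>g\<in>G. (\<forall>n. \<exists>k\<in>G. \<exists>A. Q n k A \<and> (\<forall>x\<in>A. g x = k x)) \<and>
    (\<forall>X. finite X \<longrightarrow> X \<subseteq> U \<longrightarrow> (\<exists>k\<in>G. \<exists>A. P k A \<and> X \<subseteq> A \<and> (\<forall>x\<in>A. g x = k x)))"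
  proof (rule G_construct)
    fix n g A assume g: "g \<in> G" "finite A" "A \<subseteq> U" "P g A"
    have un: "u n \<in> U" using u by auto
    obtain g1 where g1: "g1 \<in> G" "\<forall>y\<in>A. g1 y = g y" "P g1 (insert (u n) A)"
      using fwd[OF g un] by blast
    have "finite (insert (u n) A)" "insert (u n) A \<subseteq> U" using g un by auto
    then obtain g2 x where g2: "g2 \<in> G" "x \<in> U" "\<forall>y\<in>insert (u n) A. g2 y = g1 y"
        "P g2 (insert x (insert (u n) A))" "g2 x = u n"
      using bwd[OF g1(1) _ _ g1(3) un] by blast
    then have "Q n g2 (insert x (insert (u n) A))" unfolding Q_def by auto
    then show "\<exists>g'\<in>G. \<exists>A'. finite A' \<and> A' \<subseteq> U \<and> A \<subseteq> A' \<and> (\<forall>x\<in>A. g' x = g x) \<and> P g' A' \<and> Q n g' A'"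
      using g1 g2 g un by (intro bexI[of _ g2] exI[of _ "insert x (insert (u n) A)"]) auto
  next
    fix x assume "x \<in> U"
    then obtain n where "x = u n" using u by blast
    then show "\<exists>n. \<forall>g A. Q n g A \<longrightarrow> x \<in> A" "\<exists>n. \<forall>g A. Q n g A \<longrightarrow> x \<in> g ` A"
      unfolding Q_def by blast+
  qed (simp add: P_def)
  then obtain g where g: "g \<in> G"
    "\<And>X. finite X \<Longrightarrow> X \<subseteq> U \<Longrightarrow> \<exists>k\<in>G. \<exists>A. P k A \<and> X \<subseteq> A \<and> (\<forall>x\<in>A. g x = k x)" by blast
  have "g (h x) \<noteq> h (g x)" if x: "x \<in> U" for x
  proof -
    obtain k A where "P k A" "{x, h x} \<subseteq> A" "\<forall>x\<in>A. g x = k x"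
      using g(2)[of "{x, h x}"] x h by auto
    then show ?thesis unfolding P_def by simp
  qed
  then show ?thesis using g(1) by blast
qed

lemma conj_by_fixed_point_free:
  assumes "c \<in> G" "\<And>x. x \<in> U \<Longrightarrow> k x \<noteq> x" "x \<in> U" shows "conj_by c k x \<noteq> x"
proof
  assume "conj_by c k x = x"
  then have "k (inv c x) = inv c x" using assms(1) by (metis conj_by_def comp_apply inv_f_G)
  then show False using assms by simp
qed

definition free_moving :: "('b \<Rightarrow> 'b) \<Rightarrow> bool" where
  "free_moving k \<longleftrightarrow> (\<forall>W F x. finite W \<longrightarrow> W \<subseteq> U \<longrightarrow> finite F \<longrightarrow> F \<subseteq> U \<longrightarrow> x \<in> U \<longrightarrow> x \<notin> W \<longrightarrow>
     (\<exists>c\<in>stab W. c x \<notin> F \<and> free_ind {k (c x)} (k ` W) (insert (c x) W)))"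

text \<open>Density for the category argument: a commutator is \<open>k \<circ> h\<close> with
  \<open>k\<close> a conjugate of \<open>inv h\<close>, and conjugating \<open>k\<close> by
  \<open>c\<close> in \<open>stab E\<close> changes the other entry only off a finite set. In the
  chain \<open>x0\<close>, \<open>x1 = h x0\<close>, \<open>x2 = k3 x1\<close> each point is
  loosened from the earlier data in turn.\<close>

lemma free_moving_dense:
  assumes h: "h \<in> G" "\<And>x. x \<in> U \<Longrightarrow> h x \<noteq> x" and k: "k \<in> G" "\<And>x. x \<in> U \<Longrightarrow> k x \<noteq> x"
    and E: "finite E" "E \<subseteq> U" and W: "finite W" "W \<subseteq> U" and F: "finite F" "F \<subseteq> U"
    and x: "x \<in> U" "x \<notin> W"
  shows "\<exists>c\<in>stab E. \<exists>d\<in>stab W. d x \<notin> F \<and>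
    free_ind {conj_by c k (h (d x))} (conj_by c k ` h ` W) (insert (d x) W)"
proof -
  define Y1 where "Y1 = h ` W \<union> E"
  define Y0 where "Y0 = inv h ` Y1"
  have hY0: "h ` Y0 = Y1" using h by (simp add: Y0_def)
  have WY0: "W \<subseteq> Y0" using h by (auto simp: Y0_def Y1_def image_Un)
  have fin: "finite Y0" "finite Y1" "Y0 \<subseteq> U" "Y1 \<subseteq> U" using W E h by (auto simp: Y0_def Y1_def)
  have "inv h ` Y0 \<subseteq> U" using fin h by auto
  then have "\<exists>d\<in>stab W. free_ind {d x} W (Y0 \<union> inv h ` Y0 \<union> F)"
    using free_existence_point[of W "Y0 \<union> inv h ` Y0 \<union> F" x] fin W F x by auto
  then obtain d where d: "d \<in> stab W" "free_ind {d x} W (Y0 \<union> inv h ` Y0 \<union> F)" by blast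
  define x0 where "x0 = d x"
  define x1 where "x1 = h x0"
  have x0U: "x0 \<in> U" "x1 \<in> U" using x d h by (auto simp: x0_def x1_def)
  have "x0 \<notin> W" using d x G_image_mem[of d x W] stab_image[OF d(1), of W] by (auto simp: x0_def)
  then have x0Y: "x0 \<notin> Y0" "x0 \<notin> inv h ` Y0" "x0 \<notin> F" using d(2) by (auto simp: free_ind_def x0_def)
  have x1: "x1 \<noteq> x0" "x1 \<notin> Y0" "x1 \<notin> Y1"
    using h x0U x0Y by (auto simp: x1_def hY0[symmetric] G_inj image_iff)
  obtain c1 where c1: "c1 \<in> stab Y1" "ind (c1 ` k ` Y1) Y1 (Y0 \<union> {x0, x1})"
    using existence[of "k ` Y1" Y1 "Y0 \<union> {x0, x1}"] fin x0U k by auto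
  define k1 where "k1 = conj_by c1 k"
  define Y2 where "Y2 = k1 ` Y1"
  have k1: "k1 \<in> G" using c1 k by (simp add: k1_def)
  have Y2: "Y2 = c1 ` k ` Y1"
    using conj_by_image[of c1 k Y1] c1 stab_image[OF c1(1), of Y1] by (simp add: Y2_def k1_def)
  have finY2: "finite Y2" "Y2 \<subseteq> U" using fin k1 by (auto simp: Y2_def)
  have "free_ind Y2 Y1 (Y0 \<union> {x0, x1})" using c1 by (simp add: Y2 ind_def)
  then have x1Y2: "free_ind {x1} Y1 Y2" by (blast intro: free_ind_sym free_ind_mono)
  have "inv k1 ` Y1 \<subseteq> U" using fin k1 by auto
  \<comment> \<open>The point \<open>x1\<close> must stay, so the map changes instead:
    \<open>x1\<close> is moved to a point \<open>u\<close> whose image is free from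
    \<open>Y1\<close>, and conjugating by \<open>c3 = inv c2\<close> carries this back to
    \<open>x1\<close>.\<close>
  then have "\<exists>c2\<in>stab (Y1 \<union> Y2). free_ind {c2 x1} (Y1 \<union> Y2) (inv k1 ` Y1)"
    using free_existence_point[of "Y1 \<union> Y2" "inv k1 ` Y1" x1] fin finY2 x0U k1 by auto
  then obtain c2 where c2: "c2 \<in> stab (Y1 \<union> Y2)" "free_ind {c2 x1} (Y1 \<union> Y2) (inv k1 ` Y1)" by blast
  define u where "u = c2 x1"
  have "free_ind {u} Y1 Y2"
    using free_ind_G[OF _ x1Y2, of c2] c2 stab_image[OF c2(1), of Y1] stab_image[OF c2(1), of Y2]
    by (simp add: u_def)
  then have "free_ind {u} Y1 (inv k1 ` Y1 \<union> Y2)"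
    using free_ind_right_trans c2(2) by (simp add: u_def)
  then have "free_ind {u} Y1 (inv k1 ` Y1)" by (rule free_ind_mono) auto
  then have kuY2: "free_ind {k1 u} Y2 Y1" using free_ind_G[OF k1, of "{u}" Y1 "inv k1 ` Y1"] k1 by (simp add: Y2_def)
  define c3 where "c3 = inv c2"
  have c3: "c3 \<in> stab (Y1 \<union> Y2)" "c3 u = x1" using c2 by (auto simp: c3_def u_def)
  define k2 where "k2 = conj_by c3 k1"
  have k2: "k2 \<in> G" "k2 x1 = c3 (k1 u)" "k2 ` Y1 = Y2"
    using c3 k1 conj_by_apply[of c3 k1 u] conj_stab_image[OF c3(1), of Y1 k1]
    by (auto simp: k2_def Y2_def)
  have x2Y2: "free_ind {k2 x1} Y2 Y1"
    using free_ind_G[OF _ kuY2, of c3] c3 stab_image[OF c3(1), of Y1] stab_image[OF c3(1), of Y2] k2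
    by simp
  have "\<exists>c4\<in>stab (Y1 \<union> Y2 \<union> {x1}). free_ind {c4 (k2 x1)} (Y1 \<union> Y2 \<union> {x1}) (Y0 \<union> {x0})"
    by (rule free_existence_point) (use fin finY2 x0U k2(1) in simp_all)
  then obtain c4 where c4: "c4 \<in> stab (Y1 \<union> Y2 \<union> {x1})"
      "free_ind {c4 (k2 x1)} (Y1 \<union> Y2 \<union> {x1}) (Y0 \<union> {x0})" by blast
  define k3 where "k3 = conj_by c4 k2"
  define x2 where "x2 = c4 (k2 x1)"
  have k3: "k3 \<in> G" "k3 x1 = x2" "k3 ` Y1 = Y2"
    using c4 k2 conj_by_apply[of c4 k2 x1] conj_stab_image[OF c4(1), of Y1 k2]
    by (auto simp: k3_def x2_def)
  have k3_eq: "k3 = conj_by (c4 \<circ> c3 \<circ> c1) k"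
    using c4 c3 c1 by (simp add: k3_def k2_def k1_def conj_by_comp o_assoc)
  have cE: "c4 \<circ> c3 \<circ> c1 \<in> stab E"
    by (intro stab_comp stab_mono[OF c4(1)] stab_mono[OF c3(1)] stab_mono[OF c1(1)])
      (auto simp: Y1_def)
  \<comment> \<open>Conjugates of \<open>k\<close> have no fixed points either; this is what allows
    \<open>x1\<close> to be dropped from the base.\<close>
  have "x2 \<noteq> x1"
    using conj_by_fixed_point_free[OF stab_G[OF cE] k(2) x0U(2)] k3(2) k3_eq by simp
  then have "free_ind {x2} (Y1 \<union> Y2) (Y0 \<union> {x0})"
    using c4(2) x1 free_ind_drop_base[of "{x2}" "Y1 \<union> Y2" "{x1}" "Y0 \<union> {x0}"]
    by (simp add: x2_def)
  moreover have "free_ind {x2} Y2 Y1"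
    using free_ind_G[OF _ x2Y2, of c4] c4 stab_image[OF c4(1), of Y1] stab_image[OF c4(1), of Y2]
    by (simp add: x2_def)
  ultimately have big: "free_ind {x2} Y2 (Y0 \<union> {x0} \<union> Y1)"
    using free_ind_right_trans[of "{x2}" Y2 Y1 "Y0 \<union> {x0}"] by (simp add: Un_commute)
  have "free_ind {x0} W Y0" using d(2) by (auto simp: x0_def intro: free_ind_mono)
  then have "free_ind {(k3 \<circ> h) x0} ((k3 \<circ> h) ` W) ((k3 \<circ> h) ` Y0)"
    using free_ind_G[of "k3 \<circ> h" "{x0}" W Y0] k3 h by simp
  moreover have "(k3 \<circ> h) ` W = k3 ` h ` W" "(k3 \<circ> h) ` Y0 = Y2" "(k3 \<circ> h) x0 = x2"
    using k3 hY0 by (metis image_comp, metis image_comp, simp add: x1_def)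
  ultimately have xW: "free_ind {x2} (k3 ` h ` W) Y2" by metis
  have "k3 ` h ` W \<union> Y2 = Y2" using k3(3) by (auto simp: Y1_def)
  then have "free_ind {x2} (k3 ` h ` W) (Y0 \<union> {x0} \<union> Y1 \<union> Y2)"
    using free_ind_right_trans[OF xW, of "Y0 \<union> {x0} \<union> Y1"] big by metis
  then have "free_ind {x2} (k3 ` h ` W) (insert x0 W)" by (rule free_ind_mono) (use WY0 in auto)
  then show ?thesis using cE d(1) k3(2) k3_eq x0Y(3) by (auto simp: x0_def x1_def)
qed

text \<open>Induction on \<open>X\<close>. The new point is made free from the earlier points and
  their images before \<open>free_moving\<close> is applied to it; by symmetry of freeness the
  earlier images are then free from the new point too.\<close>

lemma free_moving_set:
  assumes k: "k \<in> G" "free_moving k" and W: "finite W" "W \<subseteq> U" and F: "finite F" "F \<subseteq> U"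
    and X: "finite X" "X \<subseteq> U"
  shows "\<exists>c\<in>stab W. c ` (X - W) \<inter> F = {} \<and> free_ind (k ` c ` X) (k ` W) (W \<union> c ` X)"
  using X
proof (induction X rule: finite_induct)
  case empty
  show ?case by (intro bexI[of _ id]) (auto simp: free_ind_def)
next
  case (insert x X)
  then obtain c where c: "c \<in> stab W" "free_ind (k ` c ` X) (k ` W) (W \<union> c ` X)"
      "c ` (X - W) \<inter> F = {}" by auto
  show ?case
  proof (cases "x \<in> W")
    case True
    have "free_ind (k ` c ` X \<union> k ` W) (k ` W) (W \<union> c ` X)"
      using free_ind_add_base[OF c(2)] by (rule free_ind_mono) auto
    then have "free_ind (k ` c ` insert x X) (k ` W) (W \<union> c ` X)"
      by (rule free_ind_mono) (use True c in auto)
    then show ?thesis using c True by (intro bexI[of _ c]) (simp_all add: insert_absorb)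
  next
    case False
    define W1 where "W1 = W \<union> c ` X"
    define V where "V = W1 \<union> k ` W1"
    have fin: "finite W1" "W1 \<subseteq> U" "finite V" "V \<subseteq> U" using W insert c k by (auto simp: W1_def V_def)
    have cx: "c x \<notin> W1" "c x \<in> U"
      using False insert c G_image_mem[of c x W] stab_image[OF c(1), of W] by (auto simp: W1_def G_inj)
    obtain d where d: "d \<in> stab W1" "free_ind {d (c x)} W1 V"
      using free_existence_point[of W1 V "c x"] fin cx by blast
    have dx: "d (c x) \<notin> W1" using d cx G_image_mem[of d "c x" W1] stab_image[OF d(1), of W1] by auto
    then have "d (c x) \<notin> V" "d (c x) \<in> U" using d cx by (auto simp: free_ind_def)
    then have "\<exists>d'\<in>stab V. d' (d (c x)) \<notin> F \<and>
        free_ind {k (d' (d (c x)))} (k ` V) (insert (d' (d (c x))) V)"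
      using k(2)[unfolded free_moving_def, rule_format, OF fin(3,4) F] by blast
    then obtain d' where d': "d' \<in> stab V" "free_ind {k (d' (d (c x)))} (k ` V) (insert (d' (d (c x))) V)"
        "d' (d (c x)) \<notin> F" by blast
    define x' where "x' = d' (d (c x))"
    have W1V: "W1 \<subseteq> V" by (auto simp: V_def)
    have x'V: "free_ind {x'} W1 V"
      using free_ind_G[OF _ d(2), of d'] d'(1) stab_image[OF d'(1), of V] stab_image[OF d'(1) W1V]
      by (simp add: x'_def)
    have kV: "k ` W1 \<union> k ` V = k ` V" using W1V by auto
    have "free_ind {k x'} (k ` W1) (k ` V)" using free_ind_G[OF k(1) x'V] by simp
    then have "free_ind {k x'} (k ` W1) (insert x' V \<union> k ` V)"
      by (rule free_ind_right_trans) (use d'(2) kV in \<open>simp add: x'_def\<close>)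
    then have "free_ind {k x'} (k ` W1) (insert x' W1)"
      by (rule free_ind_mono) (use W1V in auto)
    then have 1: "free_ind {k x'} (k ` W \<union> k ` c ` X) (insert x' W1)"
      by (simp add: W1_def image_Un)
    have "free_ind {x'} W1 (k ` c ` X \<union> k ` W)"
      using x'V by (rule free_ind_mono) (auto simp: V_def W1_def)
    then have "free_ind (k ` c ` X) (k ` W \<union> W1) {x'}"
      using free_ind_sym[OF free_ind_base_mono] by (metis Un_commute)
    then have "free_ind (k ` c ` X) (k ` W) ({x'} \<union> W1)"
      using free_ind_right_trans[of "k ` c ` X" "k ` W" W1 "{x'}"] c(2) by (simp add: W1_def)
    then have "free_ind ({k x'} \<union> k ` c ` X) (k ` W) (insert x' W1)"
      using free_ind_left_trans[OF 1] by simp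
    moreover have dc: "d' (d (c y)) = c y" if "y \<in> X" for y
    proof -
      have "c y \<in> W1" "c y \<in> V" using that W1V by (auto simp: W1_def)
      then show ?thesis using stab_fix[OF d(1)] stab_fix[OF d'(1)] by simp
    qed
    moreover have "(d' \<circ> d \<circ> c) ` insert x X = insert x' (c ` X)"
      using dc by (auto simp: x'_def image_iff)
    moreover have "(d' \<circ> d \<circ> c) ` (insert x X - W) \<inter> F = {}"
      using dc d'(3) c(3) by (auto simp: image_iff disjoint_iff)
    moreover have "d' \<circ> d \<circ> c \<in> stab W"
      by (intro stab_comp stab_mono[OF d'(1)] stab_mono[OF d(1)] c(1)) (auto simp: W1_def V_def)
    ultimately show ?thesis
      by (intro bexI[of _ "d' \<circ> d \<circ> c"] conjI) (simp_all add: W1_def image_comp)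
  qed
qed

text \<open>An end is a point, or \<open>None\<close> for infinity.\<close>

definition below :: "bool \<Rightarrow> 's \<Rightarrow> 'b option \<Rightarrow> 'b \<Rightarrow> bool" where
  "below b i e x \<longleftrightarrow> (case e of None \<Rightarrow> True | Some \<beta> \<Rightarrow> lt b i x \<beta>)"

lemma below_simps [simp]: "below b i None x" "below b i (Some \<beta>) x \<longleftrightarrow> lt b i x \<beta>"
  by (simp_all add: below_def)

text \<open>Existence over the end alone, oriented by \<open>b\<close>: nothing but the end can
  separate the copy of \<open>w\<close> from the points of \<open>C\<close>.\<close>

lemma point_near_end:
  assumes i: "i \<in> I" and C: "finite C" "C \<subseteq> U" and e: "set_option e \<subseteq> U"
    and w: "w \<in> U" "below b i e w"
  shows "\<exists>x\<in>U. below b i e x \<and> (\<forall>z\<in>C. below b i e z \<longrightarrow> lt b i z x)"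
proof -
  obtain c where c: "c \<in> stab (set_option e)" "ord_ind (\<lambda>_. b) {c w} (set_option e) C"
    using existence_point[of "set_option e" C w "\<lambda>_. b"] C e w(1) by auto
  have "below b i e (c w)"
  proof (cases e)
    case (Some \<beta>)
    then have "c \<beta> = \<beta>" using stab_fix[OF c(1)] by simp
    then show ?thesis using w(2) Some lt_G[OF stab_G[OF c(1)], of b i w \<beta>] by simp
  qed simp
  moreover have cw: "c w \<in> U" using c(1) w(1) by simp
  moreover have "lt b i z (c w)" if z: "z \<in> C" "below b i e z" for z
  proof (rule ccontr)
    assume "\<not> lt b i z (c w)"
    then have "le b i (c w) z" using not_lt[OF i, of z "c w"] z C cw by auto
    then obtain \<beta> where "e = Some \<beta>" "le b i \<beta> z" using ord_indD[OF c(2) i, of "c w" z] z by auto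
    then show False using z lt_le_trans[OF i, of b z \<beta> z] lt_irrefl[OF i] by auto
  qed
  ultimately show ?thesis by blast
qed

text \<open>The image of \<open>h x\<close> is pushed in direction \<open>b\<close> over the values
  of \<open>g\<close> on \<open>insert x E\<close>. Only one of these values could stop it before
  \<open>h (g x)\<close>, and \<open>free\<close> rules that out.\<close>

lemma commutator_step:
  assumes h: "h \<in> G" and g: "g \<in> G" and E: "finite E" "E \<subseteq> U" and i: "i \<in> I" and x: "x \<in> U"
    and free: "\<And>e. e \<in> insert x E \<Longrightarrow> le b i (h x) e \<Longrightarrow> le b i (g e) (h (g x)) \<Longrightarrow> False"
  shows "\<exists>g'\<in>G. (\<forall>e\<in>insert x E. g' e = g e) \<and> lt b i (h (g' x)) (g' (h x))"
proof -
  obtain c where c: "c \<in> stab (g ` insert x E)"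
      "ord_ind (\<lambda>_. b) {c (g (h x))} (g ` insert x E) {h (g x)}"
    using existence_point[of "g ` insert x E" "{h (g x)}" "g (h x)" "\<lambda>_. b"] E h g x by auto
  have "\<not> le b i (c (g (h x))) (h (g x))"
  proof
    assume "le b i (c (g (h x))) (h (g x))"
    then obtain e where e: "e \<in> insert x E" "le b i (c (g (h x))) (g e)" "le b i (g e) (h (g x))"
      using ord_indD[OF c(2) i, of "c (g (h x))" "h (g x)"] by auto
    have "c (g e) = g e" using e(1) stab_fix[OF c(1)] by blast
    then have "le b i (c (g (h x))) (c (g e))" using e(2) by simp
    then have "le b i (h x) e" using le_G[OF stab_G[OF c(1)]] le_G[OF g] by blast
    then show False using free e by blast
  qed
  moreover have "c (g (h x)) \<in> U" "h (g x) \<in> U"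
    using G_U[OF stab_G[OF c(1)]] G_U[OF g] G_U[OF h] x by blast+
  ultimately have "lt b i (h (g x)) (c (g (h x)))" using not_le[OF i] by blast
  moreover have eq: "c (g e) = g e" if "e \<in> insert x E" for e
    using that stab_fix[OF c(1)] by blast
  ultimately have "\<forall>e\<in>insert x E. (c \<circ> g) e = g e" "lt b i (h ((c \<circ> g) x)) ((c \<circ> g) (h x))"
    by (simp_all add: eq)
  then show ?thesis using G_comp[OF stab_G[OF c(1)] g] by blast
qed

text \<open>The inequality \<open>h (g' x) < g' (h x)\<close> says that the commutator
  \<open>inv g' \<circ> inv h \<circ> g' \<circ> h\<close> moves \<open>x\<close> in direction
  \<open>b\<close>. The hypothesis on \<open>e\<close> says that the commutator of \<open>h\<close>
  and \<open>g\<close> fixes this end.\<close>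

lemma oscillation_dense:
  assumes h: "h \<in> G" "\<And>x. x \<in> U \<Longrightarrow> h x \<noteq> x" and g: "g \<in> G"
    and E: "finite E" "E \<subseteq> U" and i: "i \<in> I"
    and e: "\<And>\<beta>. e = Some \<beta> \<Longrightarrow> \<beta> \<in> U \<and> g (h \<beta>) = h (g \<beta>)"
    and w: "w \<in> U" "below b i e w"
  shows "\<exists>g'\<in>G. (\<forall>y\<in>E. g' y = g y) \<and>
    (\<exists>x\<in>U. below b i e x \<and> lt b i w x \<and> lt b i (h (g' x)) (g' (h x)))"
proof (cases e)
  case (Some \<beta>)
  have \<beta>: "\<beta> \<in> U" "g (h \<beta>) = h (g \<beta>)" using e Some by auto
  define E' where "E' = E \<union> {\<beta>, h \<beta>, w}"
  define C where "C = E' \<union> inv h ` E'"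
  have E': "finite E'" "E' \<subseteq> U" and C: "finite C" "C \<subseteq> U" using E \<beta> w h by (auto simp: E'_def C_def)
  obtain x where x: "x \<in> U" "lt b i x \<beta>" "\<And>z. z \<in> C \<Longrightarrow> lt b i z \<beta> \<Longrightarrow> lt b i z x"
    using point_near_end[OF i C _ w] Some \<beta> by auto
  have False if e': "e' \<in> insert x E'" "le b i (h x) e'" "le b i (g e') (h (g x))" for e'
  proof -
    have "lt b i (h (g x)) (h (g \<beta>))" using x(2) h g by simp
    then have "lt b i (g e') (g (h \<beta>))" using e'(3) le_lt_trans[OF i] \<beta>(2) by metis
    then have e'\<beta>: "lt b i e' (h \<beta>)" using g by simp
    show False
    proof (cases "e' = x")
      case False
      then have "inv h e' \<in> C" using e' by (auto simp: C_def)
      moreover have "lt b i (inv h e') \<beta>" "le b i x (inv h e')"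
        using e'\<beta> e'(2) lt_G[OF h(1), of b i "inv h e'" \<beta>] le_G[OF h(1), of b i x "inv h e'"] h by auto
      ultimately show False using x(3) lt_le_trans[OF i, of b "inv h e'" x] lt_irrefl[OF i] by blast
    next
      case True
      then have hx: "lt b i (h x) x" using e'(2) h(2)[OF x(1)] by (simp add: le_def)
      \<comment> \<open>\<open>h\<close> moves \<open>\<beta>\<close>; whichever of
        \<open>h \<beta>\<close> and \<open>inv h \<beta>\<close> comes before
        \<open>\<beta>\<close> was put before \<open>x\<close> when \<open>x\<close> was
        chosen.\<close>
      have "lt b i \<beta> (h \<beta>) \<or> lt b i (h \<beta>) \<beta>" using lt_total[OF i \<beta>(1), of "h \<beta>" b] h \<beta>(1) by force
      then show False
      proof
        assume "lt b i \<beta> (h \<beta>)"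
        then have "lt b i (inv h \<beta>) \<beta>" using lt_G[OF h(1), of b i "inv h \<beta>" \<beta>] h by simp
        then have "lt b i (inv h \<beta>) x" using x(3) by (simp add: C_def E'_def)
        then have "lt b i \<beta> (h x)" using lt_G[OF h(1), of b i "inv h \<beta>" x] h by simp
        then show False using hx x(2) lt_trans[OF i] lt_irrefl[OF i] by blast
      next
        assume "lt b i (h \<beta>) \<beta>"
        then have "lt b i (h \<beta>) x" using x(3) by (simp add: C_def E'_def)
        then show False using e'\<beta> True lt_asym[OF i] by blast
      qed
    qed
  qed
  then obtain g' where g': "g' \<in> G" "\<forall>y\<in>insert x E'. g' y = g y" "lt b i (h (g' x)) (g' (h x))"
    using commutator_step[OF h(1) g E' i x(1)] by blast
  moreover have "lt b i w x" using x(3) w Some by (simp add: C_def E'_def)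
  ultimately have "\<exists>x\<in>U. below b i e x \<and> lt b i w x \<and> lt b i (h (g' x)) (g' (h x))"
    using x(1,2) Some by auto
  moreover have "\<forall>y\<in>E. g' y = g y" using g'(2) by (simp add: E'_def)
  ultimately show ?thesis using g'(1) by blast
next
  case None
  show ?thesis
  \<comment> \<open>At infinity either \<open>h\<close> moves points outwards arbitrarily far out,
    and such an \<open>x\<close> serves, or beyond some \<open>t\<close> it moves all points
    inwards, and the image of \<open>x\<close> is first taken beyond \<open>t\<close>.\<close>
  proof (cases "\<forall>t\<in>U. \<exists>x\<in>U. lt b i t x \<and> lt b i x (h x)")
    case True
    obtain t where t: "t \<in> U" "\<And>z. z \<in> insert w E \<Longrightarrow> lt b i z t"
      using point_near_end[OF i, of "insert w E" None w b] E w by auto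
    obtain x where x: "x \<in> U" "lt b i t x" "lt b i x (h x)" using True t(1) by blast
    have xE: "lt b i z x" if "z \<in> insert w E" for z using t(2)[OF that] x(2) lt_trans[OF i] by blast
    have False if "e' \<in> insert x E" "le b i (h x) e'" for e'
    proof -
      have "le b i e' x" using that(1) xE by (auto simp: le_def)
      then have "lt b i e' (h x)" using le_lt_trans[OF i _ x(3)] by blast
      then show False using lt_le_trans[OF i _ that(2)] lt_irrefl[OF i] by blast
    qed
    then obtain g' where g': "g' \<in> G" "\<forall>y\<in>insert x E. g' y = g y" "lt b i (h (g' x)) (g' (h x))"
      using commutator_step[OF h(1) g E i x(1)] by blast
    then have "\<exists>x\<in>U. below b i e x \<and> lt b i w x \<and> lt b i (h (g' x)) (g' (h x))"
      using x(1) xE[of w] None by auto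
    then show ?thesis using g' by blast
  next
    case False
    then obtain t where t: "t \<in> U" "\<And>x. x \<in> U \<Longrightarrow> lt b i t x \<Longrightarrow> \<not> lt b i x (h x)" by blast
    define C where "C = insert w E \<union> inv h ` E"
    have C: "finite C" "C \<subseteq> U" using E w h by (auto simp: C_def)
    obtain x where x: "x \<in> U" "\<And>z. z \<in> C \<Longrightarrow> lt b i z x"
      using point_near_end[OF i C, of None w b] w by auto
    have hxE: "lt b i z (h x)" if "z \<in> E" for z
      using x(2)[of "inv h z"] that lt_G[OF h(1), of b i "inv h z" x] h by (simp add: C_def)
    define T where "T = insert t (inv h ` g ` E)"
    have T: "finite T" "T \<subseteq> U" using E t h g by (auto simp: T_def)
    obtain c where c: "c \<in> stab (g ` E)" "ord_ind (\<lambda>_. b) {c (g x)} (g ` E) T"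
      using existence_point[of "g ` E" T "g x" "\<lambda>_. b"] E g x T by auto
    have cE: "c (g y) = g y" if "y \<in> E" for y using that stab_fix[OF c(1)] by blast
    have uT: "lt b i z (c (g x))" if z: "z \<in> T" for z
    proof (rule ccontr)
      assume "\<not> lt b i z (c (g x))"
      then have "le b i (c (g x)) z" using not_lt[OF i, of z "c (g x)"] z T c(1) g x by auto
      then obtain y where y: "y \<in> E" "le b i (c (g x)) (g y)" using ord_indD[OF c(2) i, of "c (g x)" z] z by auto
      then have "le b i (c (g x)) (c (g y))" using cE by simp
      then have "le b i x y" using le_G[OF stab_G[OF c(1)]] le_G[OF g] by blast
      then show False using x(2)[of y] y(1) le_lt_trans[OF i] lt_irrefl[OF i] by (metis C_def UnI1 insertCI)
    qed
    define g1 where "g1 = c \<circ> g"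
    have g1: "g1 \<in> G" "g1 x \<in> U" using c(1) g x by (auto simp: g1_def)
    have u: "lt b i (h (g1 x)) (g1 x)"
      using t(2)[OF g1(2)] uT[of t] lt_total[OF i g1(2), of "h (g1 x)" b] h g1
      by (auto simp: T_def g1_def) metis
    have False if e': "e' \<in> insert x E" "le b i (h x) e'" "le b i (g1 e') (h (g1 x))" for e'
    proof (cases "e' = x")
      case True
      then show False using e'(3) u le_lt_trans[OF i] lt_irrefl[OF i] by blast
    next
      case False
      then show False using e' hxE le_lt_trans[OF i] lt_irrefl[OF i] by blast
    qed
    then obtain g' where g': "g' \<in> G" "\<forall>y\<in>insert x E. g' y = g1 y" "lt b i (h (g' x)) (g' (h x))"
      using commutator_step[OF h(1) g1(1) E i x(1)] by blast
    moreover have "lt b i w x" using x(2) by (simp add: C_def)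
    ultimately have "\<exists>x\<in>U. below b i e x \<and> lt b i w x \<and> lt b i (h (g' x)) (g' (h x))"
      using x(1) None by auto
    moreover have "\<forall>y\<in>E. g' y = g y" using g'(2) cE by (simp add: g1_def)
    ultimately show ?thesis using g'(1) by blast
  qed
qed

definition osc :: "bool \<Rightarrow> 's \<Rightarrow> ('b \<Rightarrow> 'b) \<Rightarrow> bool" where
  "osc b i k \<longleftrightarrow> (\<forall>e. \<forall>w\<in>U. set_option e \<subseteq> U \<longrightarrow> below b i e w \<longrightarrow> map_option k e = e \<longrightarrow>
     (\<exists>x\<in>U. below b i e x \<and> lt b i w x \<and> lt b i x (k x)))"

text \<open>Both oscillation clauses say that \<open>k\<close> moves points to the right:
  \<open>osc True\<close> near ends approached from the left, and \<open>osc False\<close> of the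
  inverse near ends approached from the right.\<close>

definition good :: "('b \<Rightarrow> 'b) \<Rightarrow> bool" where
  "good k \<longleftrightarrow> k \<in> G \<and> free_moving k \<and> (\<forall>i\<in>I. osc True i k \<and> osc False i (inv k))"

end

section \<open>Existence of good commutators\<close>

context generic_struc
begin

text \<open>The requirements on \<open>g\<close> form a countable family. Each is open because
  finitely many values of \<open>g\<close> decide it, and dense by \<open>free_moving_dense\<close>
  and \<open>oscillation_dense\<close>.\<close>

lemma good_commutator:
  assumes h: "h \<in> G" "\<And>x. x \<in> U \<Longrightarrow> h x \<noteq> x"
  shows "\<exists>g\<in>G. good (inv g \<circ> inv h \<circ> g \<circ> h)"
proof -
  define comm where "comm g = inv g \<circ> inv h \<circ> g \<circ> h" for g
  \<comment> \<open>Conjugated by \<open>h\<close>, the inverse of the commutator becomes the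
    commutator with \<open>inv h\<close> in place of \<open>h\<close>; so the clause for the inverse
    is the same statement about \<open>inv h\<close>.\<close>
  define hb where "hb b = (if b then h else inv h)" for b
  have hb: "hb b \<in> G" "x \<in> U \<Longrightarrow> hb b x \<noteq> x" for b x
    using h by (auto simp: hb_def inv_eq_G) metis
  define P where "P W F x = {g \<in> G. \<exists>c\<in>stab W. c x \<notin> F \<and>
      free_ind {comm g (c x)} (comm g ` W) (insert (c x) W)}" for W F x
  define O1 where "O1 b i e w = {g \<in> G. (\<exists>\<beta>\<in>set_option e. g (hb b \<beta>) \<noteq> hb b (g \<beta>)) \<or>
      (\<exists>x\<in>U. below b i e x \<and> lt b i w x \<and> lt b i (hb b (g x)) (g (hb b x)))}" for b i e w
  define X where "X = {W. finite W \<and> W \<subseteq> U}"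
  define \<O> where "\<O> = {P W F x |W F x. W \<in> X \<and> F \<in> X \<and> x \<in> U \<and> x \<notin> W} \<union>
     {O1 b i e w |b i e w. i \<in> I \<and> set_option e \<subseteq> U \<and> w \<in> U \<and> below b i e w}"
  have "\<exists>g\<in>G. \<forall>V\<in>\<O>. g \<in> V"
  proof (rule G_baire)
    have cX: "countable X" unfolding X_def by (rule countable_Collect_finite_subset[OF countable_U])
    have "countable ((\<lambda>(W, F, x). P W F x) ` (X \<times> X \<times> U))"
      by (intro countable_image countable_SIGMA cX countable_U)
    moreover have "countable ((\<lambda>(b, i, e, w). O1 b i e w) ` (UNIV \<times> I \<times> insert None (Some ` U) \<times> U))"
      by (intro countable_image countable_SIGMA countable_U countable_insert countable_finite finite_I) simp
    moreover have "\<O> \<subseteq> (\<lambda>(W, F, x). P W F x) ` (X \<times> X \<times> U) \<union>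
        (\<lambda>(b, i, e, w). O1 b i e w) ` (UNIV \<times> I \<times> insert None (Some ` U) \<times> U)"
    proof
      fix V assume "V \<in> \<O>"
      then consider W F x where "V = P W F x" "W \<in> X" "F \<in> X" "x \<in> U"
        | b i e w where "V = O1 b i e w" "i \<in> I" "set_option e \<subseteq> U" "w \<in> U"
        unfolding \<O>_def by blast
      then show "V \<in> (\<lambda>(W, F, x). P W F x) ` (X \<times> X \<times> U) \<union>
        (\<lambda>(b, i, e, w). O1 b i e w) ` (UNIV \<times> I \<times> insert None (Some ` U) \<times> U)"
      proof cases
        case 1
        then have "V = (\<lambda>(W, F, x). P W F x) (W, F, x)" "(W, F, x) \<in> X \<times> X \<times> U" by auto
        then show ?thesis by blast
      next
        case 2
        then have "V = (\<lambda>(b, i, e, w). O1 b i e w) (b, i, e, w)"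
          "(b, i, e, w) \<in> UNIV \<times> I \<times> insert None (Some ` U) \<times> U" by (cases e; auto)+
        then show ?thesis by blast
      qed
    qed
    ultimately show "countable \<O>" by (meson countable_Un countable_subset)
  next
    fix V g assume V: "V \<in> \<O>" "g \<in> V" and g: "g \<in> G"
    then consider W F x where "V = P W F x" "W \<in> X" "F \<in> X" "x \<in> U"
      | b i e w where "V = O1 b i e w" "i \<in> I" "set_option e \<subseteq> U" "w \<in> U"
      unfolding \<O>_def by blast
    then show "\<exists>A. finite A \<and> A \<subseteq> U \<and> (\<forall>g'\<in>G. (\<forall>x\<in>A. g' x = g x) \<longrightarrow> g' \<in> V)"
    proof cases
      case 1
      then obtain c where c: "c \<in> stab W" "c x \<notin> F"
          "free_ind {comm g (c x)} (comm g ` W) (insert (c x) W)"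
        using V by (auto simp: P_def)
      define Z where "Z = insert (c x) W"
      have Z: "finite Z" "Z \<subseteq> U" using 1 c by (auto simp: Z_def X_def)
      \<comment> \<open>These values of \<open>g\<close> determine the commutator on
        \<open>Z\<close>, since \<open>comm g z\<close> is the point that \<open>g\<close> sends to
        \<open>inv h (g (h z))\<close>.\<close>
      define A where "A = h ` Z \<union> comm g ` Z"
      have cg: "comm g \<in> G" using g h by (simp add: comm_def)
      have "finite A" "A \<subseteq> U" using Z cg h by (auto simp: A_def)
      moreover have "g' \<in> V" if g': "g' \<in> G" "\<forall>x\<in>A. g' x = g x" for g'
      proof -
        have eq: "comm g' z = comm g z" if "z \<in> Z" for z
        proof -
          have "g' (h z) = g (h z)" "g' (comm g z) = g (comm g z)"
            using that g'(2) by (auto simp: A_def)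
          moreover have "g (comm g z) = inv h (g (h z))" using g by (simp add: comm_def)
          ultimately have "inv g' (inv h (g' (h z))) = comm g z" using g' by (simp add: inv_eq_G)
          then show ?thesis by (simp add: comm_def)
        qed
        have "comm g' ` W = comm g ` W" using eq by (auto simp: Z_def)
        then show ?thesis using c g'(1) eq[of "c x"] 1(1) by (auto simp: P_def Z_def)
      qed
      ultimately show ?thesis by blast
    next
      case 2
      have "g \<in> O1 b i e w" using V 2 by simp
      then consider \<beta> where "\<beta> \<in> set_option e" "g (hb b \<beta>) \<noteq> hb b (g \<beta>)"
        | x where "x \<in> U" "below b i e x" "lt b i w x" "lt b i (hb b (g x)) (g (hb b x))"
        unfolding O1_def by blast
      then show ?thesis
      proof cases
        case (1 \<beta>)
        then have "\<beta> \<in> U" using 2 by auto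
        then have "finite {\<beta>, hb b \<beta>}" "{\<beta>, hb b \<beta>} \<subseteq> U" using hb(1)[of b] by simp_all
        moreover have "\<forall>g'\<in>G. (\<forall>y\<in>{\<beta>, hb b \<beta>}. g' y = g y) \<longrightarrow> g' \<in> V"
          using 1 2(1) unfolding O1_def by auto
        ultimately show ?thesis by blast
      next
        case (2 x)
        have "finite {x, hb b x}" "{x, hb b x} \<subseteq> U" using 2(1) hb(1)[of b] by simp_all
        moreover have "g' \<in> V" if "g' \<in> G" "\<forall>y\<in>{x, hb b x}. g' y = g y" for g'
        proof -
          have "g' x = g x" "g' (hb b x) = g (hb b x)" using that(2) by simp_all
          then have "\<exists>x\<in>U. below b i e x \<and> lt b i w x \<and> lt b i (hb b (g' x)) (g' (hb b x))"
            using 2 by metis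
          then show ?thesis using \<open>V = O1 b i e w\<close> that(1) unfolding O1_def by simp
        qed
        ultimately show ?thesis by blast
      qed
    qed
  next
    fix V g A assume V: "V \<in> \<O>" and g: "g \<in> G" and A: "finite A" "A \<subseteq> U"
    consider W F x where "V = P W F x" "W \<in> X" "F \<in> X" "x \<in> U" "x \<notin> W"
      | b i e w where "V = O1 b i e w" "i \<in> I" "set_option e \<subseteq> U" "w \<in> U" "below b i e w"
      using V unfolding \<O>_def by blast
    then show "\<exists>g'\<in>G. (\<forall>x\<in>A. g' x = g x) \<and> g' \<in> V"
    proof cases
      case 1
      \<comment> \<open>Now the commutator is \<open>k \<circ> h\<close>, and replacing
        \<open>g\<close> by \<open>g \<circ> inv c\<close> replaces \<open>k\<close> by
        \<open>conj_by c k\<close>.\<close>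
      define k where "k = conj_by (inv g) (inv h)"
      have hi: "inv h x \<noteq> x" if "x \<in> U" for x using h that by (auto simp: inv_eq_G) metis
      have k: "k \<in> G" "\<And>x. x \<in> U \<Longrightarrow> k x \<noteq> x"
        using g h conj_by_fixed_point_free[of "inv g" "inv h"] hi by (auto simp: k_def)
      obtain c d where c: "c \<in> stab A" and d: "d \<in> stab W" "d x \<notin> F"
        "free_ind {conj_by c k (h (d x))} (conj_by c k ` h ` W) (insert (d x) W)"
        using free_moving_dense[OF h k A, of W F x] 1 unfolding X_def by blast
      define g' where "g' = g \<circ> inv c"
      have g': "g' \<in> G" using g c by (simp add: g'_def)
      have agree: "\<forall>x\<in>A. g' x = g x" using stab_fix[OF stab_inv[OF c]] by (simp add: g'_def)
      have "inv g' = c \<circ> inv g"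
        using o_inv_distrib[of g "inv c"] g c by (simp add: g'_def G_bij)
      then have "comm g' = conj_by c k \<circ> h"
        using g c by (simp add: comm_def k_def conj_by_def g'_def fun_eq_iff)
      then have "g' \<in> V" using d g' 1(1) by (auto simp: P_def image_comp)
      then show ?thesis using g' agree by blast
    next
      case 2
      show ?thesis
      proof (cases "\<exists>\<beta>\<in>set_option e. g (hb b \<beta>) \<noteq> hb b (g \<beta>)")
        case True
        then show ?thesis using g 2 by (auto simp: O1_def)
      next
        case False
        then have "\<beta> \<in> U \<and> g (hb b \<beta>) = hb b (g \<beta>)" if "e = Some \<beta>" for \<beta> using 2 that by auto
        then show ?thesis
          using oscillation_dense[OF hb g A 2(2) _ 2(4,5), of b] 2(1) unfolding O1_def by blast
      qed
    qed
  qed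
  then obtain g where g: "g \<in> G" "\<And>V. V \<in> \<O> \<Longrightarrow> g \<in> V" by blast
  have cg: "comm g \<in> G" using g(1) h by (simp add: comm_def)
  have icg: "inv (comm g) x = inv h (inv g (h (g x)))" for x
    using cg g(1) h by (simp add: inv_eq_G comm_def)
  have "free_moving (comm g)"
    unfolding free_moving_def
  proof (intro allI impI)
    fix W F x assume "finite W" "W \<subseteq> U" "finite F" "F \<subseteq> U" "x \<in> U" "x \<notin> W"
    then have "P W F x \<in> \<O>" unfolding \<O>_def X_def by blast
    then have "g \<in> P W F x" by (rule g(2))
    then show "\<exists>c\<in>stab W. c x \<notin> F \<and> free_ind {comm g (c x)} (comm g ` W) (insert (c x) W)"
      unfolding P_def by blast
  qed
  moreover have "osc True i (comm g)" if i: "i \<in> I" for i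
    unfolding osc_def
  proof (intro allI ballI impI)
    fix e w assume w: "w \<in> U" and e: "set_option e \<subseteq> U" "below True i e w" "map_option (comm g) e = e"
    have "O1 True i e w \<in> \<O>" unfolding \<O>_def using i w e by blast
    then have gO: "g \<in> O1 True i e w" by (rule g(2))
    have "g (h \<beta>) = h (g \<beta>)" if "\<beta> \<in> set_option e" for \<beta>
    proof -
      have "comm g \<beta> = \<beta>" using e(3) that by (cases e) auto
      then show ?thesis using g(1) h by (simp add: comm_def inv_eq_G)
    qed
    then obtain x where x: "x \<in> U" "below True i e x" "lt True i w x" "lt True i (h (g x)) (g (h x))"
      using gO unfolding O1_def hb_def by auto
    have "h (g (comm g x)) = g (h x)" using g(1) h by (simp add: comm_def)
    then have "lt True i (h (g x)) (h (g (comm g x)))" using x(4) by simp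
    then have "lt True i x (comm g x)" using lt_G[OF h(1)] lt_G[OF g(1)] by blast
    then show "\<exists>x\<in>U. below True i e x \<and> lt True i w x \<and> lt True i x (comm g x)" using x by blast
  qed
  moreover have "osc False i (inv (comm g))" if i: "i \<in> I" for i
    unfolding osc_def
  proof (intro allI ballI impI)
    fix e w assume w: "w \<in> U" and e: "set_option e \<subseteq> U" "below False i e w"
      "map_option (inv (comm g)) e = e"
    \<comment> \<open>Passing to the commutator with \<open>inv h\<close> is a conjugation by
      \<open>h\<close>, so ends and points are transported by \<open>h\<close>.\<close>
    let ?e = "map_option h e"
    have "below False i ?e (h w)" using e(2) h by (cases e) auto
    then have "O1 False i ?e (h w) \<in> \<O>"
      unfolding \<O>_def using i w e h by (fastforce simp: option.set_map)
    then have gO: "g \<in> O1 False i ?e (h w)" by (rule g(2))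
    have "g (inv h \<beta>) = inv h (g \<beta>)" if \<beta>: "\<beta> \<in> set_option ?e" for \<beta>
    proof -
      obtain \<beta>' where \<beta>': "e = Some \<beta>'" "\<beta> = h \<beta>'" using \<beta> by (cases e) auto
      then have "inv (comm g) \<beta>' = \<beta>'" using e(3) by simp
      then have "comm g \<beta>' = \<beta>'" using cg by (simp add: inv_eq_G)
      then have "g (h \<beta>') = h (g \<beta>')" using g(1) h by (simp add: comm_def inv_eq_G)
      then show ?thesis using \<beta>' h by (simp add: inv_eq_G)
    qed
    then obtain y where y: "y \<in> U" "below False i ?e y" "lt False i (h w) y"
        "lt False i (inv h (g y)) (g (inv h y))"
      using gO unfolding O1_def hb_def by auto
    define x where "x = inv h y"
    have yx: "y = h x" "x \<in> U" using h y by (simp_all add: x_def)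
    have "below False i e x" using y(2) h yx by (cases e) auto
    moreover have "lt False i w x" using y(3) h yx by simp
    moreover have "lt False i x (inv (comm g) x)"
    proof -
      have "lt False i (h (inv h (g (h x)))) (h (g x))" 
        using y(4) h yx lt_G[OF h(1), of False i "inv h (g (h x))" "g x"] by simp
      then have "lt False i (g (h x)) (g (h (inv (comm g) x)))" using h g by (simp add: icg)
      then show ?thesis using lt_G[OF h(1)] lt_G[OF g(1)] by blast
    qed
    ultimately show "\<exists>x\<in>U. below False i e x \<and> lt False i w x \<and> lt False i x (inv (comm g) x)"
      using yx by blast
  qed
  ultimately have "good (comm g)" using cg by (simp add: good_def)
  then show ?thesis using g(1) by (auto simp: comm_def)
qed

lemma osc_conj:
  assumes a: "a \<in> G" and k: "k \<in> G" "osc b i k" shows "osc b i (conj_by a k)"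
  unfolding osc_def
proof (intro allI ballI impI)
  fix e w assume w: "w \<in> U" and e: "set_option e \<subseteq> U" "below b i e w" "map_option (conj_by a k) e = e"
  let ?e = "map_option (inv a) e"
  have 1: "set_option ?e \<subseteq> U" using e a by (cases e) auto
  have below: "below b i ?e (inv a x) \<longleftrightarrow> below b i e x" for x
    using lt_G[OF G_inv[OF a]] by (cases e) auto
  have 2: "map_option k ?e = ?e"
  proof (cases e)
    case (Some \<beta>)
    then have "conj_by a k \<beta> = \<beta>" using e(3) by simp
    then show ?thesis using a Some by (metis comp_apply conj_by_def inv_f_G option.simps(9))
  qed simp
  have "inv a w \<in> U" using a w by simp
  then obtain x where x: "x \<in> U" "below b i ?e x" "lt b i (inv a w) x" "lt b i x (k x)"
    using k(2) below[of w] e(2) 1 2 unfolding osc_def by blast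
  have "below b i e (a x)" using below[of "a x"] x a by simp
  moreover have "lt b i w (a x)" using lt_G[OF a, of b i "inv a w" x] x a by simp
  moreover have "lt b i (a x) (conj_by a k (a x))" using x a by (simp add: conj_by_apply)
  ultimately show "\<exists>x\<in>U. below b i e x \<and> lt b i w x \<and> lt b i x (conj_by a k x)"
    using x a by (intro bexI[of _ "a x"]) auto
qed

lemma free_moving_conj:
  assumes a: "a \<in> G" and k: "k \<in> G" "free_moving k" shows "free_moving (conj_by a k)"
  unfolding free_moving_def
proof (intro allI impI)
  fix W F x assume W: "finite W" "W \<subseteq> U" and F: "finite F" "F \<subseteq> U" and x: "x \<in> U" "x \<notin> W"
  have "inv a x \<notin> inv a ` W" using x G_image_mem[OF G_inv[OF a]] by blast
  moreover have "inv a ` W \<subseteq> U" "inv a ` F \<subseteq> U" "inv a x \<in> U" using a W F x by simp_all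
  ultimately obtain c where c: "c \<in> stab (inv a ` W)" "c (inv a x) \<notin> inv a ` F"
      "free_ind {k (c (inv a x))} (k ` inv a ` W) (insert (c (inv a x)) (inv a ` W))"
    using k(2) W(1) F(1) unfolding free_moving_def by (meson finite_imageI)
  define d where "d = conj_by a c"
  have d: "d \<in> stab W" using a c stab_fix[OF c(1)] unfolding stab_def by (auto simp: d_def conj_by_def)
  have dx: "d x = a (c (inv a x))" by (simp add: d_def conj_by_def)
  have "inv a (d x) \<notin> inv a ` F" using c(2) a by (simp add: dx)
  then have "d x \<notin> F" by blast
  moreover have "free_ind {conj_by a k (d x)} (conj_by a k ` W) (insert (d x) W)"
  proof -
    have "a ` k ` inv a ` W = conj_by a k ` W" by (simp add: conj_by_def image_comp)
    moreover have "a (k (c (inv a x))) = conj_by a k (d x)" using a by (simp add: dx conj_by_apply)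
    moreover have "a ` insert (c (inv a x)) (inv a ` W) = insert (d x) W" using a by (simp add: dx)
    ultimately show ?thesis using free_ind_G[OF a c(3)] by simp
  qed
  ultimately show "\<exists>c\<in>stab W. c x \<notin> F \<and>
      free_ind {conj_by a k (c x)} (conj_by a k ` W) (insert (c x) W)"
    using d by blast
qed

lemma good_conj: "a \<in> G \<Longrightarrow> good k \<Longrightarrow> good (conj_by a k)"
  unfolding good_def using osc_conj free_moving_conj by (auto simp: conj_by_inv)

lemma ind_right_trans: "ind A B D \<Longrightarrow> ind A (B \<union> D) C \<Longrightarrow> ind A B (C \<union> D)"
  unfolding ind_def by (blast intro: free_ind_right_trans ord_ind_right_trans)

text \<open>Over the empty set \<open>ext\<close> allows the cuts to be prescribed in each order
  independently. In the other orders the point goes beyond \<open>V\<close> on one side, where it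
  cannot interfere.\<close>

lemma orbit_interval_point:
  assumes i: "i \<in> I" and V: "finite V" "V \<subseteq> U" and pq: "lt b i p q" and x: "x \<in> U"
  shows "\<exists>g\<in>G. lt b i p (g x) \<and> lt b i (g x) q \<and> (\<forall>j\<in>I. j \<noteq> i \<longrightarrow> (\<forall>v\<in>V. lt b j (g x) v))"
proof -
  define C where "C = V \<union> {p, q}"
  have pqU: "p \<in> U" "q \<in> U" using lt_U[OF pq] by auto
  have C: "finite C" "C \<subseteq> U" using V pqU by (auto simp: C_def)
  \<comment> \<open>In order \<open>i\<close> the cut just after the smaller of \<open>p\<close> and
    \<open>q\<close>; in the other orders the cut before or after everything.\<close>
  define D where "D j = (if j = i then {c \<in> C. le True i c (if b then p else q)}
      else if b then {} else C)" for j
  have "\<exists>g\<in>stab {}. g x \<notin> C \<and> (\<forall>j\<in>I. \<forall>c\<in>C. lt True j c (g x) \<longleftrightarrow> c \<in> D j) \<and> free_ind {g x} {} C"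
  proof (rule ext[OF C _ x])
    fix j c d assume "j \<in> I" "c \<in> C" "d \<in> D j" "lt True j c d"
    then show "c \<in> D j" using lt_le_trans[of j True c d] unfolding D_def le_def by (auto split: if_splits)
  qed (auto simp: D_def)
  then obtain g where g: "g \<in> G" "g x \<notin> C" "\<And>j c. j \<in> I \<Longrightarrow> c \<in> C \<Longrightarrow> lt True j c (g x) \<longleftrightarrow> c \<in> D j"
    using stab_G by metis
  have gU: "g x \<in> U" using g x by simp
  have above: "lt True j (g x) c" if "j \<in> I" "c \<in> C" "c \<notin> D j" for j c
    using that g(3)[of j c] lt_total[OF that(1) gU, of c True] C g(2) by blast
  have D: "p \<in> D i \<longleftrightarrow> b" "q \<in> D i \<longleftrightarrow> \<not> b"
    using pq lt_irrefl[OF i] lt_asym[OF i, of True p q] lt_asym[OF i, of True q p]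
    by (cases b; auto simp: D_def C_def le_def lt_False)+
  have pC: "p \<in> C" "q \<in> C" by (auto simp: C_def)
  have "lt b i p (g x)" "lt b i (g x) q"
    using D g(3)[OF i pC(1)] g(3)[OF i pC(2)] above[OF i pC(1)] above[OF i pC(2)]
    by (cases b; simp add: lt_False)+
  moreover have "lt b j (g x) v" if j: "j \<in> I" "j \<noteq> i" "v \<in> V" for j v
  proof -
    have "v \<in> C" "v \<in> D j \<longleftrightarrow> \<not> b" using j by (auto simp: D_def C_def)
    then show ?thesis using g(3)[OF j(1), of v] above[OF j(1), of v] by (cases b) (simp_all add: lt_False)
  qed
  ultimately show ?thesis using g(1) by blast
qed

lemma interval_point:
  assumes i: "i \<in> I" and V: "finite V" "V \<subseteq> U" and pq: "lt b i p q"
  shows "\<exists>x\<in>U. lt b i p x \<and> lt b i x q \<and> (\<forall>j\<in>I. j \<noteq> i \<longrightarrow> (\<forall>v\<in>V. lt b j x v))"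
proof -
  obtain x where x: "x \<in> U" using U_ne by blast
  from orbit_interval_point[OF assms x] obtain g where "g \<in> G" "lt b i p (g x)" "lt b i (g x) q"
    "\<forall>j\<in>I. j \<noteq> i \<longrightarrow> (\<forall>v\<in>V. lt b j (g x) v)" by (elim bexE conjE)
  then show ?thesis using x by (intro bexI[of _ "g x"]) simp_all
qed

lemma exists_below:
  assumes i: "i \<in> I" and e: "set_option e \<subseteq> U"
  shows "\<exists>x\<in>U. below b i e x"
proof (cases e)
  case None
  then show ?thesis using U_ne by auto
next
  case (Some \<beta>)
  obtain g where g: "g \<in> stab {}" "ord_ind (\<lambda>_. \<not> b) {g \<beta>} {} {\<beta>}"
    using existence_point[of "{}" "{\<beta>}" \<beta>] e Some by auto
  have "\<not> le (\<not> b) i (g \<beta>) \<beta>" using ord_indD[OF g(2) i, of "g \<beta>" \<beta>] by auto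
  moreover have gU: "g \<beta> \<in> U" "\<beta> \<in> U" using g(1) e Some by simp_all
  ultimately have "lt b i (g \<beta>) \<beta>" using not_le[OF i gU, of "\<not> b"] lt_flip by blast
  then show ?thesis using Some gU by auto
qed

text \<open>Points just below the ends in \<open>\<Gamma>\<close>, arranged so that \<open>k\<close> pushes the point chosen below an
  end beyond the point chosen below its image.  For ends fixed by \<open>k\<close> this needs oscillation; the
  other ends form finite chains and are treated starting from the last one.\<close>

lemma end_points:
  assumes k: "k \<in> G" "osc b i k" and i: "i \<in> I"
    and \<Gamma>: "finite \<Gamma>" "\<And>e. e \<in> \<Gamma> \<Longrightarrow> set_option e \<subseteq> U" and V: "finite V" "V \<subseteq> U"
  shows "\<exists>w. \<forall>e\<in>\<Gamma>. w e \<in> U \<and> below b i e (w e) \<and> (\<forall>v\<in>V. below b i e v \<longrightarrow> lt b i v (w e)) \<and>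
     (\<forall>j\<in>I. j \<noteq> i \<longrightarrow> (\<forall>v\<in>V. lt b j (w e) v)) \<and>
     (map_option k e \<in> \<Gamma> \<longrightarrow> lt b i (w (map_option k e)) (k (w e)))"
  using \<Gamma>
proof (induction \<Gamma> rule: finite_psubset_induct)
  case (psubset \<Gamma>)
  have near: "\<exists>x\<in>U. below b i e x \<and> (\<forall>v\<in>C. below b i e v \<longrightarrow> lt b i v x)"
    if "e \<in> \<Gamma>" "finite C" "C \<subseteq> U" for e C
    using exists_below[OF i psubset.prems[OF that(1)]] point_near_end[OF i that(2,3) psubset.prems[OF that(1)]]
    by blast
  have below_trans: "lt b i x y \<Longrightarrow> below b i e y \<Longrightarrow> below b i e x" for x y e
    using lt_trans[OF i] by (cases e) auto
  have below_k: "below b i (map_option k e) (k x) \<longleftrightarrow> below b i e x" for e x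
    using k(1) by (cases e) auto
  show ?case
  proof (cases "\<exists>e0\<in>\<Gamma>. e0 \<notin> map_option k ` \<Gamma>")
    case True
    \<comment> \<open>An end that is not an image enters the constraint of no other end, so its
      witness can be chosen after all the others.\<close>
    then obtain e0 where e0: "e0 \<in> \<Gamma>" "e0 \<notin> map_option k ` \<Gamma>" by blast
    have sub: "\<Gamma> - {e0} \<subset> \<Gamma>" using e0 by blast
    have pr: "\<And>e. e \<in> \<Gamma> - {e0} \<Longrightarrow> set_option e \<subseteq> U" using psubset.prems by blast
    from psubset.IH[OF sub pr] obtain w where w: "\<forall>e\<in>\<Gamma> - {e0}. w e \<in> U \<and> below b i e (w e) \<and>
       (\<forall>v\<in>V. below b i e v \<longrightarrow> lt b i v (w e)) \<and> (\<forall>j\<in>I. j \<noteq> i \<longrightarrow> (\<forall>v\<in>V. lt b j (w e) v)) \<and>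
       (map_option k e \<in> \<Gamma> - {e0} \<longrightarrow> lt b i (w (map_option k e)) (k (w e)))"
      by (rule exE)
    note w = bspec[OF w]
    define ke where "ke = map_option k e0"
    have ke: "ke \<noteq> e0" using e0 by (metis imageI ke_def)
    define C where "C = V \<union> (if ke \<in> \<Gamma> then {inv k (w ke)} else {})"
    have C: "finite C" "C \<subseteq> U" using V w[of ke] ke k(1) by (auto simp: C_def)
    obtain p where p: "p \<in> U" "below b i e0 p" "\<And>v. v \<in> C \<Longrightarrow> below b i e0 v \<Longrightarrow> lt b i v p"
      using near[OF e0(1) C] by blast
    have "finite (insert p C)" "insert p C \<subseteq> U" using p C by auto
    then obtain q where q: "q \<in> U" "below b i e0 q" "lt b i p q"
      using near[OF e0(1), of "insert p C"] p(2) by blast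
    obtain x where x: "x \<in> U" "lt b i p x" "lt b i x q" "\<forall>j\<in>I. j \<noteq> i \<longrightarrow> (\<forall>v\<in>V. lt b j x v)"
      using interval_point[OF i V q(3)] by blast
    have xe: "below b i e0 x" using below_trans[OF x(3) q(2)] .
    have xC: "lt b i v x" if "v \<in> C" "below b i e0 v" for v
      using p(3)[OF that] lt_trans[OF i _ x(2)] by blast
    have step: "lt b i (w ke) (k x)" if "ke \<in> \<Gamma>"
    proof -
      have wke: "below b i ke (w ke)" using w[of ke] that ke by blast
      have "inv k (w ke) \<in> C" using that by (simp add: C_def)
      moreover have "below b i e0 (inv k (w ke))"
        using below_k[of e0 "inv k (w ke)"] wke k(1) by (simp add: ke_def)
      ultimately have "lt b i (inv k (w ke)) x" by (rule xC)
      then show ?thesis using lt_G[OF k(1), of b i "inv k (w ke)" x] k(1) by simp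
    qed
    define w' where "w' = w(e0 := x)"
    have "w' e \<in> U \<and> below b i e (w' e) \<and> (\<forall>v\<in>V. below b i e v \<longrightarrow> lt b i v (w' e)) \<and>
     (\<forall>j\<in>I. j \<noteq> i \<longrightarrow> (\<forall>v\<in>V. lt b j (w' e) v)) \<and>
     (map_option k e \<in> \<Gamma> \<longrightarrow> lt b i (w' (map_option k e)) (k (w' e)))" if e: "e \<in> \<Gamma>" for e
    proof (cases "e = e0")
      case True
      have "\<forall>v\<in>V. below b i e0 v \<longrightarrow> lt b i v x" using xC by (simp add: C_def)
      then show ?thesis using True x(1,4) xe step ke by (simp add: w'_def ke_def)
    next
      case False
      then have "map_option k e \<noteq> e0" using e0 e by blast
      then show ?thesis using w[of e] e False by (simp add: w'_def)
    qed
    then show ?thesis by blast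
  next
    case False
    \<comment> \<open>Now \<open>k\<close> permutes the finite set \<open>\<Gamma>\<close> and
      preserves the order, so it fixes every end and oscillation applies to all of them.\<close>
    then have sub: "\<Gamma> \<subseteq> map_option k ` \<Gamma>" by blast
    have surj: "map_option k ` \<Gamma> = \<Gamma>"
      using card_seteq[OF finite_imageI[OF psubset.hyps] sub card_image_le[OF psubset.hyps]] by simp
    define S where "S = {\<beta>. Some \<beta> \<in> \<Gamma> \<and> k \<beta> \<noteq> \<beta>}"
    have finS: "finite S" "S \<subseteq> U"
      using finite_vimageI[OF psubset.hyps, of Some] psubset.prems
      by (auto simp: S_def vimage_def elim: rev_finite_subset)
    have "S = {}"
    proof (rule ccontr)
      assume "S \<noteq> {}"
      then obtain m where m: "m \<in> S" "\<forall>s\<in>S. le b i s m" using finite_has_max[OF i finS(1) _ finS(2)] by blast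
      have mG: "Some m \<in> \<Gamma>" "k m \<noteq> m" using m by (auto simp: S_def)
      have "Some (k m) \<in> \<Gamma>" using surj mG(1) by force
      then have "k m \<in> S" using mG G_inj[OF k(1)] by (simp add: S_def)
      then have km: "lt b i (k m) m" using m mG by (auto simp: le_def)
      have "Some m \<in> map_option k ` \<Gamma>" using mG surj by simp
      then obtain m' where m': "Some m' \<in> \<Gamma>" "m = k m'" by (auto simp: image_iff) (metis option.exhaust option.simps(8,9) option.inject option.distinct(1))
      then have "m' \<in> S" using mG by (auto simp: S_def)
      then have "le b i m' m" using m by blast
      then have "le b i m (k m)" using m' k(1) by simp
      then show False using km lt_le_trans[OF i] lt_irrefl[OF i] by blast
    qed
    then have fixed: "map_option k e = e" if "e \<in> \<Gamma>" for e using that by (cases e) (auto simp: S_def)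
    have "\<exists>x\<in>U. below b i e x \<and> (\<forall>v\<in>V. below b i e v \<longrightarrow> lt b i v x) \<and>
        (\<forall>j\<in>I. j \<noteq> i \<longrightarrow> (\<forall>v\<in>V. lt b j x v)) \<and> lt b i x (k x)" if e: "e \<in> \<Gamma>" for e
    proof -
      obtain p where p: "p \<in> U" "below b i e p" "\<And>v. v \<in> V \<Longrightarrow> below b i e v \<Longrightarrow> lt b i v p"
        using near[OF e V] by blast
      obtain x where x: "x \<in> U" "below b i e x" "lt b i p x" "lt b i x (k x)"
        using k(2) p psubset.prems[OF e] fixed[OF e] unfolding osc_def by blast
      \<comment> \<open>\<open>osc\<close> gives no control in the other orders. But each
        \<open>y\<close> strictly between \<open>inv k x\<close> and \<open>x\<close> satisfies
        \<open>y < x < k y\<close>, which leaves a whole interval for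
        \<open>interval_point\<close>.\<close>
      have ix: "lt b i (inv k x) x" using lt_G[OF k(1), of b i "inv k x" x] x k(1) by simp
      have "\<exists>m\<in>U. le b i p m \<and> le b i (inv k x) m \<and> lt b i m x"
        using lt_total[OF i p(1), of "inv k x" b] x(1,3) ix p(1) k(1) unfolding le_def by fastforce
      then obtain m where m: "m \<in> U" "le b i p m" "le b i (inv k x) m" "lt b i m x" by blast
      obtain y where y: "y \<in> U" "lt b i m y" "lt b i y x" "\<forall>j\<in>I. j \<noteq> i \<longrightarrow> (\<forall>v\<in>V. lt b j y v)"
        using interval_point[OF i V m(4)] by blast
      have "below b i e y" using below_trans[OF y(3) x(2)] .
      moreover have "lt b i v y" if "v \<in> V" "below b i e v" for v
        using p(3)[OF that] lt_le_trans[OF i _ m(2)] lt_trans[OF i _ y(2)] by blast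
      moreover have "lt b i y (k y)"
      proof -
        have "lt b i (inv k x) y" using le_lt_trans[OF i m(3) y(2)] .
        then have "lt b i x (k y)" using lt_G[OF k(1), of b i "inv k x" y] k(1) by simp
        then show ?thesis using lt_trans[OF i y(3)] by blast
      qed
      ultimately show ?thesis using y by blast
    qed
    then obtain w where "\<And>e. e \<in> \<Gamma> \<Longrightarrow> w e \<in> U \<and> below b i e (w e) \<and>
        (\<forall>v\<in>V. below b i e v \<longrightarrow> lt b i v (w e)) \<and>
        (\<forall>j\<in>I. j \<noteq> i \<longrightarrow> (\<forall>v\<in>V. lt b j (w e) v)) \<and> lt b i (w e) (k (w e))"
      by metis
    then show ?thesis using fixed by (intro exI[of _ w]) simp
  qed
qed

end

section \<open>Moving conjugates into independent position\<close>

context generic_struc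
begin

lemma stab_lt:
  assumes "g \<in> stab B" "v \<in> B"
  shows "lt b i (g x) v \<longleftrightarrow> lt b i x v" "lt b i v (g x) \<longleftrightarrow> lt b i v x"
  using lt_G[OF stab_G[OF assms(1)], of b i x v] lt_G[OF stab_G[OF assms(1)], of b i v x]
    stab_fix[OF assms] by simp_all

lemma stab_below: "g \<in> stab B \<Longrightarrow> set_option e \<subseteq> B \<Longrightarrow> below b i e (g x) \<longleftrightarrow> below b i e x"
  using stab_lt(1)[of g B] by (cases e) auto

lemma stab_disjoint: "g \<in> stab B \<Longrightarrow> A \<inter> B = {} \<Longrightarrow> g ` A \<inter> B = {}"
  using stab_image[of g B B] by (metis G_bij bij_is_inj image_Int image_empty order_refl stab_G)

lemma end_points_family:
  assumes k: "k \<in> G" "\<And>i. i \<in> I \<Longrightarrow> osc b i k"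
    and \<Gamma>: "finite \<Gamma>" "\<And>e. e \<in> \<Gamma> \<Longrightarrow> set_option e \<subseteq> U" and V: "finite V" "V \<subseteq> U"
  shows "\<exists>w. \<forall>i\<in>I. \<forall>e\<in>\<Gamma>. w i e \<in> U \<and> below b i e (w i e) \<and>
     (\<forall>v\<in>V. below b i e v \<longrightarrow> lt b i v (w i e)) \<and>
     (\<forall>j\<in>I. j \<noteq> i \<longrightarrow> (\<forall>v\<in>V. lt b j (w i e) v)) \<and>
     (map_option k e \<in> \<Gamma> \<longrightarrow> lt b i (w i (map_option k e)) (k (w i e)))"
  by (rule bchoice, rule ballI, rule end_points) (use assms in auto)

lemma end_above:
  assumes i: "i \<in> I" and X: "finite X" "X \<subseteq> U" and s: "s \<in> U" "s \<notin> X"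
  shows "\<exists>e\<in>insert None (Some ` X). below b i e s \<and>
    (\<forall>\<beta>\<in>X. le b i s \<beta> \<longrightarrow> (\<exists>\<beta>0. e = Some \<beta>0 \<and> le b i \<beta>0 \<beta>))"
proof (cases "{\<beta> \<in> X. le b i s \<beta>} = {}")
  case True
  then show ?thesis by (intro bexI[of _ None]) auto
next
  case False
  have "finite {\<beta> \<in> X. le b i s \<beta>}" "{\<beta> \<in> X. le b i s \<beta>} \<subseteq> U" using X by auto
  then obtain m where m: "m \<in> X" "le b i s m" "\<And>\<beta>. \<beta> \<in> X \<Longrightarrow> le b i s \<beta> \<Longrightarrow> le (\<not> b) i \<beta> m"
    using finite_has_max[OF i _ False, of "\<not> b"] by blast
  have "lt b i s m" using m s by (auto simp: le_def)
  then show ?thesis using m(1,3) le_flip by (intro bexI[of _ "Some m"]) auto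
qed

text \<open>\<open>free_moving_set\<close> provides the freeness. For the orders,
  \<open>end_points\<close> yields a witness \<open>w i e\<close> just before each end
  \<open>e\<close>, and points of \<open>S\<close> whose next end is \<open>e\<close> are squeezed
  between \<open>inv k (w i (k e))\<close> and \<open>w i e\<close> whenever \<open>k e\<close> is
  again an end of \<open>X\<close>. Their images then lie beyond \<open>w i (k e)\<close>, hence
  beyond all points of \<open>S\<close> before \<open>k e\<close>.\<close>

lemma push_tuple:
  assumes good: "good k" and X: "finite X" "X \<subseteq> U" and S: "finite S" "S \<subseteq> U" "S \<inter> X = {}"
    and indS: "ind S X (k ` X)"
  shows "\<exists>c\<in>stab (X \<union> k ` X). ind (k ` c ` S) (k ` X) (X \<union> c ` S)"
proof -
  have k: "k \<in> G" "free_moving k" "\<And>i. i \<in> I \<Longrightarrow> osc True i k" using good by (auto simp: good_def)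
  define Y where "Y = k ` X"
  define W where "W = X \<union> Y \<union> inv k ` X"
  have fin: "finite Y" "Y \<subseteq> U" "finite W" "W \<subseteq> U" using X k by (auto simp: Y_def W_def)
  have XW: "X \<subseteq> W" "Y \<subseteq> W" "inv k ` X \<subseteq> W" by (auto simp: W_def)
  have finXY: "finite (X \<union> Y)" "X \<union> Y \<subseteq> U" using fin X by auto
  obtain c0 where c0: "c0 \<in> stab (X \<union> Y)" "ind (c0 ` S) (X \<union> Y) W"
    using existence[OF S(1) finXY(1) fin(3) S(2) finXY(2) fin(4)] by blast
  define S1 where "S1 = c0 ` S"
  have S1: "finite S1" "S1 \<subseteq> U" using S c0 by (auto simp: S1_def)
  have "ind S1 X Y"
    using ind_G[OF stab_G[OF c0(1)] indS] stab_image[OF c0(1), of X] stab_image[OF c0(1), of Y]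
    by (simp add: S1_def Y_def)
  then have "ind S1 X (W \<union> Y)" using ind_right_trans c0(2) unfolding S1_def by blast
  then have S1W: "ind S1 X W" by (rule ind_mono) auto
  have "S1 \<inter> X = {}"
    using stab_disjoint[OF stab_mono[OF c0(1), of X]] S(3) by (simp add: S1_def)
  then have S1W': "S1 \<inter> W = {}" using S1W by (auto simp: ind_def free_ind_def)
  define \<Gamma> where "\<Gamma> = insert None (Some ` X)"
  define V where "V = S1 \<union> W"
  have \<Gamma>: "finite \<Gamma>" "\<And>e. e \<in> \<Gamma> \<Longrightarrow> set_option e \<subseteq> X" using X by (auto simp: \<Gamma>_def)
  have \<Gamma>U: "\<And>e. e \<in> \<Gamma> \<Longrightarrow> set_option e \<subseteq> U" using \<Gamma>(2) X(2) by blast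
  have V: "finite V" "V \<subseteq> U" using S1 fin by (auto simp: V_def)
  obtain w where w0: "\<forall>i\<in>I. \<forall>e\<in>\<Gamma>. w i e \<in> U \<and> below True i e (w i e) \<and>
     (\<forall>v\<in>V. below True i e v \<longrightarrow> lt True i v (w i e)) \<and>
     (\<forall>j\<in>I. j \<noteq> i \<longrightarrow> (\<forall>v\<in>V. lt True j (w i e) v)) \<and>
     (map_option k e \<in> \<Gamma> \<longrightarrow> lt True i (w i (map_option k e)) (k (w i e)))"
    using end_points_family[where b=True, OF k(1) k(3) \<Gamma>(1) \<Gamma>U V] by (rule exE)
  have w: "\<And>i e. i \<in> I \<Longrightarrow> e \<in> \<Gamma> \<Longrightarrow> w i e \<in> U"
    "\<And>i e. i \<in> I \<Longrightarrow> e \<in> \<Gamma> \<Longrightarrow> below True i e (w i e)"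
    "\<And>i e v. i \<in> I \<Longrightarrow> e \<in> \<Gamma> \<Longrightarrow> v \<in> V \<Longrightarrow> below True i e v \<Longrightarrow> lt True i v (w i e)"
    "\<And>i j e v. i \<in> I \<Longrightarrow> e \<in> \<Gamma> \<Longrightarrow> j \<in> I \<Longrightarrow> j \<noteq> i \<Longrightarrow> v \<in> V \<Longrightarrow> lt True j (w i e) v"
    "\<And>i e. i \<in> I \<Longrightarrow> e \<in> \<Gamma> \<Longrightarrow> map_option k e \<in> \<Gamma> \<Longrightarrow>
        lt True i (w i (map_option k e)) (k (w i e))"
    using w0 by simp_all
  define Ws where "Ws = (\<Union>i\<in>I. w i ` \<Gamma>)"
  have Ws: "finite Ws" "Ws \<subseteq> U" using finite_I \<Gamma>(1) w(1) by (auto simp: Ws_def)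
  have WsV: "Ws \<inter> V = {}" using w(2,3) lt_irrefl by (fastforce simp: Ws_def)
  define W1 where "W1 = W \<union> Ws"
  \<comment> \<open>The lower bounds of the squeeze; the tuple is placed to the right of them over
    \<open>W1\<close>.\<close>
  define K where "K = inv k ` Ws"
  have W1: "finite W1" "W1 \<subseteq> U" "finite K" "K \<subseteq> U" using fin Ws k by (auto simp: W1_def K_def)
  obtain c1 where c1: "c1 \<in> stab W1" "ind (c1 ` S1) W1 K"
    using existence[OF S1(1) W1(1) W1(3) S1(2) W1(2) W1(4)] by blast
  define S2 where "S2 = c1 ` S1"
  define W2 where "W2 = W1 \<union> K"
  have S2: "finite S2" "S2 \<subseteq> U" "finite W2" "W2 \<subseteq> U" using S1 c1 W1 by (auto simp: S2_def W2_def)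
  have "S1 \<inter> W1 = {}" using S1W' WsV by (auto simp: W1_def V_def)
  then have "S2 \<inter> W1 = {}" using stab_disjoint[OF c1(1)] by (simp add: S2_def)
  then have S2W2: "S2 \<inter> W2 = {}" using c1(2) by (auto simp: W2_def ind_def free_ind_def S2_def)
  have F: "finite (k ` Ws)" "k ` Ws \<subseteq> U" using Ws k by auto
  obtain c2 where c2: "c2 \<in> stab W2" "c2 ` (S2 - W2) \<inter> k ` Ws = {}"
      "free_ind (k ` c2 ` S2) (k ` W2) (W2 \<union> c2 ` S2)"
    using free_moving_set[OF k(1,2) S2(3,4) F S2(1,2)] by blast
  define S3 where "S3 = c2 ` S2"
  have S3U: "S3 \<subseteq> U" using S2 c2 by (auto simp: S3_def)
  have S3W2: "S3 \<inter> W2 = {}" using stab_disjoint[OF c2(1) S2W2] by (simp add: S3_def)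
  have "S2 - W2 = S2" using S2W2 by blast
  then have S3F: "S3 \<inter> k ` Ws = {}" using c2(2) by (simp add: S3_def)
  have c21: "c2 \<circ> c1 \<in> stab W1" using c1 stab_mono[OF c2(1)] by (simp add: W2_def)
  have S3_eq: "S3 = (c2 \<circ> c1) ` S1" by (simp add: S3_def S2_def image_comp)
  have "(c2 \<circ> c1) ` X = X" "(c2 \<circ> c1) ` W = W"
    by (rule stab_image[OF c21]; use XW in \<open>auto simp: W1_def\<close>)+
  then have S3X: "ind S3 X W"
    using ind_G[OF stab_G[OF c21] S1W] unfolding S3_eq by metis
  have "ind S3 W1 K"
    using ind_G[OF stab_G[OF c2(1)] c1(2)] stab_image[OF c2(1), of W1] stab_image[OF c2(1), of K]
    by (simp add: S3_def S2_def W2_def)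
  then have oK: "ord_ind (\<lambda>_. True) S3 W1 K" by (simp add: ind_def)
  have oX: "ord_ind (\<lambda>_. True) S3 X W" using S3X by (simp add: ind_def)
  have natural: "lt True i s (w i e)" if i: "i \<in> I" and e: "e \<in> \<Gamma>" and s: "s \<in> S3" "below True i e s" for i e s
  proof -
    obtain s1 where s1: "s1 \<in> S1" "s = (c2 \<circ> c1) s1" using s by (auto simp: S3_eq)
    have "set_option e \<subseteq> W1" using \<Gamma>(2)[OF e] XW by (auto simp: W1_def)
    then have "below True i e s1" using s stab_below[OF c21] s1 by metis
    then have "lt True i s1 (w i e)" using w(3)[OF i e] s1 by (simp add: V_def)
    moreover have "w i e \<in> W1" using i e by (auto simp: W1_def Ws_def)
    ultimately show ?thesis using stab_lt(1)[OF c21] s1 by metis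
  qed
  have natural': "lt True i (w j e) s" if ij: "i \<in> I" "j \<in> I" "i \<noteq> j" and e: "e \<in> \<Gamma>" and s: "s \<in> S3" for i j e s
  proof -
    obtain s1 where s1: "s1 \<in> S1" "s = (c2 \<circ> c1) s1" using s by (auto simp: S3_eq)
    have "lt True i (w j e) s1" using w(4)[OF ij(2) e ij(1,3)] s1 by (simp add: V_def)
    moreover have "w j e \<in> W1" using ij e by (auto simp: W1_def Ws_def)
    ultimately show ?thesis using stab_lt(2)[OF c21] s1 by metis
  qed
  have "free_ind (k ` S3) Y (X \<union> S3)"
  proof -
    have kW2: "k ` W2 = k ` W \<union> (k ` Ws \<union> Ws)" using k by (auto simp: W2_def W1_def K_def image_Un)
    have "free_ind (k ` S3) (k ` W2) (X \<union> S3)"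
      using c2(3) unfolding S3_def by (rule free_ind_mono) (use XW in \<open>auto simp: W2_def W1_def\<close>)
    moreover have "(k ` Ws \<union> Ws) \<inter> (k ` S3 \<union> (X \<union> S3)) = {}"
    proof -
      have "Ws \<inter> S3 = {}" using S3W2 by (auto simp: W2_def W1_def)
      then have "k ` Ws \<inter> k ` S3 = {}" using k(1) by (auto simp: G_inj)
      moreover have "Ws \<inter> k ` S3 = {}"
      proof (rule ccontr)
        assume "Ws \<inter> k ` S3 \<noteq> {}"
        then obtain s where s: "s \<in> S3" "k s \<in> Ws" by auto
        then have "inv k (k s) \<in> K" unfolding K_def by blast
        then show False using S3W2 s k by (auto simp: W2_def)
      qed
      moreover have "k ` Ws \<inter> X = {}"
      proof (rule ccontr)
        assume "k ` Ws \<inter> X \<noteq> {}"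
        then obtain v where v: "v \<in> Ws" "k v \<in> X" by auto
        then have "inv k (k v) \<in> W" using XW by blast
        then show False using WsV v k by (auto simp: V_def)
      qed
      moreover have "Ws \<inter> X = {}" using WsV XW by (auto simp: V_def)
      moreover have "k ` Ws \<inter> S3 = {}" using S3F by (simp add: Int_commute)
      ultimately show ?thesis using \<open>Ws \<inter> S3 = {}\<close> by (simp add: Int_Un_distrib Int_Un_distrib2)
    qed
    ultimately have "free_ind (k ` S3) (k ` W) (X \<union> S3)"
      using free_ind_drop_base[of "k ` S3" "k ` W" "k ` Ws \<union> Ws" "X \<union> S3"] unfolding kW2 by blast
    moreover have "Y \<union> k ` W = k ` W" using XW by (auto simp: Y_def)
    moreover have "free_ind (k ` S3) Y (k ` W)"
      using free_ind_G[OF k(1), of S3 X W] S3X by (simp add: ind_def Y_def)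
    ultimately have "free_ind (k ` S3) Y (X \<union> S3 \<union> k ` W)" using free_ind_right_trans by metis
    then show ?thesis by (rule free_ind_mono) auto
  qed
  moreover have "ord_ind (\<lambda>_. True) (k ` S3) Y (X \<union> S3)"
    unfolding ord_ind_def
  proof (intro ballI impI)
    fix i a z assume i: "i \<in> I" and a: "a \<in> k ` S3" and z: "z \<in> X \<union> S3" and az: "le True i a z"
    obtain s where s: "s \<in> S3" "a = k s" using a by auto
    have sU: "s \<in> U" using s S3U by auto
    have ksle: "le True i s (inv k y)" if "le True i a y" for y
      using that s le_G[OF k(1), of True i s "inv k y"] k(1) by simp
    have lek: "le True i (k x) y" if "le True i x (inv k y)" for x y
      using that le_G[OF k(1), of True i x "inv k y"] k(1) by simp
    show "\<exists>b\<in>Y. le True i a b \<and> le True i b z"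
    proof (cases "z \<in> X")
      case True
      then have "inv k z \<in> W" using XW by auto
      then obtain \<beta> where "\<beta> \<in> X" "le True i s \<beta>" "le True i \<beta> (inv k z)"
        using ord_indD[OF oX i s(1), of "inv k z"] ksle[OF az] by auto
      then show ?thesis using s lek k(1) by (intro bexI[of _ "k \<beta>"]) (auto simp: Y_def)
    next
      case False
      then have z: "z \<in> S3" "z \<in> U" using z S3U by auto
      have sX: "s \<notin> X" using s S3W2 XW by (auto simp: W2_def W1_def)
      from end_above[OF i X sU sX, where b=True] obtain e where e0: "e \<in> insert None (Some ` X)"
          "below True i e s \<and> (\<forall>\<beta>\<in>X. le True i s \<beta> \<longrightarrow> (\<exists>\<beta>0. e = Some \<beta>0 \<and> le True i \<beta>0 \<beta>))"
        by (rule bexE)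
      then have e: "e \<in> \<Gamma>" "below True i e s"
          "\<And>\<beta>. \<beta> \<in> X \<Longrightarrow> le True i s \<beta> \<Longrightarrow> \<exists>\<beta>0. e = Some \<beta>0 \<and> le True i \<beta>0 \<beta>"
        unfolding \<Gamma>_def by simp_all
      show ?thesis
      proof (rule ccontr)
        assume no: "\<not> ?thesis"
        \<comment> \<open>The image of the end next to \<open>s\<close> is not before
          \<open>a\<close>, and by assumption it does not separate \<open>a\<close> from
          \<open>z\<close>; so \<open>z\<close> lies before it.\<close>
        have zke: "below True i (map_option k e) z"
        proof (cases e)
          case (Some \<beta>)
          then have \<beta>: "\<beta> \<in> X" "lt True i s \<beta>" using e by (auto simp: \<Gamma>_def)
          then have "k \<beta> \<in> Y" "le True i a (k \<beta>)" using s k(1) by (auto simp: Y_def le_def)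
          then have "\<not> le True i (k \<beta>) z" using no by blast
          then show ?thesis using Some not_le[OF i, of "k \<beta>" z True] z \<beta> X k(1) by auto
        qed simp
        show False
        proof (cases "map_option k e \<in> \<Gamma>")
          case True
          define u where "u = inv k (w i (map_option k e))"
          have zw: "lt True i z (w i (map_option k e))" using natural[OF i True z(1) zke] .
          have "lt True i (k u) (k (w i e))" using w(5)[OF i e(1) True] k(1) by (simp add: u_def)
          then have uw: "lt True i u (w i e)" using k(1) by simp
          have uK: "u \<in> K" using i True by (auto simp: u_def K_def Ws_def)
          have uU: "u \<in> U" using uK W1 by auto
          \<comment> \<open>The lower half of the squeeze. If it failed, a point \<open>v\<close> of
            \<open>W1\<close> would lie between \<open>s\<close> and \<open>w i e\<close>; but no
            point of \<open>W\<close> and no other witness can lie there.\<close>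
          have "lt True i u s"
          proof (rule ccontr)
            assume "\<not> lt True i u s"
            then have "le True i s u" using not_lt[OF i uU sU] by blast
            then obtain v where v: "v \<in> W1" "le True i s v" "le True i v u"
              using ord_indD[OF oK i s(1) uK] by auto
            have vw: "lt True i v (w i e)" using le_lt_trans[OF i v(3) uw] .
            have ends: False if "e = Some \<beta>0" "le True i \<beta>0 v" for \<beta>0
            proof -
              have "lt True i (w i e) \<beta>0" using w(2)[OF i e(1)] that by simp
              then show False using vw that(2) lt_trans[OF i] lt_le_trans[OF i] lt_irrefl[OF i] by metis
            qed
            from v(1) consider "v \<in> W" | j e' where "j \<in> I" "e' \<in> \<Gamma>" "v = w j e'"
              by (auto simp: W1_def Ws_def)
            then show False
            proof cases
              case 1
              then obtain \<beta> where \<beta>: "\<beta> \<in> X" "le True i s \<beta>" "le True i \<beta> v"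
                using ord_indD[OF oX i s(1) 1] v(2) by auto
              then show False using e(3)[OF \<beta>(1,2)] ends le_trans[OF i] by blast
            next
              case (2 j e')
              show False
              proof (cases "j = i")
                case False
                then have "lt True i v s" using natural'[OF i 2(1) _ 2(2) s(1)] 2(3) by auto
                then show False using v(2) le_lt_trans[OF i] lt_irrefl[OF i] by blast
              next
                case True
                have ne: "e' \<noteq> e" using vw 2(3) True lt_irrefl[OF i] by auto
                have "\<exists>\<beta>0. e = Some \<beta>0 \<and> below True i e' \<beta>0"
                proof (cases e')
                  case None
                  then show ?thesis using ne by (cases e) auto
                next
                  case (Some \<beta>')
                  have "lt True i v \<beta>'" using w(2)[OF i 2(2)] 2(3) True Some by simp
                  then have "le True i s \<beta>'" using le_lt_trans[OF i v(2)] by (simp add: le_def)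
                  moreover have "\<beta>' \<in> X" using 2(2) Some by (auto simp: \<Gamma>_def)
                  ultimately obtain \<beta>0 where "e = Some \<beta>0" "le True i \<beta>0 \<beta>'" using e(3) by blast
                  then show ?thesis using ne Some by (auto simp: le_def)
                qed
                then obtain \<beta>0 where \<beta>0: "e = Some \<beta>0" "below True i e' \<beta>0" by blast
                have "\<beta>0 \<in> V" using e(1) \<beta>0 XW by (auto simp: \<Gamma>_def V_def)
                then have "lt True i \<beta>0 v" using w(3)[OF i 2(2)] \<beta>0 2(3) True by blast
                then show False using ends \<beta>0 by (simp add: le_def)
              qed
            qed
          qed
          then have "lt True i (k u) a" using s k(1) by simp
          then have "lt True i (w i (map_option k e)) a" using k(1) by (simp add: u_def)
          then show False using az zw lt_trans[OF i] lt_le_trans[OF i] lt_irrefl[OF i] by metis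
        next
          case False
          then obtain \<beta>0 where \<beta>0: "e = Some \<beta>0" by (cases e) (auto simp: \<Gamma>_def)
          then have \<beta>0X: "\<beta>0 \<in> X" "k \<beta>0 \<notin> X" using False e(1) by (auto simp: \<Gamma>_def)
          then have "k \<beta>0 \<in> W" using XW by (auto simp: Y_def)
          moreover have "le True i z (k \<beta>0)" using zke \<beta>0 by (simp add: le_def)
          ultimately obtain \<beta>2 where \<beta>2: "\<beta>2 \<in> X" "le True i z \<beta>2" "le True i \<beta>2 (k \<beta>0)"
            using ord_indD[OF oX i z(1)] by auto
          have "inv k \<beta>2 \<in> W" using \<beta>2 XW by auto
          moreover have "le True i s (inv k \<beta>2)" using ksle le_trans[OF i az \<beta>2(2)] by blast
          ultimately obtain \<beta>3 where \<beta>3: "\<beta>3 \<in> X" "le True i s \<beta>3" "le True i \<beta>3 (inv k \<beta>2)"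
            using ord_indD[OF oX i s(1)] by auto
          have "le True i \<beta>0 \<beta>3" using e(3)[OF \<beta>3(1,2)] \<beta>0 by auto
          then have "le True i (k \<beta>0) \<beta>2" using lek le_trans[OF i] \<beta>3(3) by blast
          then have "k \<beta>0 = \<beta>2" using le_antisym[OF i] \<beta>2(3) by blast
          then show False using \<beta>0X \<beta>2 by simp
        qed
      qed
    qed
  qed
  ultimately have "ind (k ` S3) Y (X \<union> S3)" by (simp add: ind_def)
  moreover have "c2 \<circ> c1 \<circ> c0 \<in> stab (X \<union> Y)"
    by (intro stab_comp c0(1) stab_mono[OF c21]) (use XW in \<open>auto simp: W1_def\<close>)
  moreover have "(c2 \<circ> c1 \<circ> c0) ` S = S3" by (simp add: S3_eq S1_def image_comp)
  ultimately show ?thesis unfolding Y_def by metis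
qed

text \<open>\<open>push_tuple\<close> brings the image of \<open>S\<close> outside \<open>X\<close>
  into the same independent position over \<open>k\<close>
  X\<open>as its prescribed image. By\<close>stationarity\<open>some\<close>g\<open>fixing\<close>k
  \<open>X\<close>, \<open>X\<close> and \<open>S\<close> takes one to the other, and conjugating by
  such a \<open>g\<close> changes only the values on \<open>S\<close>.\<close>

lemma straighten:
  assumes good: "good k" and X: "finite X" "X \<subseteq> U" and S: "finite S" "S \<subseteq> U"
    and indS: "ind S X (k ` X)" and \<sigma>: "\<sigma> \<in> G" "\<And>x. x \<in> X \<Longrightarrow> \<sigma> x = k x"
    and indT: "ind (\<sigma> ` S) (k ` X) (X \<union> S)"
  shows "\<exists>c\<in>stab (X \<union> k ` X). \<forall>s\<in>S. conj_by c k s = \<sigma> s"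
proof -
  have k: "k \<in> G" using good by (simp add: good_def)
  define Y where "Y = k ` X"
  define S' where "S' = S - X"
  have S': "finite S'" "S' \<subseteq> U" "S' \<inter> X = {}" "S' \<subseteq> S" using S by (auto simp: S'_def)
  have "ind S' X (k ` X)" using indS by (rule ind_mono) (use S' in auto)
  then obtain c1 where c1: "c1 \<in> stab (X \<union> Y)" "ind (k ` c1 ` S') Y (X \<union> c1 ` S')"
    using push_tuple[OF good X S'(1-3)] unfolding Y_def by blast
  define k' where "k' = conj_by (inv c1) k"
  have c1i: "inv c1 \<in> stab (X \<union> Y)" using c1 by simp
  have k'G: "k' \<in> G" using k c1 by (simp add: k'_def)
  have k'X: "k' x = k x" if "x \<in> X" for x
    unfolding k'_def using that by (intro conj_stab_eq[OF c1i]) (auto simp: Y_def)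
  have k'S: "k' ` S' = inv c1 ` k ` c1 ` S'"
    using conj_by_image[OF stab_G[OF c1i], of k "c1 ` S'"] c1(1) by (simp add: k'_def)
  have "inv c1 ` (X \<union> c1 ` S') = X \<union> S'"
    using stab_image[OF c1i, of X] c1(1) by (simp add: image_Un)
  then have indk': "ind (k' ` S') Y (X \<union> S')"
    using ind_G[OF stab_G[OF c1i] c1(2)] stab_image[OF c1i, of Y] k'S by simp
  define \<tau> where "\<tau> = \<sigma> \<circ> inv k'"
  have "\<tau> y = y" if y: "y \<in> Y" for y
  proof -
    obtain x where x: "x \<in> X" "y = k x" using y by (auto simp: Y_def)
    then have "y = k' x" using k'X by simp
    then show ?thesis using x \<sigma>(2) k'G by (simp add: \<tau>_def)
  qed
  then have \<tau>: "\<tau> \<in> stab Y" using \<sigma>(1) k'G unfolding stab_def by (simp add: \<tau>_def)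
  have \<tau>S: "\<tau> ` k' ` S' = \<sigma> ` S'" using k'G by (simp add: \<tau>_def image_image)
  have "ind (\<tau> ` k' ` S') Y (X \<union> S')"
    unfolding \<tau>S using indT unfolding Y_def by (rule ind_mono) (use S' in auto)
  then obtain g where g: "g \<in> stab (Y \<union> (X \<union> S'))" "\<And>x. x \<in> S' \<Longrightarrow> g (k' x) = \<tau> (k' x)"
    using stationarity[OF _ _ _ _ _ _ \<tau> indk'] S' X k k'G by (auto simp: Y_def)
  define c where "c = g \<circ> inv c1"
  have c: "c \<in> stab (X \<union> Y)" unfolding c_def by (intro stab_comp c1i stab_mono[OF g(1)]) auto
  have "conj_by c k s = \<sigma> s" if s: "s \<in> S" for s
  proof (cases "s \<in> X")
    case True
    then show ?thesis using conj_stab_eq[OF c, of s k] \<sigma>(2) by (simp add: Y_def)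
  next
    case False
    then have sS: "s \<in> S'" using s by (simp add: S'_def)
    have "conj_by c k s = conj_by g k' s"
      using conj_by_comp[of g "inv c1" k] g c1i by (simp add: c_def k'_def)
    also have "\<dots> = conj_by g k' (g s)" using stab_fix[OF g(1), of s] sS by simp
    also have "\<dots> = g (k' s)" using conj_by_apply[OF stab_G[OF g(1)]] .
    also have "\<dots> = \<sigma> s" using g(2)[OF sS] k'G by (simp add: \<tau>_def)
    finally show ?thesis .
  qed
  then show ?thesis using c by (auto simp: Y_def)
qed

end

section \<open>The first factor: making images independent from the middle set\<close>

context generic_struc
begin

lemma stab_le:
  assumes "g \<in> stab B" "v \<in> B"
  shows "le b i (g x) v \<longleftrightarrow> le b i x v" "le b i v (g x) \<longleftrightarrow> le b i v x"
  using le_G[OF stab_G[OF assms(1)], of b i x v] le_G[OF stab_G[OF assms(1)], of b i v x]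
    stab_fix[OF assms] by simp_all

text \<open>\<open>separated k W Y S\<close> is the part of the order independence of \<open>k ` S\<close> and \<open>S\<close> over \<open>W\<close> that
  is needed below: it may fail only in cuts of \<open>W\<close> whose lower end is not in \<open>Y\<close>.\<close>

definition separated :: "('b \<Rightarrow> 'b) \<Rightarrow> 'b set \<Rightarrow> 'b set \<Rightarrow> 'b set \<Rightarrow> bool" where
  "separated k W Y S \<longleftrightarrow> (\<forall>i\<in>I. \<forall>x\<in>S. \<forall>s\<in>S. le True i (k x) s \<longrightarrow>
     (\<exists>v\<in>W. le True i (k x) v \<and> le True i v s) \<or>
     (\<exists>v\<in>W - Y. lt True i v (k x) \<and> (\<forall>v'\<in>W. lt True i v' (k x) \<longrightarrow> le True i v' v)))"

lemma separated_conj: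
  assumes c: "c \<in> stab W" and sep: "separated k W Y S"
  shows "separated (conj_by c k) W Y (c ` S)"
  unfolding separated_def
proof (intro ballI impI)
  fix i x' s' assume i: "i \<in> I" and xs: "x' \<in> c ` S" "s' \<in> c ` S" and l: "le True i (conj_by c k x') s'"
  obtain x s where x: "x \<in> S" "x' = c x" "s \<in> S" "s' = c s" using xs by auto
  have kx: "conj_by c k x' = c (k x)" using x conj_by_apply[OF stab_G[OF c]] by simp
  have "le True i (k x) s" using l x kx le_G[OF stab_G[OF c]] by metis
  then have "(\<exists>v\<in>W. le True i (k x) v \<and> le True i v s) \<or>
     (\<exists>v\<in>W - Y. lt True i v (k x) \<and> (\<forall>v'\<in>W. lt True i v' (k x) \<longrightarrow> le True i v' v))"
    using sep i x unfolding separated_def by blast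
  then show "(\<exists>v\<in>W. le True i (conj_by c k x') v \<and> le True i v s') \<or>
     (\<exists>v\<in>W - Y. lt True i v (conj_by c k x') \<and> (\<forall>v'\<in>W. lt True i v' (conj_by c k x') \<longrightarrow> le True i v' v))"
    unfolding kx x(4) using stab_le[OF c] stab_lt[OF c] by (metis DiffD1)
qed

text \<open>The mirror image of the order argument in \<open>push_tuple\<close>. Witnesses stand
  just to the right of the lower ends in \<open>k\<close> Y0\<open>and of minus infinity; images
  beyond such an end lie beyond its witness, and
  over\<close>W1\<open>the witnesses lie to the right of the moved copy of\<close>S\<open>. So a point\<close>s
  \<ge> k x\<open>forces a separating point of\<close>W\<open>. Lower ends outside\<close>k
  \<open>Y0\<close> get no witness, which is the exception in \<open>separated\<close>.\<close>

lemma push_first: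
  assumes good: "good k" and Y: "finite Y0" "Y0 \<subseteq> U" and W_eq: "W = Y0 \<union> k ` Y0 \<union> k ` k ` Y0"
    and S: "finite S" "S \<subseteq> U" "S \<inter> W = {}"
  shows "\<exists>c\<in>stab W. free_ind (conj_by c k ` S) W S \<and> separated (conj_by c k) W (k ` Y0) S"
proof -
  have k: "k \<in> G" "free_moving k" "inv k \<in> G" "\<And>i. i \<in> I \<Longrightarrow> osc False i (inv k)"
    using good by (auto simp: good_def)
  define Y1 where "Y1 = k ` Y0"
  have W: "finite W" "W \<subseteq> U" "Y0 \<subseteq> W" "Y1 \<subseteq> W" using Y k by (auto simp: W_eq Y1_def)
  have Y1: "finite Y1" "Y1 \<subseteq> U" using Y k by (auto simp: Y1_def)
  define \<Gamma> where "\<Gamma> = insert None (Some ` Y1)"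
  define V where "V = W \<union> k ` W \<union> k ` k ` W \<union> inv k ` W \<union> k ` S"
  have \<Gamma>: "finite \<Gamma>" "\<And>e. e \<in> \<Gamma> \<Longrightarrow> set_option e \<subseteq> Y1" using Y1 by (auto simp: \<Gamma>_def)
  have \<Gamma>U: "\<And>e. e \<in> \<Gamma> \<Longrightarrow> set_option e \<subseteq> U" using \<Gamma>(2) Y1(2) by blast
  have V: "finite V" "V \<subseteq> U" using W S k by (simp_all add: V_def)
  obtain w where w0: "\<forall>i\<in>I. \<forall>e\<in>\<Gamma>. w i e \<in> U \<and> below False i e (w i e) \<and>
     (\<forall>v\<in>V. below False i e v \<longrightarrow> lt False i v (w i e)) \<and>
     (\<forall>j\<in>I. j \<noteq> i \<longrightarrow> (\<forall>v\<in>V. lt False j (w i e) v)) \<and>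
     (map_option (inv k) e \<in> \<Gamma> \<longrightarrow> lt False i (w i (map_option (inv k) e)) (inv k (w i e)))"
    using end_points_family[where b=False, OF k(3) k(4) \<Gamma>(1) \<Gamma>U V] by (rule exE)
  have w: "\<And>i e. i \<in> I \<Longrightarrow> e \<in> \<Gamma> \<Longrightarrow> w i e \<in> U"
    "\<And>i e. i \<in> I \<Longrightarrow> e \<in> \<Gamma> \<Longrightarrow> below False i e (w i e)"
    "\<And>i e v. i \<in> I \<Longrightarrow> e \<in> \<Gamma> \<Longrightarrow> v \<in> V \<Longrightarrow> below False i e v \<Longrightarrow> lt False i v (w i e)"
    "\<And>i j e v. i \<in> I \<Longrightarrow> e \<in> \<Gamma> \<Longrightarrow> j \<in> I \<Longrightarrow> j \<noteq> i \<Longrightarrow> v \<in> V \<Longrightarrow> lt False j (w i e) v"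
    "\<And>i e. i \<in> I \<Longrightarrow> e \<in> \<Gamma> \<Longrightarrow> map_option (inv k) e \<in> \<Gamma> \<Longrightarrow>
        lt False i (w i (map_option (inv k) e)) (inv k (w i e))"
    using w0 by simp_all
  define Ws where "Ws = (\<Union>i\<in>I. w i ` \<Gamma>)"
  have Ws: "finite Ws" "Ws \<subseteq> U" using finite_I \<Gamma>(1) w(1) by (auto simp: Ws_def)
  have WsV: "Ws \<inter> V = {}" using w(2,3) lt_irrefl by (fastforce simp: Ws_def)
  define K where "K = inv k ` Ws"
  have kK: "k ` K = Ws" using k by (simp add: K_def)
  have K: "finite K" "K \<subseteq> U" using Ws k by (simp_all add: K_def)
  have lt_inv: "lt b i x (inv k y)" if "lt b i (k x) y" for b i x y
    using that lt_G[OF k(1), of b i x "inv k y"] k(1) by simp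
  have lt_inv': "lt b i (inv k y) x" if "lt b i y (k x)" for b i x y
    using that lt_G[OF k(1), of b i "inv k y" x] k(1) by simp
  have below_k: "below False i e (k x) \<longleftrightarrow> below False i (map_option (inv k) e) x" for i e x
  proof (cases e)
    case (Some \<beta>)
    then show ?thesis using lt_G[OF k(1), of False i x "inv k \<beta>"] k(1) by simp
  qed simp
  have KW: "K \<inter> (S \<union> k ` W) = {}"
  proof (rule ccontr)
    assume "K \<inter> (S \<union> k ` W) \<noteq> {}"
    then obtain y where y: "y \<in> Ws" "inv k y \<in> S \<union> k ` W" by (auto simp: K_def)
    then have "k (inv k y) \<in> V" by (auto simp: V_def simp del: f_inv_G)
    then show False using y WsV k by auto
  qed
  define W1 where "W1 = W \<union> K"
  have W1: "finite W1" "W1 \<subseteq> U" using W K by (auto simp: W1_def)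
  obtain c0 where c0: "c0 \<in> stab W1" "ind (c0 ` Ws) W1 S"
    using existence[OF Ws(1) W1(1) S(1) Ws(2) W1(2) S(2)] by blast
  \<comment> \<open>The witnesses are tied to \<open>k\<close> and must stay. Instead of moving them
    to the right of \<open>S\<close>, the inverse moves \<open>S\<close> to the left of
    them.\<close>
  define c2 where "c2 = inv c0"
  have c2: "c2 \<in> stab W1" using c0 by (simp add: c2_def)
  define S2 where "S2 = c2 ` S"
  have S2: "finite S2" "S2 \<subseteq> U" using S c2 by (simp_all add: S2_def)
  have WsS2: "ind Ws W1 S2"
    using ind_G[OF stab_G[OF c2] c0(2)] stab_image[OF c2, of W1] c0(1) by (simp add: S2_def c2_def)
  have "S \<inter> W1 = {}" using S(3) KW by (auto simp: W1_def)
  then have S2W1: "S2 \<inter> W1 = {}" using stab_disjoint[OF c2] by (simp add: S2_def)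
  then have S2Ws: "S2 \<inter> Ws = {}" using WsS2 by (auto simp: ind_def free_ind_def)
  define W2 where "W2 = W1 \<union> Ws"
  have W2: "finite W2" "W2 \<subseteq> U" "finite (k ` W)" "k ` W \<subseteq> U" using W1 Ws W k by (auto simp: W2_def)
  obtain c3 where c3: "c3 \<in> stab W2" "ind (c3 ` S2) W2 (k ` W)"
    using existence[OF S2(1) W2(1) W2(3) S2(2) W2(2) W2(4)] by blast
  define S3 where "S3 = c3 ` S2"
  have S3: "finite S3" "S3 \<subseteq> U" using S2 c3 by (simp_all add: S3_def)
  have S3W2: "S3 \<inter> W2 = {}" using stab_disjoint[OF c3(1)] S2W1 S2Ws by (auto simp: W2_def S3_def)
  have S3kW: "S3 \<inter> k ` W = {}" using c3(2) S3W2 by (auto simp: ind_def free_ind_def S3_def)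
  have "free_ind S3 (W \<union> (K \<union> Ws)) (k ` W)"
    using c3(2) by (simp add: ind_def S3_def W2_def W1_def Un_assoc)
  moreover have "(K \<union> Ws) \<inter> (S3 \<union> k ` W) \<subseteq> W"
    using S3W2 KW WsV by (auto simp: W2_def W1_def V_def)
  ultimately have S3free: "free_ind S3 W (k ` W)" by (rule free_ind_drop_base)
  define W3 where "W3 = W2 \<union> k ` W"
  have W3: "finite W3" "W3 \<subseteq> U" using W2 by (auto simp: W3_def)
  have S3W3: "S3 \<inter> W3 = {}" using S3W2 S3kW by (auto simp: W3_def)
  have F: "finite (k ` Ws)" "k ` Ws \<subseteq> U" using Ws k by auto
  obtain c4 where c4: "c4 \<in> stab W3" "c4 ` (S3 - W3) \<inter> k ` Ws = {}"
      "free_ind (k ` c4 ` S3) (k ` W3) (W3 \<union> c4 ` S3)"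
    using free_moving_set[OF k(1,2) W3 F S3] by blast
  define S4 where "S4 = c4 ` S3"
  have "S3 - W3 = S3" using S3W3 by blast
  then have S4F: "S4 \<inter> k ` Ws = {}" using c4(2) by (simp add: S4_def)
  have S4W3: "S4 \<inter> W3 = {}" using stab_disjoint[OF c4(1) S3W3] by (simp add: S4_def)
  have S4U: "S4 \<subseteq> U" using S3 c4 by (auto simp: S4_def)
  have c43: "c4 \<circ> c3 \<in> stab W2" using c3 stab_mono[OF c4(1)] by (simp add: W3_def)
  have S4_eq2: "S4 = (c4 \<circ> c3) ` S2" by (simp add: S4_def S3_def image_comp)
  define C where "C = c4 \<circ> c3 \<circ> c2"
  have C: "C \<in> stab W1" unfolding C_def by (intro stab_comp c2 stab_mono[OF c43]) (auto simp: W2_def)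
  have S4_eq: "S4 = C ` S" by (simp add: S4_eq2 S2_def C_def image_comp)
  have oWs: "ord_ind (\<lambda>_. True) Ws W1 S4"
  proof -
    have "(c4 \<circ> c3) ` Ws = Ws" "(c4 \<circ> c3) ` W1 = W1" by (rule stab_image[OF c43]; simp add: W2_def)+
    then show ?thesis
      using ord_ind_G[OF stab_G[OF c43], of _ Ws W1 S2] WsS2 unfolding S4_eq2 ind_def by metis
  qed
  have free: "free_ind (k ` S4) W S4"
  proof -
    have kW3: "k ` W3 = (k ` W \<union> k ` k ` W) \<union> (Ws \<union> k ` Ws)"
      by (auto simp: W3_def W2_def W1_def image_Un kK)
    have "free_ind (k ` S4) ((k ` W \<union> k ` k ` W) \<union> (Ws \<union> k ` Ws)) (W \<union> S4)"
      unfolding kW3[symmetric] using c4(3) unfolding S4_def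
      by (rule free_ind_mono) (auto simp: W3_def W2_def W1_def)
    moreover have "(Ws \<union> k ` Ws) \<inter> (k ` S4 \<union> (W \<union> S4)) = {}"
    proof -
      have 1: "Ws \<inter> S4 = {}" using S4W3 by (auto simp: W3_def W2_def)
      then have "k ` Ws \<inter> k ` S4 = {}" using k(1) by (auto simp: G_inj)
      moreover have "Ws \<inter> k ` S4 = {}"
      proof (rule ccontr)
        assume "Ws \<inter> k ` S4 \<noteq> {}"
        then obtain s where s: "s \<in> S4" "k s \<in> Ws" by auto
        then have "inv k (k s) \<in> K" unfolding K_def by blast
        then show False using S4W3 s k by (auto simp: W3_def W2_def W1_def)
      qed
      moreover have "k ` Ws \<inter> W = {}"
      proof (rule ccontr)
        assume "k ` Ws \<inter> W \<noteq> {}"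
        then obtain v where v: "v \<in> Ws" "k v \<in> W" by auto
        then have "inv k (k v) \<in> V" by (auto simp: V_def simp del: inv_f_G)
        then show False using WsV v k by auto
      qed
      moreover have "Ws \<inter> W = {}" using WsV by (auto simp: V_def)
      moreover have "k ` Ws \<inter> S4 = {}" using S4F by (simp add: Int_commute)
      ultimately show ?thesis using 1 by (simp add: Int_Un_distrib Int_Un_distrib2)
    qed
    ultimately have 2: "free_ind (k ` S4) (k ` W \<union> k ` k ` W) (W \<union> S4)"
      using free_ind_drop_base[of "k ` S4" "k ` W \<union> k ` k ` W" "Ws \<union> k ` Ws" "W \<union> S4"] by blast
    have "W \<subseteq> W3" "k ` W \<subseteq> W3" by (auto simp: W3_def W2_def W1_def)
    then have "c4 ` W = W" "c4 ` k ` W = k ` W" using stab_image[OF c4(1)] by blast+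
    then have "free_ind S4 W (k ` W)" using free_ind_G[OF stab_G[OF c4(1)] S3free] by (simp add: S4_def)
    then have "free_ind (k ` S4) (k ` W) (k ` k ` W)" using free_ind_G[OF k(1)] by blast
    then have "free_ind (k ` S4) (k ` W) (W \<union> S4 \<union> k ` k ` W)" using 2 by (rule free_ind_right_trans)
    then have "free_ind (k ` S4) (k ` W) (S4 \<union> W)" by (rule free_ind_mono) auto
    then have "free_ind (k ` S4) (k ` W \<union> W) S4" by (rule free_ind_base_mono)
    then have 3: "free_ind (k ` S4) (W \<union> k ` W) S4" by (simp add: Un_commute)
    have "S4 \<inter> W = {}" "S4 \<inter> k ` W = {}" using S4W3 by (auto simp: W3_def W2_def W1_def)
    then have "k ` W \<inter> (k ` S4 \<union> S4) \<subseteq> W" using G_inj[OF k(1)] by auto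
    with 3 show ?thesis by (rule free_ind_drop_base)
  qed
  have natural: "lt False i x (inv k (w i e))"
    if i: "i \<in> I" and e: "e \<in> \<Gamma>" and x: "x \<in> S4" "below False i (map_option (inv k) e) x" for i e x
  proof -
    obtain x1 where x1: "x1 \<in> S" "x = C x1" using x by (auto simp: S4_eq)
    have "set_option (map_option (inv k) e) \<subseteq> W1"
      using \<Gamma>(2)[OF e] k W by (cases e) (auto simp: W1_def Y1_def)
    then have "below False i (map_option (inv k) e) x1" using x stab_below[OF C] x1 by metis
    then have "below False i e (k x1)" using below_k by blast
    then have "lt False i x1 (inv k (w i e))" using w(3)[OF i e] x1 by (intro lt_inv) (simp add: V_def)
    moreover have "inv k (w i e) \<in> W1" using i e by (auto simp: W1_def K_def Ws_def)
    ultimately show ?thesis using stab_lt(1)[OF C] x1 by metis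
  qed
  have natural': "lt True i x (inv k (w j e))"
    if ij: "i \<in> I" "j \<in> I" "i \<noteq> j" and e: "e \<in> \<Gamma>" and x: "x \<in> S4" for i e x j
  proof -
    obtain x1 where x1: "x1 \<in> S" "x = C x1" using x by (auto simp: S4_eq)
    have "lt False i (w j e) (k x1)" using w(4)[OF ij(2) e ij(1,3)] x1 by (simp add: V_def)
    then have "lt True i x1 (inv k (w j e))" by (intro lt_inv) (simp add: lt_False)
    moreover have "inv k (w j e) \<in> W1" using ij e by (auto simp: W1_def K_def Ws_def)
    ultimately show ?thesis using stab_lt(1)[OF C] x1 by metis
  qed
  have "separated k W Y1 S4"
    unfolding separated_def
  proof (intro ballI impI)
    fix i x s assume i: "i \<in> I" and x: "x \<in> S4" and s: "s \<in> S4" and l: "le True i (k x) s"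
    let ?sep = "\<exists>v\<in>W. le True i (k x) v \<and> le True i v s"
    let ?end = "\<exists>v\<in>W - Y1. lt True i v (k x) \<and> (\<forall>v'\<in>W. lt True i v' (k x) \<longrightarrow> le True i v' v)"
    have xU: "k x \<in> U" "s \<in> U" using x s S4U k by auto
    have "?end" if no: "\<not> ?sep"
    proof -
      have kxW: "k x \<notin> W" using no l le_refl by blast
      from end_above[OF i W(1,2) xU(1) kxW, where b=False]
      obtain e where e0: "e \<in> insert None (Some ` W)" "below False i e (k x) \<and>
          (\<forall>\<beta>\<in>W. le False i (k x) \<beta> \<longrightarrow> (\<exists>\<beta>0. e = Some \<beta>0 \<and> le False i \<beta>0 \<beta>))"
        by (rule bexE)
      then have e: "e \<in> insert None (Some ` W)" "below False i e (k x)"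
          "\<And>\<beta>. \<beta> \<in> W \<Longrightarrow> le False i (k x) \<beta> \<Longrightarrow> \<exists>\<beta>0. e = Some \<beta>0 \<and> le False i \<beta>0 \<beta>"
        by simp_all
      have below_e: "\<exists>\<beta>0. e = Some \<beta>0 \<and> le True i v \<beta>0" if v: "v \<in> W" "le True i v s" for v
      proof -
        have "\<not> le True i (k x) v" using no v by blast
        then have "lt True i v (k x)" using not_le[OF i xU(1), of v True] v W(2) by auto
        then have "le False i (k x) v" by (simp add: le_def lt_False)
        then show ?thesis using e(3)[OF v(1)] le_flip[of True] by auto
      qed
      show ?end
      proof (cases "e \<in> \<Gamma>")
        case False
        then obtain g where g: "e = Some g" "g \<in> W" "g \<notin> Y1" using e(1) by (auto simp: \<Gamma>_def)
        have "lt True i g (k x)" using e(2) g by (simp add: lt_False)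
        moreover have "le True i v g" if "v \<in> W" "lt True i v (k x)" for v
          using e(3)[OF that(1)] that(2) g le_flip[of True] by (auto simp: le_def lt_False)
        ultimately show ?thesis using g by blast
      next
        case True
        have wU: "w i e \<in> U" using w(1) i True by blast
        have "below False i (map_option (inv k) e) x" using e(2) below_k by blast
        then have "lt False i x (inv k (w i e))" using natural[OF i True x] by blast
        then have "lt True i (w i e) (k x)"
          using lt_G[OF k(1), of False i x "inv k (w i e)"] k(1) by (simp add: lt_False)
        then have "le True i (w i e) s" using lt_le_trans[OF i _ l] by (simp add: le_def)
        moreover have "w i e \<in> Ws" using i True by (auto simp: Ws_def)
        ultimately obtain v where v: "v \<in> W1" "le True i (w i e) v" "le True i v s"
          using ord_indD[OF oWs i _ s] by auto
        have above_e: False if "e = Some \<beta>0" "le True i v \<beta>0" for \<beta>0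
        proof -
          have "lt True i \<beta>0 (w i e)" using w(2)[OF i True] that by (simp add: lt_False)
          then show False using v(2) that(2) lt_le_trans[OF i] lt_irrefl[OF i] by metis
        qed
        from v(1) consider "v \<in> W" | j e' where "j \<in> I" "e' \<in> \<Gamma>" "v = inv k (w j e')"
          by (auto simp: W1_def K_def Ws_def)
        then have False
        proof cases
          case 1
          then show False using below_e[OF 1 v(3)] above_e by blast
        next
          case (2 j e')
          show False
          proof (cases "j = i")
            case False
            then have "lt True i s v" using natural'[OF i 2(1) _ 2(2) s] 2(3) by auto
            then show False using v(3) lt_le_trans[OF i] lt_irrefl[OF i] by blast
          next
            case True
            \<comment> \<open>\<open>v\<close> stands just to the right of the end \<open>a\<close>.
              If \<open>a\<close> is \<open>e\<close>, the constraint between witnesses puts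
              \<open>v\<close> before \<open>w i e\<close>; otherwise \<open>a\<close> comes before
              \<open>e\<close>, and then so does \<open>v\<close>.\<close>
            define a where "a = map_option (inv k) e'"
            have near: "lt True i v y" if "y \<in> W" "below False i a y" for y
            proof -
              have "below False i e' (k y)" using that below_k by (simp add: a_def)
              then have "lt False i (k y) (w i e')" using w(3)[OF i 2(2)] that by (simp add: V_def)
              then have "lt False i y (inv k (w i e'))" by (rule lt_inv)
              then show ?thesis using 2(3) True by (simp add: lt_False)
            qed
            have av: "below False i a v"
              using w(2)[OF i 2(2)] below_k[of i e' v] 2(3) True k(1) by (simp add: a_def)
            show False
            proof (cases "a = e")
              case ae: True
              then have "lt False i (w i e) v" using w(5)[OF i 2(2)] 2(3) True \<open>e \<in> \<Gamma>\<close> by (simp add: a_def)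
              then show False using v(2) le_lt_trans[OF i] lt_irrefl[OF i] by (simp add: lt_False) blast
            next
              case ne: False
              have "\<exists>y\<in>W. a = Some y"
              proof (cases a)
                case None
                then obtain g where g: "e = Some g" using ne by (cases e) auto
                then have "g \<in> W" using e(1) by auto
                then have "lt True i v g" using near None by simp
                then show ?thesis using above_e[OF g] by (simp add: le_def)
              next
                case (Some y)
                then obtain y' where y': "e' = Some y'" "y = inv k y'" by (cases e') (auto simp: a_def)
                then have "y \<in> W" using \<Gamma>(2)[OF 2(2)] k W by (auto simp: Y1_def)
                then show ?thesis using Some by blast
              qed
              then obtain y where y: "y \<in> W" "a = Some y" by blast
              then have "lt True i y v" using av by (simp add: lt_False)
              then have "le True i y s" using v(3) lt_le_trans[OF i] by (simp add: le_def)
              then obtain g where g: "e = Some g" "le True i y g" using below_e[OF y(1)] by blast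
              then have "g \<in> W" "lt True i y g" using e(1) ne y by (auto simp: le_def)
              then have "lt True i v g" using near y by (simp add: lt_False)
              then show False using above_e[OF g(1)] by (simp add: le_def)
            qed
          qed
        qed
        then show ?thesis ..
      qed
    qed
    then show "?sep \<or> ?end" by blast
  qed
  then have sep: "separated k W (k ` Y0) S4" by (simp add: Y1_def)
  define c where "c = inv C"
  have CW: "C \<in> stab W" using C by (rule stab_mono) (simp add: W1_def)
  then have c: "c \<in> stab W" by (simp add: c_def)
  have cS4: "c ` S4 = S" using C by (simp add: c_def S4_eq)
  have "conj_by c k ` S = c ` k ` S4" using conj_by_image[OF stab_G[OF c], of k S4] cS4 by simp
  then have "free_ind (conj_by c k ` S) W S"
    using free_ind_G[OF stab_G[OF c] free] stab_image[OF c, of W] cS4 by simp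
  moreover have "separated (conj_by c k) W (k ` Y0) S" using separated_conj[OF c sep] cS4 by simp
  ultimately show ?thesis using c by blast
qed

text \<open>Creates the hypothesis on \<open>S\<close> in \<open>straighten\<close>. If an image is
  at most a point \<open>y\<close> of \<open>Y2\<close>, some \<open>s\<close> in
  \<open>W \<union> S\<close> separates them. For \<open>s\<close> in \<open>S\<close>,
  \<open>separated\<close> applies; in its exceptional case the lower end \<open>v\<close> of the
  image in \<open>W\<close> is not in \<open>k\<close> Y0\<open>, so the point of\<close>k
  \<open>Y0\<close> between \<open>v\<close> and \<open>y\<close> must lie beyond the image.\<close>

lemma leg_first:
  assumes good: "good k" and Y: "finite Y0" "Y0 \<subseteq> U" "finite Y2" "Y2 \<subseteq> U" and S0: "finite S0" "S0 \<subseteq> U"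
    and indY: "ind Y0 (k ` Y0) Y2"
  shows "\<exists>c\<in>stab (Y0 \<union> k ` Y0). ind (conj_by c k ` S0) (k ` Y0) Y2"
proof -
  have k: "k \<in> G" using good by (simp add: good_def)
  define Y1 where "Y1 = k ` Y0"
  have Y1: "finite Y1" "Y1 \<subseteq> U" "finite (k ` Y1)" "k ` Y1 \<subseteq> U" using Y k by (auto simp: Y1_def)
  have f: "finite (Y0 \<union> Y1)" "Y0 \<union> Y1 \<subseteq> U" "finite (Y2 \<union> S0)" "Y2 \<union> S0 \<subseteq> U" using Y Y1 S0 by auto
  obtain c1 where c1: "c1 \<in> stab (Y0 \<union> Y1)" "ind (c1 ` k ` Y1) (Y0 \<union> Y1) (Y2 \<union> S0)"
    using existence[OF Y1(3) f(1,3) Y1(4) f(2,4)] by blast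
  define k1 where "k1 = conj_by c1 k"
  have k1: "good k1" "k1 \<in> G" using good_conj[OF stab_G[OF c1(1)] good] k c1 by (simp_all add: k1_def)
  define Z where "Z = k1 ` Y1"
  have Z: "Z = c1 ` k ` Y1"
    using conj_by_image[OF stab_G[OF c1(1)], of k Y1] stab_image[OF c1(1), of Y1] by (simp add: Z_def k1_def)
  have k1Y0: "k1 ` Y0 = Y1" unfolding k1_def Y1_def
    by (rule conj_stab_image[OF c1(1)]) (auto simp: Y1_def)
  define W where "W = Y0 \<union> Y1 \<union> Z"
  have W: "finite W" "W \<subseteq> U" using Y Y1 k1 by (auto simp: W_def Z_def)
  define S where "S = S0 - (Y0 \<union> Y1)"
  have S: "finite S" "S \<subseteq> U" using S0 by (auto simp: S_def)
  have "Z \<inter> S0 \<subseteq> Y0 \<union> Y1" using c1(2) by (auto simp: Z ind_def free_ind_def)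
  then have SW: "S \<inter> W = {}" by (auto simp: S_def W_def)
  \<comment> \<open>\<open>c1\<close> has made the second image \<open>Z\<close> independent from
    \<open>Y2\<close> over \<open>Y0 \<union> Y1\<close>; with \<open>indY\<close> all of
    \<open>W\<close> becomes independent from \<open>Y2\<close> over \<open>Y1\<close>.\<close>
  have "ind Z (Y1 \<union> Y0) Y2" using ind_mono[OF c1(2)] by (simp add: Z Un_commute)
  then have "ind (Z \<union> Y0) Y1 Y2" using indY unfolding Y1_def[symmetric] by (rule ind_left_trans)
  then have indW: "ind W Y1 Y2"
    using ind_mono[OF ind_add_base, of "Z \<union> Y0" Y1 Y2 W Y2] by (auto simp: W_def)
  have "W = Y0 \<union> k1 ` Y0 \<union> k1 ` k1 ` Y0" using k1Y0 by (simp add: W_def Z_def)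
  from push_first[OF k1(1) Y(1,2) this S SW]
  obtain c2 where c2: "c2 \<in> stab W" "free_ind (conj_by c2 k1 ` S) W S"
      "separated (conj_by c2 k1) W Y1 S" unfolding k1Y0 by blast
  define k2 where "k2 = conj_by c2 k1"
  have k2: "k2 \<in> G" using k1 c2 by (simp add: k2_def)
  have fk: "finite (k2 ` S)" "k2 ` S \<subseteq> U" "finite (W \<union> S)" "W \<union> S \<subseteq> U" using S k2 W by auto
  obtain c3 where c3: "c3 \<in> stab (W \<union> S)" "ind (c3 ` k2 ` S) (W \<union> S) Y2"
    using existence[OF fk(1,3) Y(3) fk(2,4) Y(4)] by blast
  define k3 where "k3 = conj_by c3 k2"
  have c3': "c3 \<in> stab W" "c3 ` S = S" using stab_mono[OF c3(1)] stab_image[OF c3(1), of S] by auto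
  have k3S: "k3 ` S = c3 ` k2 ` S"
    using conj_by_image[OF stab_G[OF c3(1)], of k2 S] c3' by (simp add: k3_def)
  have sep: "separated k3 W Y1 S" using separated_conj[OF c3'(1) c2(3)] c3'(2) by (simp add: k3_def k2_def)
  have fr: "free_ind (k3 ` S) W S"
    using free_ind_G[OF stab_G[OF c3(1)] c2(2)] stab_image[OF c3'(1), of W] c3'(2)
    by (simp add: k3S k2_def)
  have ind3: "ind (k3 ` S) (W \<union> S) Y2" using c3 by (simp add: k3S)
  have "free_ind (k3 ` S) W (Y2 \<union> S)" using free_ind_right_trans[OF fr] ind3 by (simp add: ind_def)
  then have "free_ind (k3 ` S) W Y2" by (rule free_ind_mono) auto
  moreover have "Y1 \<union> W = W" by (auto simp: W_def)
  ultimately have "free_ind (k3 ` S \<union> W) Y1 Y2"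
    using free_ind_left_trans[of "k3 ` S" Y1 W Y2] indW by (simp add: ind_def)
  moreover have "ord_ind (\<lambda>_. True) (k3 ` S \<union> W) Y1 Y2"
    unfolding ord_ind_def
  proof (intro ballI impI)
    fix i a y assume i: "i \<in> I" and a: "a \<in> k3 ` S \<union> W" and y: "y \<in> Y2" and ay: "le True i a y"
    have oW: "ord_ind (\<lambda>_. True) W Y1 Y2" using indW by (simp add: ind_def)
    have fromW: "\<exists>b\<in>Y1. le True i a b \<and> le True i b y" if v: "v \<in> W" "le True i a v" "le True i v y" for v
    proof -
      obtain b where "b \<in> Y1" "le True i v b" "le True i b y" using ord_indD[OF oW i v(1) y] v(3) by auto
      then show ?thesis using le_trans[OF i v(2)] by blast
    qed
    show "\<exists>b\<in>Y1. le True i a b \<and> le True i b y"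
    proof (cases "a \<in> W")
      case True
      then show ?thesis using fromW ay le_refl by blast
    next
      case False
      then obtain x where x: "x \<in> S" "a = k3 x" using a by auto
      have aU: "a \<in> U" using x S k2 c3 by (auto simp: k3_def)
      have "ord_ind (\<lambda>_. True) (k3 ` S) (W \<union> S) Y2" using ind3 by (simp add: ind_def)
      then obtain s where s: "s \<in> W \<union> S" "le True i a s" "le True i s y"
        using ord_indD[OF _ i, of _ "k3 ` S" _ Y2 a y] x y ay by auto
      show ?thesis
      proof (cases "s \<in> W")
        case True
        then show ?thesis using fromW s by blast
      next
        case False
        then have "(\<exists>v\<in>W. le True i a v \<and> le True i v s) \<or>
            (\<exists>v\<in>W - Y1. lt True i v a \<and> (\<forall>v'\<in>W. lt True i v' a \<longrightarrow> le True i v' v))"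
          using sep i x s unfolding separated_def by blast
        then show ?thesis
        proof
          assume "\<exists>v\<in>W. le True i a v \<and> le True i v s"
          then show ?thesis using fromW le_trans[OF i _ s(3)] by blast
        next
          assume "\<exists>v\<in>W - Y1. lt True i v a \<and> (\<forall>v'\<in>W. lt True i v' a \<longrightarrow> le True i v' v)"
          then obtain v where v: "v \<in> W" "v \<notin> Y1" "lt True i v a"
              "\<And>v'. v' \<in> W \<Longrightarrow> lt True i v' a \<Longrightarrow> le True i v' v" by blast
          have "le True i v y" using lt_le_trans[OF i v(3) ay] by (simp add: le_def)
          then obtain b where b: "b \<in> Y1" "le True i v b" "le True i b y"
            using ord_indD[OF oW i v(1) y] by auto
          have "\<not> lt True i b a"
          proof
            assume "lt True i b a"
            then have "le True i b v" using v(4) b(1) by (auto simp: W_def)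
            then show False using b v(2) le_antisym[OF i] by blast
          qed
          then have "le True i a b" using not_lt[OF i _ aU, of b True] b Y1 by auto
          then show ?thesis using b by blast
        qed
      qed
    qed
  qed
  ultimately have "ind (k3 ` S \<union> W) Y1 Y2" by (simp add: ind_def)
  moreover have "k3 ` S0 \<subseteq> k3 ` S \<union> W"
  proof -
    have im: "k1 ` (Y0 \<union> Y1) = Y1 \<union> Z" by (simp add: image_Un k1Y0 Z_def)
    moreover have "Y0 \<union> Y1 \<subseteq> W" "k1 ` (Y0 \<union> Y1) \<subseteq> W" unfolding im by (auto simp: W_def)
    ultimately have "conj_by (c3 \<circ> c2) k1 ` (Y0 \<union> Y1) = Y1 \<union> Z"
      using conj_stab_image[OF stab_comp[OF c3'(1) c2(1)]] by metis
    then have "k3 ` (Y0 \<union> Y1) = Y1 \<union> Z"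
      using c2 c3 by (simp add: k3_def k2_def conj_by_comp)
    moreover have "S0 \<subseteq> S \<union> (Y0 \<union> Y1)" by (auto simp: S_def)
    ultimately show ?thesis by (auto simp: W_def)
  qed
  ultimately have "ind (k3 ` S0) Y1 Y2" by (blast intro: ind_mono)
  moreover have "k3 = conj_by (c3 \<circ> c2 \<circ> c1) k"
    using c1 c2 c3 by (simp add: k3_def k2_def k1_def conj_by_comp o_assoc)
  moreover have "c3 \<circ> c2 \<circ> c1 \<in> stab (Y0 \<union> Y1)"
    by (intro stab_comp c1(1) stab_mono[OF c2(1)] stab_mono[OF c3'(1)]) (auto simp: W_def)
  ultimately show ?thesis unfolding Y1_def by blast
qed

end

section \<open>Products of conjugates\<close>

context generic_struc
begin

text \<open>The paths from \<open>Y0\<close> through \<open>p1\<close>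
  Y0\<open>and from\<close>Y4\<open>through\<close>q1 \<open>Y4\<close> meet in \<open>Y2\<close>.
  The first legs are made independent from \<open>Y2\<close> on both sides; then one image over
  \<open>Y2\<close>, to the right of all intermediate points, is prescribed for both second legs,
  and \<open>straighten\<close> realises it twice.\<close>

lemma legs_dense:
  assumes good: "good p1" "good p2" "good q1" "good q2"
    and Y0: "finite Y0" "Y0 \<subseteq> U" and Y4: "finite Y4" "Y4 \<subseteq> U"
    and Y2: "Y2 = p2 ` p1 ` Y0" "Y2 = q2 ` q1 ` Y4"
    and indY: "ind Y0 (p1 ` Y0) Y2" "ind Y4 (q1 ` Y4) Y2"
    and \<tau>: "\<tau> \<in> G" "\<And>y. y \<in> Y0 \<Longrightarrow> q2 (q1 (\<tau> y)) = p2 (p1 y)"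
    and S: "finite S" "S \<subseteq> U"
  shows "\<exists>c1\<in>stab (Y0 \<union> p1 ` Y0). \<exists>c2\<in>stab (p1 ` Y0 \<union> Y2).
    \<exists>d1\<in>stab (Y4 \<union> q1 ` Y4). \<exists>d2\<in>stab (q1 ` Y4 \<union> Y2).
    \<forall>x\<in>S. conj_by d2 q2 (conj_by d1 q1 (\<tau> x)) = conj_by c2 p2 (conj_by c1 p1 x)"
proof -
  have G: "p1 \<in> G" "p2 \<in> G" "q1 \<in> G" "q2 \<in> G" using good by (auto simp: good_def)
  define Y1 where "Y1 = p1 ` Y0"
  define Y3 where "Y3 = q1 ` Y4"
  have fin: "finite Y1" "Y1 \<subseteq> U" "finite Y3" "Y3 \<subseteq> U" "finite Y2" "Y2 \<subseteq> U"
    using Y0 Y4 G by (simp_all add: Y1_def Y3_def Y2(1))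
  have p2Y1: "p2 ` Y1 = Y2" "q2 ` Y3 = Y2" using Y2 by (simp_all add: Y1_def Y3_def)
  have \<tau>Y: "\<tau> ` Y0 = Y4"
  proof -
    have "(q2 \<circ> q1) ` \<tau> ` Y0 = (q2 \<circ> q1) ` Y4"
      using \<tau>(2) Y2 by (auto simp: image_image)
    then show ?thesis using G_comp[OF G(4,3)] inv_image_cancel(1) by metis
  qed
  define S4 where "S4 = \<tau> ` S"
  have S4: "finite S4" "S4 \<subseteq> U" using S \<tau>(1) by (simp_all add: S4_def)
  obtain c1 where c1: "c1 \<in> stab (Y0 \<union> Y1)" "ind (conj_by c1 p1 ` S) Y1 Y2"
    using leg_first[OF good(1) Y0 fin(5,6) S indY(1)] unfolding Y1_def by blast
  obtain d1 where d1: "d1 \<in> stab (Y4 \<union> Y3)" "ind (conj_by d1 q1 ` S4) Y3 Y2"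
    using leg_first[OF good(3) Y4 fin(5,6) S4 indY(2)] unfolding Y3_def by blast
  define p1' where "p1' = conj_by c1 p1"
  define q1' where "q1' = conj_by d1 q1"
  have G': "p1' \<in> G" "q1' \<in> G" using G c1 d1 by (simp_all add: p1'_def q1'_def)
  define S1 where "S1 = p1' ` S"
  define S3 where "S3 = q1' ` S4"
  have S13: "finite S1" "S1 \<subseteq> U" "finite S3" "S3 \<subseteq> U" using S S4 G' by (simp_all add: S1_def S3_def)
  have f: "finite (p2 ` S1)" "p2 ` S1 \<subseteq> U" "finite (Y1 \<union> S1 \<union> (Y3 \<union> S3))" "Y1 \<union> S1 \<union> (Y3 \<union> S3) \<subseteq> U"
    using S13 fin G by simp_all
  obtain c where c: "c \<in> stab Y2" "ind (c ` p2 ` S1) Y2 (Y1 \<union> S1 \<union> (Y3 \<union> S3))"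
    using existence[OF f(1) fin(5) f(3) f(2) fin(6) f(4)] by blast
  define \<sigma> where "\<sigma> = c \<circ> p2"
  have \<sigma>: "\<sigma> \<in> G" "\<sigma> ` S1 = c ` p2 ` S1" using c G by (simp_all add: \<sigma>_def image_comp)
  have \<sigma>Y1: "\<sigma> x = p2 x" if "x \<in> Y1" for x
  proof -
    have "p2 x \<in> Y2" using p2Y1 that by blast
    then show ?thesis using stab_fix[OF c(1)] by (simp add: \<sigma>_def)
  qed
  have "ind S1 Y1 (p2 ` Y1)" using c1(2) by (simp add: S1_def p1'_def p2Y1)
  moreover have "ind (\<sigma> ` S1) (p2 ` Y1) (Y1 \<union> S1)"
    unfolding \<sigma>(2) p2Y1 using c(2) by (rule ind_mono) auto
  ultimately obtain c2 where c2: "c2 \<in> stab (Y1 \<union> Y2)" "\<And>s. s \<in> S1 \<Longrightarrow> conj_by c2 p2 s = \<sigma> s"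
    using straighten[OF good(2) fin(1,2) S13(1,2) _ \<sigma>(1) \<sigma>Y1] unfolding p2Y1 by blast
  \<comment> \<open>On \<open>S3\<close> these are the values that the second path must take for the
    product to follow \<open>\<tau>\<close>.\<close>
  define \<sigma>' where "\<sigma>' = \<sigma> \<circ> p1' \<circ> inv \<tau> \<circ> inv q1'"
  have \<sigma>': "\<sigma>' \<in> G" using \<sigma> G' \<tau> by (simp add: \<sigma>'_def)
  have \<sigma>'S: "\<sigma>' (q1' (\<tau> x)) = \<sigma> (p1' x)" for x using G' \<tau> by (simp add: \<sigma>'_def)
  have "\<sigma>' ` S3 = \<sigma> ` S1" using \<sigma>'S by (auto simp: S3_def S4_def S1_def image_image)
  then have 1: "ind (\<sigma>' ` S3) (q2 ` Y3) (Y3 \<union> S3)"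
    unfolding p2Y1 \<sigma>(2) using c(2) by (auto intro: ind_mono)
  have \<sigma>'Y3: "\<sigma>' x = q2 x" if x: "x \<in> Y3" for x
  proof -
    obtain y where y: "y \<in> Y0" "x = q1 (\<tau> y)" using x \<tau>Y by (auto simp: Y3_def)
    have t: "\<tau> y \<in> Y4 \<union> Y3" "q1 (\<tau> y) \<in> Y4 \<union> Y3" using x y \<tau>Y by auto
    have p: "y \<in> Y0 \<union> Y1" "p1 y \<in> Y0 \<union> Y1" using y by (auto simp: Y1_def)
    have "q1' (\<tau> y) = x" using conj_stab_eq[of d1 "Y4 \<union> Y3" "\<tau> y" q1, OF d1(1) t] y by (simp add: q1'_def)
    then have "\<sigma>' x = \<sigma> (p1' y)" using \<sigma>'S by metis
    also have "p1' y = p1 y" using conj_stab_eq[of c1 "Y0 \<union> Y1" y p1, OF c1(1) p] by (simp add: p1'_def)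
    also have "\<sigma> (p1 y) = p2 (p1 y)" using \<sigma>Y1 y by (auto simp: Y1_def)
    also have "\<dots> = q2 x" using \<tau>(2) y by simp
    finally show ?thesis .
  qed
  have 2: "ind S3 Y3 (q2 ` Y3)" using d1(2) by (simp add: S3_def q1'_def p2Y1)
  obtain d2 where d2: "d2 \<in> stab (Y3 \<union> Y2)" "\<And>s. s \<in> S3 \<Longrightarrow> conj_by d2 q2 s = \<sigma>' s"
    using straighten[OF good(4) fin(3,4) S13(3,4) 2 \<sigma>' \<sigma>'Y3 1] unfolding p2Y1 by blast
  have "conj_by d2 q2 (conj_by d1 q1 (\<tau> x)) = conj_by c2 p2 (conj_by c1 p1 x)" if x: "x \<in> S" for x
  proof -
    have "q1' (\<tau> x) \<in> S3" "p1' x \<in> S1" using x by (auto simp: S3_def S4_def S1_def)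
    then show ?thesis using c2(2) d2(2) \<sigma>'S by (metis p1'_def q1'_def)
  qed
  then show ?thesis using c1(1) c2(1) d1(1) d2(1) unfolding Y1_def Y3_def by blast
qed

text \<open>Only the entries \<open>a 0, \<dots>, a 3\<close> matter.\<close>

definition quads :: "(nat \<Rightarrow> 'b \<Rightarrow> 'b) set" where
  "quads = {a. \<forall>j. a j \<in> G}"

definition agree :: "'b set \<Rightarrow> (nat \<Rightarrow> 'b \<Rightarrow> 'b) \<Rightarrow> (nat \<Rightarrow> 'b \<Rightarrow> 'b) \<Rightarrow> bool" where
  "agree E a a' \<longleftrightarrow> (\<forall>j<4. \<forall>x\<in>E. a j x = a' j x)"

definition word :: "('b \<Rightarrow> 'b) \<Rightarrow> (nat \<Rightarrow> 'b \<Rightarrow> 'b) \<Rightarrow> 'b \<Rightarrow> 'b" where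
  "word k a = inv (conj_by (a 3) k \<circ> conj_by (a 2) k) \<circ> (conj_by (a 1) k \<circ> conj_by (a 0) k)"

text \<open>In topological terms: the closure of the image under \<open>word k\<close> of the
  neighbourhood of \<open>a\<close> given by \<open>E\<close> contains the neighbourhood of
  \<open>word k a\<close> given by \<open>Y\<close>.\<close>

definition dense_near :: "('b \<Rightarrow> 'b) \<Rightarrow> (nat \<Rightarrow> 'b \<Rightarrow> 'b) \<Rightarrow> 'b set \<Rightarrow> 'b set \<Rightarrow> bool" where
  "dense_near k a E Y \<longleftrightarrow> (\<forall>\<tau>\<in>G. (\<forall>y\<in>Y. \<tau> y = word k a y) \<longrightarrow>
     (\<forall>S. finite S \<longrightarrow> S \<subseteq> U \<longrightarrow> (\<exists>a'\<in>quads. agree E a' a \<and> (\<forall>x\<in>S. word k a' x = \<tau> x))))"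

lemma quadsI: "(\<And>j. a j \<in> G) \<Longrightarrow> a \<in> quads"
  by (simp add: quads_def)

lemma quadsD [simp]: "a \<in> quads \<Longrightarrow> a j \<in> G"
  by (simp add: quads_def)

lemma word_G: "k \<in> G \<Longrightarrow> a \<in> quads \<Longrightarrow> word k a \<in> G"
  by (simp add: word_def)

lemma word_eq_iff:
  assumes "k \<in> G" "a \<in> quads"
  shows "word k a x = y \<longleftrightarrow>
    conj_by (a 3) k (conj_by (a 2) k y) = conj_by (a 1) k (conj_by (a 0) k x)"
proof -
  have "conj_by (a 3) k \<circ> conj_by (a 2) k \<in> G" using assms by simp
  from inv_eq_G[OF this] show ?thesis by (auto simp: word_def)
qed

lemma dense_near_mono: "dense_near k a E Y \<Longrightarrow> Y \<subseteq> Y' \<Longrightarrow> dense_near k a E Y'"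
  unfolding dense_near_def by blast

lemma dense_near_if:
  assumes good: "good k" and a: "a \<in> quads"
    and Y0: "finite Y0" "Y0 \<subseteq> U" and Y4: "finite Y4" "Y4 \<subseteq> U"
    and Y1: "Y1 = conj_by (a 0) k ` Y0" and Y3: "Y3 = conj_by (a 2) k ` Y4"
    and Y2: "Y2 = conj_by (a 1) k ` Y1" "Y2 = conj_by (a 3) k ` Y3"
    and indY: "ind Y0 Y1 Y2" "ind Y4 Y3 Y2"
    and E: "\<And>j. j < 4 \<Longrightarrow> a j ` E \<subseteq> Y1 \<inter> Y3"
  shows "dense_near k a E Y0"
  unfolding dense_near_def
proof (intro ballI impI allI)
  fix \<tau> S assume \<tau>: "\<tau> \<in> G" "\<forall>y\<in>Y0. \<tau> y = word k a y" and S: "finite S" "S \<subseteq> U"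
  have k: "k \<in> G" using good by (simp add: good_def)
  have \<tau>': "conj_by (a 3) k (conj_by (a 2) k (\<tau> y)) = conj_by (a 1) k (conj_by (a 0) k y)"
    if "y \<in> Y0" for y
    using \<tau>(2) that word_eq_iff[OF k a] by metis
  have goods: "good (conj_by (a j) k)" for j using good_conj[OF _ good] a by simp
  obtain c1 c2 d1 d2 where c: "c1 \<in> stab (Y0 \<union> Y1)" "c2 \<in> stab (Y1 \<union> Y2)"
      "d1 \<in> stab (Y4 \<union> Y3)" "d2 \<in> stab (Y3 \<union> Y2)"
      "\<And>x. x \<in> S \<Longrightarrow> conj_by d2 (conj_by (a 3) k) (conj_by d1 (conj_by (a 2) k) (\<tau> x)) =
        conj_by c2 (conj_by (a 1) k) (conj_by c1 (conj_by (a 0) k) x)"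
    using legs_dense[of "conj_by (a 0) k" "conj_by (a 1) k" "conj_by (a 2) k" "conj_by (a 3) k",
        OF goods goods goods goods Y0 Y4 _ _ _ _ \<tau>(1) \<tau>' S, folded Y1 Y3, OF Y2 indY] by blast
  define a' where "a' = (\<lambda>j::nat. if j = 0 then c1 \<circ> a 0 else if j = 1 then c2 \<circ> a 1
      else if j = 2 then d1 \<circ> a 2 else d2 \<circ> a 3)"
  have a': "a' \<in> quads" by (rule quadsI) (use c a in \<open>simp add: a'_def\<close>)
  have "agree E a' a"
    unfolding agree_def
  proof (intro allI ballI impI)
    fix j :: nat and x assume "j < 4" "x \<in> E"
    then have "a j x \<in> Y1" "a j x \<in> Y3" using E by blast+
    moreover have "j = 0 \<or> j = 1 \<or> j = 2 \<or> j = 3" using \<open>j < 4\<close> by auto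
    ultimately show "a' j x = a j x"
      using stab_fix[OF c(1)] stab_fix[OF c(2)] stab_fix[OF c(3)] stab_fix[OF c(4)]
      by (auto simp: a'_def)
  qed
  moreover have "word k a' x = \<tau> x" if "x \<in> S" for x
    unfolding word_eq_iff[OF k a'] using c(5)[OF that] c(1-4) a by (simp add: a'_def conj_by_comp)
  ultimately show "\<exists>a'\<in>quads. agree E a' a \<and> (\<forall>x\<in>S. word k a' x = \<tau> x)" using a' by blast
qed

text \<open>Only the conjugators of the two first factors change. This moves \<open>Y0\<close> and
  \<open>Y4\<close> into independent position from \<open>Y2\<close> and leaves \<open>Y1\<close>,
  \<open>Y3\<close> and the second factors as they are.\<close>

lemma somewhere_dense:
  assumes good: "good k" and a: "a \<in> quads" and E: "finite E" "E \<subseteq> U"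
  shows "\<exists>a'\<in>quads. agree E a' a \<and> (\<exists>Y. finite Y \<and> Y \<subseteq> U \<and> dense_near k a' E Y)"
proof -
  have k: "k \<in> G" using good by (simp add: good_def)
  define p where "p j = conj_by (a j) k" for j
  have p: "p j \<in> G" for j using k a by (simp add: p_def)
  define X where "X = (\<Union>j<4. a j ` E)"
  have X: "finite X" "X \<subseteq> U" using E a by (auto simp: X_def)
  \<comment> \<open>\<open>Y1\<close> and \<open>Y3\<close> contain the values to be protected and
    are completed so that \<open>p 1\<close> and \<open>p 3\<close> carry them onto the same
    \<open>Y2\<close>.\<close>
  define Y1 where "Y1 = X \<union> inv (p 1) ` p 3 ` X"
  define Y3 where "Y3 = X \<union> inv (p 3) ` p 1 ` X"
  define Y2 where "Y2 = p 1 ` X \<union> p 3 ` X"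
  have Y2: "Y2 = p 1 ` Y1" "Y2 = p 3 ` Y3" using p by (simp_all add: Y1_def Y2_def Y3_def image_Un Un_commute)
  have fin: "finite Y1" "Y1 \<subseteq> U" "finite Y3" "Y3 \<subseteq> U" "finite Y2" "Y2 \<subseteq> U"
    using X p by (simp_all add: Y1_def Y2_def Y3_def)
  have f: "finite (inv (p 0) ` Y1)" "inv (p 0) ` Y1 \<subseteq> U" "finite (inv (p 2) ` Y3)" "inv (p 2) ` Y3 \<subseteq> U"
    using fin p by simp_all
  obtain c where c: "c \<in> stab Y1" "ind (c ` inv (p 0) ` Y1) Y1 Y2"
    using existence[OF f(1) fin(1,5) f(2) fin(2,6)] by blast
  obtain d where d: "d \<in> stab Y3" "ind (d ` inv (p 2) ` Y3) Y3 Y2"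
    using existence[OF f(3) fin(3,5) f(4) fin(4,6)] by blast
  define a' where "a' = (\<lambda>j::nat. if j = 0 then c \<circ> a 0 else if j = 2 then d \<circ> a 2 else a j)"
  have a': "a' \<in> quads" by (rule quadsI) (use c d a in \<open>simp add: a'_def\<close>)
  have agree: "agree E a' a"
    unfolding agree_def
  proof (intro allI ballI impI)
    fix j :: nat and x assume "j < 4" "x \<in> E"
    then have "a j x \<in> Y1" "a j x \<in> Y3" by (auto simp: Y1_def Y3_def X_def)
    then show "a' j x = a j x" using stab_fix[OF c(1)] stab_fix[OF d(1)] by (auto simp: a'_def)
  qed
  define Y0 where "Y0 = c ` inv (p 0) ` Y1"
  define Y4 where "Y4 = d ` inv (p 2) ` Y3"
  have q: "conj_by (a' 0) k = conj_by c (p 0)" "conj_by (a' 2) k = conj_by d (p 2)"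
    "conj_by (a' 1) k = p 1" "conj_by (a' 3) k = p 3"
    using c d a by (simp_all add: a'_def p_def conj_by_comp)
  have im: "conj_by c (p 0) ` Y0 = Y1" "conj_by d (p 2) ` Y4 = Y3"
    using conj_by_image[OF stab_G[OF c(1)], of "p 0"] conj_by_image[OF stab_G[OF d(1)], of "p 2"]
      stab_image[OF c(1), of Y1] stab_image[OF d(1), of Y3] p by (simp_all add: Y0_def Y4_def)
  have f': "finite Y0" "Y0 \<subseteq> U" "finite Y4" "Y4 \<subseteq> U" using f c d by (simp_all add: Y0_def Y4_def)
  have "a' j ` E \<subseteq> Y1 \<inter> Y3" if j: "j < 4" for j
  proof
    fix y assume "y \<in> a' j ` E"
    then obtain x where "x \<in> E" "y = a j x" using agree j by (auto simp: agree_def)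
    then show "y \<in> Y1 \<inter> Y3" using j by (auto simp: Y1_def Y3_def X_def)
  qed
  then have "dense_near k a' E Y0"
    using im Y2 c(2) d(2) q by (intro dense_near_if[OF good a' f', of Y1 Y3 Y2]) (simp_all add: Y0_def Y4_def)
  then show ?thesis using a' agree f' by blast
qed

lemma dense_near_empty:
  assumes "good k" "a \<in> quads" shows "dense_near k a {} {}"
  by (rule dense_near_if[where ?Y4.0="{}" and ?Y2.0="{}" and ?Y1.0="{}" and ?Y3.0="{}", OF assms])
    (auto simp: ind_def free_ind_def ord_ind_def)

text \<open>Continuity of a map from \<open>quads\<close> to \<open>G\<close> under pointwise
  convergence; on \<open>quads\<close> the topology is that of the first four coordinates.\<close>

definition finitely_determined :: "((nat \<Rightarrow> 'b \<Rightarrow> 'b) \<Rightarrow> 'b \<Rightarrow> 'b) \<Rightarrow> bool" where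
  "finitely_determined F \<longleftrightarrow> (\<forall>a\<in>quads. F a \<in> G \<and>
     (\<forall>x\<in>U. \<exists>D. finite D \<and> D \<subseteq> U \<and> (\<forall>a'\<in>quads. agree D a' a \<longrightarrow> F a' x = F a x)))"

lemma finitely_determinedD: "finitely_determined F \<Longrightarrow> a \<in> quads \<Longrightarrow> F a \<in> G"
  by (simp add: finitely_determined_def)

lemma finitely_determined_nbhd:
  "finitely_determined F \<Longrightarrow> a \<in> quads \<Longrightarrow> x \<in> U \<Longrightarrow>
    \<exists>D. finite D \<and> D \<subseteq> U \<and> (\<forall>a'\<in>quads. agree D a' a \<longrightarrow> F a' x = F a x)"
  by (simp add: finitely_determined_def)

lemma finitely_determined_proj: "j < 4 \<Longrightarrow> finitely_determined (\<lambda>a. a j)"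
  unfolding finitely_determined_def
proof (intro ballI conjI)
  fix a x assume "j < 4" "a \<in> quads" "x \<in> U"
  then show "\<exists>D. finite D \<and> D \<subseteq> U \<and> (\<forall>a'\<in>quads. agree D a' a \<longrightarrow> a' j x = a j x)"
    by (intro exI[of _ "{x}"]) (auto simp: agree_def)
qed simp

lemma finitely_determined_const: "k \<in> G \<Longrightarrow> finitely_determined (\<lambda>a. k)"
  unfolding finitely_determined_def by auto

lemma agree_mono: "agree E a a' \<Longrightarrow> D \<subseteq> E \<Longrightarrow> agree D a a'"
  unfolding agree_def by blast

lemma finitely_determined_comp:
  assumes "finitely_determined F" "finitely_determined F'"
  shows "finitely_determined (\<lambda>a. F a \<circ> F' a)"
  unfolding finitely_determined_def
proof (intro ballI conjI)
  fix a assume a: "a \<in> quads"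
  then show "F a \<circ> F' a \<in> G" using assms by (simp add: finitely_determinedD)
  fix x assume x: "x \<in> U"
  obtain D where D: "finite D" "D \<subseteq> U" "\<forall>a'\<in>quads. agree D a' a \<longrightarrow> F' a' x = F' a x"
    using finitely_determined_nbhd[OF assms(2) a x] by (elim exE conjE) (rule that)
  have "F' a x \<in> U" using finitely_determinedD[OF assms(2) a] x by simp
  from finitely_determined_nbhd[OF assms(1) a this] obtain D' where D': "finite D'" "D' \<subseteq> U"
      "\<forall>a'\<in>quads. agree D' a' a \<longrightarrow> F a' (F' a x) = F a (F' a x)" by (elim exE conjE) (rule that)
  show "\<exists>D. finite D \<and> D \<subseteq> U \<and> (\<forall>a'\<in>quads. agree D a' a \<longrightarrow> (F a' \<circ> F' a') x = (F a \<circ> F' a) x)"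
  proof (intro exI[of _ "D \<union> D'"] conjI ballI impI)
    fix a' assume "a' \<in> quads" "agree (D \<union> D') a' a"
    then show "(F a' \<circ> F' a') x = (F a \<circ> F' a) x"
      using D(3) D'(3) agree_mono[of "D \<union> D'" a' a] by simp
  qed (use D D' in simp_all)
qed

lemma finitely_determined_inv:
  assumes "finitely_determined F" shows "finitely_determined (\<lambda>a. inv (F a))"
  unfolding finitely_determined_def
proof (intro ballI conjI)
  fix a assume a: "a \<in> quads"
  have F: "F a' \<in> G" if "a' \<in> quads" for a' using assms that by (rule finitely_determinedD)
  show "inv (F a) \<in> G" using F[OF a] by simp
  fix x assume x: "x \<in> U"
  define y where "y = inv (F a) x"
  have y: "y \<in> U" "F a y = x" using F[OF a] x by (simp_all add: y_def)
  obtain D where D: "finite D" "D \<subseteq> U" "\<forall>a'\<in>quads. agree D a' a \<longrightarrow> F a' y = F a y"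
    using finitely_determined_nbhd[OF assms a y(1)] by (elim exE conjE) (rule that)
  show "\<exists>D. finite D \<and> D \<subseteq> U \<and> (\<forall>a'\<in>quads. agree D a' a \<longrightarrow> inv (F a') x = inv (F a) x)"
  proof (intro exI[of _ D] conjI ballI impI)
    fix a' assume "a' \<in> quads" "agree D a' a"
    then have "F a' y = x" "F a' \<in> G" using D(3) y F by auto
    then show "inv (F a') x = inv (F a) x" by (simp add: inv_eq_G y_def[symmetric])
  qed (use D in simp_all)
qed

lemma finitely_determined_word:
  assumes "k \<in> G" shows "finitely_determined (word k)"
proof -
  have 1: "finitely_determined (\<lambda>a. conj_by (a j) k)" if "j < 4" for j
    unfolding conj_by_def
    by (intro finitely_determined_comp finitely_determined_inv finitely_determined_proj
        finitely_determined_const that assms)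
  show ?thesis
    unfolding word_def by (intro finitely_determined_comp finitely_determined_inv 1) auto
qed

lemma word_continuous:
  assumes k: "k \<in> G" and a: "a \<in> quads" and Y: "finite Y" "Y \<subseteq> U"
  shows "\<exists>D. finite D \<and> D \<subseteq> U \<and> (\<forall>a'\<in>quads. agree D a' a \<longrightarrow> (\<forall>y\<in>Y. word k a' y = word k a y))"
proof -
  have "\<forall>y\<in>Y. \<exists>D. finite D \<and> D \<subseteq> U \<and> (\<forall>a'\<in>quads. agree D a' a \<longrightarrow> word k a' y = word k a y)"
    using finitely_determined_word[OF k] a Y(2) unfolding finitely_determined_def by blast
  from bchoice[OF this] obtain D where D: "\<forall>y\<in>Y. finite (D y) \<and> D y \<subseteq> U \<and>
      (\<forall>a'\<in>quads. agree (D y) a' a \<longrightarrow> word k a' y = word k a y)" by (rule exE)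
  show ?thesis
  proof (intro exI[of _ "\<Union>y\<in>Y. D y"] conjI ballI impI)
    fix a' y assume "a' \<in> quads" "agree (\<Union>y\<in>Y. D y) a' a" "y \<in> Y"
    then show "word k a' y = word k a y" using D agree_mono[of "\<Union>y\<in>Y. D y" a' a "D y"] by blast
  qed (use D Y in auto)
qed

text \<open>A position in the game for \<open>f \<circ> word k b = word k a\<close>: the two sides agree on \<open>Y\<close>, and \<open>a\<close> can still be
  changed off \<open>E\<close> to realise any extension of the values on \<open>Y\<close>.  A half move extends \<open>b\<close>, answers with
  such a change of \<open>a\<close>, and exchanges the two sides.\<close>

definition game_state where
  "game_state k f a E Y b D \<longleftrightarrow> a \<in> quads \<and> b \<in> quads \<and> finite E \<and> E \<subseteq> U \<and> finite Y \<and> Y \<subseteq> U \<and>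
     finite D \<and> D \<subseteq> U \<and> dense_near k a E Y \<and> (\<forall>y\<in>Y. f (word k b y) = word k a y)"

lemma half_move:
  assumes good: "good k" and f: "f \<in> G" and st: "game_state k f a E Y b D" and u: "u \<in> U"
  shows "\<exists>b' D' Y' a'. game_state k (inv f) b' D' Y' a' E \<and> agree D b' b \<and> agree E a' a \<and>
    insert u D \<subseteq> D' \<and> insert u Y \<subseteq> Y' \<and> (\<forall>j<4. u \<in> b' j ` D')"
proof -
  have k: "k \<in> G" using good by (simp add: good_def)
  have st': "a \<in> quads" "b \<in> quads" "finite E" "E \<subseteq> U" "finite Y" "Y \<subseteq> U" "finite D" "D \<subseteq> U"
    "dense_near k a E Y" "\<And>y. y \<in> Y \<Longrightarrow> f (word k b y) = word k a y"
    using st by (auto simp: game_state_def)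
  obtain D0 where D0: "finite D0" "D0 \<subseteq> U"
      "\<And>b'. b' \<in> quads \<Longrightarrow> agree D0 b' b \<Longrightarrow> \<forall>y\<in>Y. word k b' y = word k b y"
    using word_continuous[OF k st'(2,5,6)] by blast
  \<comment> \<open>\<open>D0\<close> protects the word of \<open>b\<close> on \<open>Y\<close>; the
    preimages of \<open>u\<close> put \<open>u\<close> into the range of each of the four
    entries.\<close>
  define D' where "D' = insert u D \<union> D0 \<union> (\<Union>j<4. {inv (b j) u})"
  have D': "finite D'" "D' \<subseteq> U" "insert u D \<subseteq> D'" "D0 \<subseteq> D'" using st' D0 u by (auto simp: D'_def)
  obtain b' Y1 where b': "b' \<in> quads" "agree D' b' b" "finite Y1" "Y1 \<subseteq> U" "dense_near k b' D' Y1"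
    using somewhere_dense[OF good st'(2) D'(1,2)] by blast
  define Y' where "Y' = Y1 \<union> insert u Y"
  have Y': "finite Y'" "Y' \<subseteq> U" "dense_near k b' D' Y'"
    using b' st' u dense_near_mono[of k b' D' Y1 Y'] by (auto simp: Y'_def)
  have "f \<circ> word k b' \<in> G" using f word_G[OF k b'(1)] by simp
  moreover have "(f \<circ> word k b') y = word k a y" if "y \<in> Y" for y
    using D0(3)[OF b'(1) agree_mono[OF b'(2) D'(4)]] st'(10) that by simp
  ultimately obtain a' where a': "a' \<in> quads" "agree E a' a" "\<forall>x\<in>Y'. word k a' x = (f \<circ> word k b') x"
    using st'(9) Y'(1,2) unfolding dense_near_def by blast
  have "inv f (word k a' y) = word k b' y" if "y \<in> Y'" for y
    using a'(3) that f by simp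
  then have "game_state k (inv f) b' D' Y' a' E"
    using a' b' D' Y' st' by (simp add: game_state_def)
  moreover have "u \<in> b' j ` D'" if j: "j < 4" for j
  proof -
    have "inv (b j) u \<in> D'" using j by (auto simp: D'_def)
    moreover have "b' j (inv (b j) u) = u"
      using b'(2) j calculation st'(2) by (simp add: agree_def)
    ultimately show ?thesis by (metis image_eqI)
  qed
  moreover have "agree D b' b" using agree_mono[OF b'(2)] D'(3) by simp
  moreover have "insert u Y \<subseteq> Y'" by (auto simp: Y'_def)
  ultimately show ?thesis using a'(2) D'(3) by blast
qed

section \<open>Playing the game to its end\<close>

lemma agree_trans: "agree E a b \<Longrightarrow> agree E b c \<Longrightarrow> agree E a c"
  by (simp add: agree_def)

lemma finite_subset_chain:
  fixes E :: "nat \<Rightarrow> 'b set"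
  assumes "finite X" "X \<subseteq> U" and mono: "\<And>n. E n \<subseteq> E (Suc n)" and dom: "\<And>x. x \<in> U \<Longrightarrow> \<exists>n. x \<in> E n"
  shows "\<exists>n. X \<subseteq> E n"
  using assms(1,2)
proof (induction X rule: finite_induct)
  case (insert x X)
  then obtain n m where "X \<subseteq> E n" "x \<in> E m" using dom by blast
  moreover have "E n \<subseteq> E (max n m)" "E m \<subseteq> E (max n m)"
    by (simp_all add: lift_Suc_mono_le[of E, OF mono])
  ultimately show ?case by (meson insert_subset order_trans subsetD)
qed simp

lemma quads_fusion:
  assumes a: "\<And>n. a n \<in> quads" and mono: "\<And>n. E n \<subseteq> E (Suc n)"
    and ag: "\<And>n. agree (E n) (a (Suc n)) (a n)"
    and dom: "\<And>x. x \<in> U \<Longrightarrow> \<exists>n. x \<in> E n"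
    and ran: "\<And>x j. x \<in> U \<Longrightarrow> j < 4 \<Longrightarrow> \<exists>n. x \<in> a n j ` E n"
  shows "\<exists>A\<in>quads. \<forall>n. agree (E n) A (a n)"
proof -
  have "\<exists>g\<in>G. \<forall>n. \<forall>x\<in>E n. g x = a n j x" if "j < 4" for j
    by (rule G_fusion) (use a mono ag dom ran that in \<open>auto simp: agree_def\<close>)
  then have "\<forall>j. \<exists>g\<in>G. j < 4 \<longrightarrow> (\<forall>n. \<forall>x\<in>E n. g x = a n j x)" using G_id by blast
  then obtain A where "\<forall>j. A j \<in> G \<and> (j < 4 \<longrightarrow> (\<forall>n. \<forall>x\<in>E n. A j x = a n j x))" by metis
  then show ?thesis by (intro bexI[of _ A]) (auto simp: agree_def intro: quadsI)
qed

theorem product_of_conjugates: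
  assumes good: "good k" and f: "f \<in> G"
  shows "\<exists>a\<in>quads. \<exists>b\<in>quads. f = word k a \<circ> inv (word k b)"
proof -
  have k: "k \<in> G" using good by (simp add: good_def)
  obtain u :: "nat \<Rightarrow> 'b" where u: "range u = U" by (rule enumerate_U)
  define St where "St = (\<lambda>(a, E, Y, b, D). game_state k f a E Y b D)"
  define R where "R n = (\<lambda>(a, E, Y, b, D) (a', E', Y', b', D'). agree E a' a \<and> agree D b' b \<and>
      E \<subseteq> E' \<and> D \<subseteq> D' \<and> Y \<subseteq> Y' \<and> u n \<in> E' \<inter> D' \<inter> Y' \<and> (\<forall>j<4. u n \<in> a' j ` E' \<and> u n \<in> b' j ` D'))" for n
  have "\<exists>s. \<forall>n. St (s n) \<and> R n (s n) (s (Suc n))"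
  proof (rule dependent_nat_choice)
    have "(\<lambda>j. id) \<in> quads" by (rule quadsI) simp
    then have "St (\<lambda>j. id, {}, {}, \<lambda>j. id, {})"
      using dense_near_empty[OF good] by (simp add: St_def game_state_def)
    then show "\<exists>x. St x" by blast
  next
    fix x n assume "St x"
    then obtain a E Y b D where x: "x = (a, E, Y, b, D)" "game_state k f a E Y b D"
      by (auto simp: St_def split: prod.splits)
    have un: "u n \<in> U" using u by blast
    obtain b1 D1 Y1 a1 where 1: "game_state k (inv f) b1 D1 Y1 a1 E" "agree D b1 b" "agree E a1 a"
        "insert (u n) D \<subseteq> D1" "insert (u n) Y \<subseteq> Y1" "\<forall>j<4. u n \<in> b1 j ` D1"
      using half_move[OF good f x(2) un] by (elim exE conjE) (rule that)
    \<comment> \<open>Two half moves make a round: the sides are exchanged twice, and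
      \<open>f\<close> returns as \<open>inv (inv f)\<close>.\<close>
    obtain a2 E2 Y2 b2 where 2: "game_state k (inv (inv f)) a2 E2 Y2 b2 D1" "agree E a2 a1" "agree D1 b2 b1"
        "insert (u n) E \<subseteq> E2" "insert (u n) Y1 \<subseteq> Y2" "\<forall>j<4. u n \<in> a2 j ` E2"
      using half_move[OF good G_inv[OF f] 1(1) un] by (elim exE conjE) (rule that)
    have "St (a2, E2, Y2, b2, D1)" using 2(1) f by (simp add: St_def)
    moreover have "agree E a2 a" using agree_trans 2(2) 1(3) by blast
    moreover have "agree D b2 b" using agree_trans[OF agree_mono[OF 2(3)] 1(2)] 1(4) by simp
    moreover have "u n \<in> b2 j ` D1" if j: "j < 4" for j
    proof -
      have "b2 j ` D1 = b1 j ` D1" using 2(3) j by (auto simp: agree_def)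
      then show ?thesis using 1(6) j by simp
    qed
    ultimately have "St (a2, E2, Y2, b2, D1) \<and> R n x (a2, E2, Y2, b2, D1)"
      using 1 2 by (auto simp: R_def x(1))
    then show "\<exists>y. St y \<and> R n x y" by blast
  qed
  then obtain s where s: "\<And>n. St (s n)" "\<And>n. R n (s n) (s (Suc n))" by blast
  define a where "a n = fst (s n)" for n
  define E where "E n = fst (snd (s n))" for n
  define Y where "Y n = fst (snd (snd (s n)))" for n
  define b where "b n = fst (snd (snd (snd (s n))))" for n
  define D where "D n = snd (snd (snd (snd (s n))))" for n
  have s_eq: "s n = (a n, E n, Y n, b n, D n)" for n by (simp add: a_def E_def Y_def b_def D_def)
  have quad: "a n \<in> quads" "b n \<in> quads" and eq: "y \<in> Y n \<Longrightarrow> f (word k (b n) y) = word k (a n) y" for n y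
    using s(1)[of n] by (auto simp: St_def s_eq game_state_def)
  have nxt: "agree (E n) (a (Suc n)) (a n)" "agree (D n) (b (Suc n)) (b n)" "E n \<subseteq> E (Suc n)"
    "D n \<subseteq> D (Suc n)" "Y n \<subseteq> Y (Suc n)" "u n \<in> E (Suc n)" "u n \<in> D (Suc n)" "u n \<in> Y (Suc n)"
    "j < 4 \<Longrightarrow> u n \<in> a (Suc n) j ` E (Suc n)" "j < 4 \<Longrightarrow> u n \<in> b (Suc n) j ` D (Suc n)" for n j
    using s(2)[of n] by (auto simp: R_def s_eq)
  have ran_ex: "\<exists>n. x = u n" if "x \<in> U" for x using that u by blast
  have "\<exists>A\<in>quads. \<forall>n. agree (E n) A (a n)"
  proof (rule quads_fusion)
    show "\<And>n. a n \<in> quads" "\<And>n. E n \<subseteq> E (Suc n)" "\<And>n. agree (E n) (a (Suc n)) (a n)"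
      using quad nxt by blast+
    show "\<exists>n. x \<in> E n" if "x \<in> U" for x using ran_ex[OF that] nxt(6) by blast
    show "\<exists>n. x \<in> a n j ` E n" if "x \<in> U" "j < 4" for x j using ran_ex[OF that(1)] nxt(9)[OF that(2)] by blast
  qed
  then obtain A where A: "A \<in> quads" "\<And>n. agree (E n) A (a n)" by blast
  have "\<exists>B\<in>quads. \<forall>n. agree (D n) B (b n)"
  proof (rule quads_fusion)
    show "\<And>n. b n \<in> quads" "\<And>n. D n \<subseteq> D (Suc n)" "\<And>n. agree (D n) (b (Suc n)) (b n)"
      using quad nxt by blast+
    show "\<exists>n. x \<in> D n" if "x \<in> U" for x using ran_ex[OF that] nxt(7) by blast
    show "\<exists>n. x \<in> b n j ` D n" if "x \<in> U" "j < 4" for x j using ran_ex[OF that(1)] nxt(10)[OF that(2)] by blast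
  qed
  then obtain B where B: "B \<in> quads" "\<And>n. agree (D n) B (b n)" by blast
  \<comment> \<open>Each word at \<open>x\<close> depends on finitely many values of
    \<open>A\<close> or \<open>B\<close>; at some stage these are frozen and \<open>x\<close>
    belongs to \<open>Y n\<close>, where the two sides agree.\<close>
  have main: "word k A x = f (word k B x)" if x: "x \<in> U" for x
  proof -
    obtain C1 where C1: "finite C1" "C1 \<subseteq> U"
        "\<And>a'. a' \<in> quads \<Longrightarrow> agree C1 a' A \<Longrightarrow> word k a' x = word k A x"
      using word_continuous[OF k A(1), of "{x}"] x by auto
    obtain C2 where C2: "finite C2" "C2 \<subseteq> U"
        "\<And>b'. b' \<in> quads \<Longrightarrow> agree C2 b' B \<Longrightarrow> word k b' x = word k B x"
      using word_continuous[OF k B(1), of "{x}"] x by auto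
    have "\<exists>n. X \<subseteq> E n \<inter> D n \<inter> Y n" if "finite X" "X \<subseteq> U" for X
    proof (rule finite_subset_chain[OF that])
      show "\<And>n. E n \<inter> D n \<inter> Y n \<subseteq> E (Suc n) \<inter> D (Suc n) \<inter> Y (Suc n)" using nxt(3-5) by blast
      show "\<exists>n. x \<in> E n \<inter> D n \<inter> Y n" if "x \<in> U" for x using ran_ex[OF that] nxt(6-8) by blast
    qed
    moreover have "finite (insert x (C1 \<union> C2))" "insert x (C1 \<union> C2) \<subseteq> U" using C1 C2 x by auto
    ultimately obtain n where n: "insert x (C1 \<union> C2) \<subseteq> E n \<inter> D n \<inter> Y n" by meson
    have "agree C1 (a n) A" "agree C2 (b n) B"
      using A(2)[of n] B(2)[of n] n unfolding agree_def by (metis Int_iff UnI1 UnI2 insertI2 subsetD)+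
    then have "word k (a n) x = word k A x" "word k (b n) x = word k B x" using C1(3) C2(3) quad by auto
    then show ?thesis using eq[of x n] n by simp
  qed
  have wG: "word k A \<in> G" "word k B \<in> G" using word_G[OF k] A B by simp_all
  have "f y = word k A (inv (word k B) y)" for y
  proof (cases "y \<in> U")
    case True
    then show ?thesis using main[of "inv (word k B) y"] wG by simp
  next
    case False
    then have "inv (word k B) y = y" using G_out[OF G_inv[OF wG(2)]] by blast
    then show ?thesis using G_out[OF wG(1) False] G_out[OF f False] by simp
  qed
  then have "f = word k A \<circ> inv (word k B)" by auto
  then show ?thesis using A(1) B(1) by blast
qed

text \<open>If \<open>h0\<close> fixed every realisation of some type over \<open>W\<close> outside
  \<open>W\<close>, it would fix a set that is dense in an interval, hence the whole interval,
  against \<open>rigid\<close>. So \<open>fixed_point_free_commutator\<close> applies, and a second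
  commutator is good.\<close>

theorem normal_subgroup_eq_G:
  assumes rigid: "\<exists>i\<in>I. \<forall>h\<in>G. \<forall>\<alpha> \<beta>. lt True i \<alpha> \<beta> \<longrightarrow>
      (\<forall>w. lt True i \<alpha> w \<longrightarrow> lt True i w \<beta> \<longrightarrow> h w = w) \<longrightarrow> h = id"
    and H: "H \<subseteq> G" "h0 \<in> H" "h0 \<noteq> id"
    and comp: "\<And>g h. g \<in> H \<Longrightarrow> h \<in> H \<Longrightarrow> g \<circ> h \<in> H" and inv: "\<And>h. h \<in> H \<Longrightarrow> inv h \<in> H"
    and conj: "\<And>g h. g \<in> G \<Longrightarrow> h \<in> H \<Longrightarrow> conj_by g h \<in> H"
  shows "H = G"
proof -
  have h0: "h0 \<in> G" using H by blast
  have "\<exists>c\<in>stab W. h0 (c x) \<noteq> c x" if W: "finite W" "W \<subseteq> U" and x: "x \<in> U" "x \<notin> W" for W x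
  proof (rule ccontr)
    assume neg: "\<not> ?thesis"
    obtain i where i: "i \<in> I" and rig: "\<And>h \<alpha> \<beta>. h \<in> G \<Longrightarrow> lt True i \<alpha> \<beta> \<Longrightarrow>
        (\<And>w. lt True i \<alpha> w \<Longrightarrow> lt True i w \<beta> \<Longrightarrow> h w = w) \<Longrightarrow> h = id"
      using rigid by blast
    obtain c where c: "c \<in> stab W" "ord_ind (\<lambda>_. True) {c x} W {x}"
      using existence_point[of W "{x}" x] W x by blast
    \<comment> \<open>Another realisation, to the right of \<open>x\<close> in the same cut of
      \<open>W\<close>; between the two no point of \<open>W\<close> intervenes.\<close>
    define \<beta> where "\<beta> = c x"
    have \<beta>: "\<beta> \<in> U" using c x by (simp add: \<beta>_def)
    have "\<not> le True i \<beta> x"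
    proof
      assume "le True i \<beta> x"
      then obtain b where b: "b \<in> W" "le True i \<beta> b" "le True i b x"
        using ord_indD[OF c(2) i, of "c x" x] by (auto simp: \<beta>_def)
      have "le True i x b" using b(2) le_G[OF stab_G[OF c(1)], of True i x b] stab_fix[OF c(1) b(1)]
        by (simp add: \<beta>_def)
      then have "x = b" using b(3) le_antisym[OF i] by blast
      then show False using b x by blast
    qed
    then have x\<beta>: "lt True i x \<beta>" using not_le[OF i \<beta> x(1)] by blast
    have cut: False if "b \<in> W" "le True i x b" "lt True i b \<beta>" for b
    proof -
      have "lt True i b x"
        using that(3) lt_G[OF stab_G[OF c(1)], of True i b x] stab_fix[OF c(1) that(1)] by (simp add: \<beta>_def)
      then show False using that(2) lt_le_trans[OF i] lt_irrefl[OF i] by blast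
    qed
    have dense: "\<exists>r. h0 r = r \<and> lt True i p r \<and> lt True i r q"
      if pq: "lt True i p q" "le True i x p" "le True i q \<beta>" for p q
    proof -
      have pqU: "p \<in> U" "q \<in> U" using lt_U[OF pq(1)] by auto
      have xq: "lt True i x q" using pq le_lt_trans[OF i] by blast
      obtain d where d: "d \<in> stab (insert q W)" "ord_ind (\<lambda>_. True) {d x} (insert q W) {p}"
        using existence_point[of "insert q W" "{p}" x] W x pqU by blast
      have dU: "d x \<in> U" using d x by simp
      have dq: "lt True i (d x) q"
        using xq lt_G[OF stab_G[OF d(1)], of True i x q] stab_fix[OF d(1), of q] by simp
      have "\<not> le True i (d x) p"
      proof
        assume "le True i (d x) p"
        then obtain b where b: "b \<in> insert q W" "le True i (d x) b" "le True i b p"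
          using ord_indD[OF d(2) i, of "d x" p] by auto
        have bq: "lt True i b q" using le_lt_trans[OF i b(3) pq(1)] .
        then have bW: "b \<in> W" using b lt_irrefl[OF i] by blast
        have "le True i x b" using b(2) le_G[OF stab_G[OF d(1)], of True i x b] stab_fix[OF d(1) b(1)] by simp
        then show False using cut[OF bW] lt_le_trans[OF i bq pq(3)] by blast
      qed
      then have "lt True i p (d x)" using not_le[OF i dU pqU(1)] by blast
      moreover have "h0 (d x) = d x" using neg stab_mono[OF d(1), of W] by blast
      ultimately show ?thesis using dq by blast
    qed
    \<comment> \<open>If \<open>w\<close> were moved, a fixed point strictly between
      \<open>w\<close> and \<open>h0 w\<close> would contradict monotonicity.\<close>
    have "h0 w = w" if w: "lt True i x w" "lt True i w \<beta>" for w
    proof (rule ccontr)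
      assume ne: "h0 w \<noteq> w"
      have wU: "w \<in> U" "h0 w \<in> U" using lt_U[OF w(1)] h0 by auto
      then consider "lt True i w (h0 w)" | "lt True i (h0 w) w" using ne lt_total[OF i] by metis
      then show False
      proof cases
        case 1
        have "\<exists>q. lt True i w q \<and> le True i q \<beta> \<and> le True i q (h0 w)"
        proof (cases "le True i \<beta> (h0 w)")
          case True then show ?thesis using w le_refl by blast
        next
          case False
          then have "le True i (h0 w) \<beta>" using not_le[OF i \<beta> wU(2)] by (auto simp: le_def)
          then show ?thesis using 1 le_refl by blast
        qed
        then obtain q where q: "lt True i w q" "le True i q \<beta>" "le True i q (h0 w)" by blast
        obtain r where r: "h0 r = r" "lt True i w r" "lt True i r q"
          using dense[OF q(1) _ q(2)] w(1) by (auto simp: le_def)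
        have "lt True i (h0 w) r" using r(1,2) lt_G[OF h0, of True i w r] by simp
        moreover have "lt True i r (h0 w)" using lt_le_trans[OF i r(3) q(3)] .
        ultimately show False using lt_asym[OF i] by blast
      next
        case 2
        have "\<exists>p. lt True i p w \<and> le True i x p \<and> le True i (h0 w) p"
        proof (cases "le True i (h0 w) x")
          case True then show ?thesis using w le_refl by blast
        next
          case False
          then have "le True i x (h0 w)" using not_le[OF i wU(2) x(1)] by (auto simp: le_def)
          then show ?thesis using 2 le_refl by blast
        qed
        then obtain p where p: "lt True i p w" "le True i x p" "le True i (h0 w) p" by blast
        obtain r where r: "h0 r = r" "lt True i p r" "lt True i r w"
          using dense[OF p(1,2)] w(2) by (auto simp: le_def)
        have "lt True i r (h0 w)" using r(1,3) lt_G[OF h0, of True i r w] by simp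
        moreover have "lt True i (h0 w) r" using le_lt_trans[OF i p(3) r(2)] .
        ultimately show False using lt_asym[OF i] by blast
      qed
    qed
    then have "h0 = id" using rig[OF h0 x\<beta>] by blast
    then show False using H(3) by simp
  qed
  then obtain g1 where g1: "g1 \<in> G" "\<And>x. x \<in> U \<Longrightarrow> g1 (h0 x) \<noteq> h0 (g1 x)"
    using fixed_point_free_commutator[OF h0] by blast
  have comm_H: "inv g \<circ> inv h \<circ> g \<circ> h \<in> H" if "g \<in> G" "h \<in> H" for g h
  proof -
    have "conj_by (inv g) (inv h) \<in> H" using conj[OF G_inv[OF that(1)] inv[OF that(2)]] .
    then show ?thesis using comp[OF _ that(2)] that(1) by (simp add: conj_by_def)
  qed
  define h1 where "h1 = inv g1 \<circ> inv h0 \<circ> g1 \<circ> h0"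
  have h1: "h1 \<in> H" "h1 \<in> G" using comm_H[OF g1(1) H(2)] H(1) by (auto simp: h1_def)
  have "h1 x \<noteq> x" if "x \<in> U" for x
    using g1(2)[OF that] g1(1) h0 by (simp add: h1_def inv_eq_G)
  then obtain g2 where g2: "g2 \<in> G" "good (inv g2 \<circ> inv h1 \<circ> g2 \<circ> h1)"
    using good_commutator[OF h1(2)] by blast
  define k where "k = inv g2 \<circ> inv h1 \<circ> g2 \<circ> h1"
  have k: "k \<in> H" "good k" using comm_H[OF g2(1) h1(1)] g2(2) by (simp_all add: k_def)
  have word: "word k a \<in> H" if "a \<in> quads" for a
    unfolding word_def using that by (intro comp inv conj k(1)) simp_all
  have "G \<subseteq> H"
  proof
    fix f assume "f \<in> G"
    then obtain a b where "a \<in> quads" "b \<in> quads" "f = word k a \<circ> inv (word k b)"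
      using product_of_conjugates[OF k(2)] by blast
    then show "f \<in> H" using comp inv word by blast
  qed
  then show ?thesis using H(1) by blast
qed

end

section \<open>Rigidity on intervals\<close>

context generic_struc
begin

lemma box_point:
  assumes "\<And>i. i \<in> I \<Longrightarrow> lt True i (p i) (q i)"
  shows "\<exists>x\<in>U. \<forall>i\<in>I. lt True i (p i) x \<and> lt True i x (q i)"
proof -
  define C where "C = p ` I \<union> q ` I"
  have C: "finite C" "C \<subseteq> U" using finite_I lt_U[OF assms] by (auto simp: C_def)
  define D where "D i = {c \<in> C. le True i c (p i)}" for i
  obtain x where x: "x \<in> U" using U_ne by blast
  have "\<exists>g\<in>stab {}. g x \<notin> C \<and> (\<forall>i\<in>I. \<forall>c\<in>C. lt True i c (g x) \<longleftrightarrow> c \<in> D i) \<and> free_ind {g x} {} C"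
  proof (rule ext[OF C _ x])
    fix j c d assume "j \<in> I" "c \<in> C" "d \<in> D j" "lt True j c d"
    then show "c \<in> D j" using lt_le_trans[of j True c d] unfolding D_def le_def by auto
  qed (auto simp: D_def)
  then obtain g where g: "g \<in> G" "g x \<notin> C" "\<And>i c. i \<in> I \<Longrightarrow> c \<in> C \<Longrightarrow> lt True i c (g x) \<longleftrightarrow> c \<in> D i"
    using stab_G by metis
  have gU: "g x \<in> U" using g x by simp
  have "lt True i (p i) (g x) \<and> lt True i (g x) (q i)" if i: "i \<in> I" for i
  proof -
    have pq: "p i \<in> C" "q i \<in> C" using i by (auto simp: C_def)
    have "p i \<in> D i" using pq by (simp add: D_def)
    moreover have "q i \<notin> D i" using lt_le_trans[OF i assms[OF i], of "p i"] lt_irrefl[OF i] by (auto simp: D_def)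
    ultimately have 1: "lt True i (p i) (g x)" "\<not> lt True i (q i) (g x)"
      using g(3)[OF i pq(1)] g(3)[OF i pq(2)] by simp_all
    have "q i \<in> U" "g x \<noteq> q i" using pq(2) C(2) g(2) by auto
    then show ?thesis using 1 lt_total[OF i gU, of "q i" True] by simp
  qed
  then show ?thesis using gU by blast
qed

text \<open>If \<open>h\<close> moves \<open>y\<close>, some \<open>v\<close> lies between
  \<open>\<alpha>\<close> and \<open>\<beta>\<close> in order \<open>i\<close> and between
  \<open>y\<close> and \<open>h y\<close> in order \<open>j\<close>. It is fixed by
  \<open>h\<close>, although \<open>y\<close> and \<open>h y\<close> lie on different sides of it in
  order \<open>j\<close>.\<close>

lemma rigid_by_second_order:
  assumes ij: "i \<in> I" "j \<in> I" "i \<noteq> j" and h: "h \<in> G" and \<alpha>\<beta>: "lt True i \<alpha> \<beta>"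
    and fixed: "\<And>w. lt True i \<alpha> w \<Longrightarrow> lt True i w \<beta> \<Longrightarrow> h w = w"
  shows "h = id"
proof -
  have U: "\<alpha> \<in> U" "\<beta> \<in> U" "\<alpha> \<noteq> \<beta>" using lt_U[OF \<alpha>\<beta>] \<alpha>\<beta> lt_irrefl[OF ij(1)] by auto
  \<comment> \<open>The conclusion is an arbitrary equation because the assumptions are
    contradictory.\<close>
  have no: "w = h w" if pq: "lt True j p q" "p = y \<and> q = h y \<or> p = h y \<and> q = y" for y p q w
  proof -
    define P where "P k = (if k = i then \<alpha> else if k = j then p else if lt True k \<alpha> \<beta> then \<alpha> else \<beta>)" for k
    define Q where "Q k = (if k = i then \<beta> else if k = j then q else if lt True k \<alpha> \<beta> then \<beta> else \<alpha>)" for k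
    have "lt True k (P k) (Q k)" if "k \<in> I" for k
      using \<alpha>\<beta> pq lt_total[OF that U(1,2), of True] U(3) by (auto simp: P_def Q_def)
    from box_point[of P Q, OF this] obtain v where v: "v \<in> U" "\<forall>k\<in>I. lt True k (P k) v \<and> lt True k v (Q k)"
      by blast
    have "lt True i \<alpha> v" "lt True i v \<beta>" using v(2) ij(1) by (force simp: P_def Q_def)+
    then have hv: "h v = v" by (rule fixed)
    have pvq: "lt True j p v" "lt True j v q" using v(2) ij(2,3) by (force simp: P_def Q_def)+
    have "lt True j (h v) (h y) \<longleftrightarrow> lt True j v y" "lt True j (h y) (h v) \<longleftrightarrow> lt True j y v" using h by simp_all
    then show ?thesis using pq(2) pvq hv lt_asym[OF ij(2)] by metis
  qed
  have "h y = y" for y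
  proof (cases "y \<in> U")
    case True
    then have "lt True j y (h y) \<or> y = h y \<or> lt True j (h y) y" using lt_total[OF ij(2)] h by simp
    then show ?thesis using no[of y "h y" y y] no[of "h y" y y y] by auto
  qed (simp add: G_out[OF h])
  then show ?thesis by auto
qed

text \<open>A point \<open>y\<close> moved by \<open>h\<close> is tied by a relation to points of
  the fixed interval. \<open>h\<close> keeps these and moves \<open>y\<close>, but they were chosen
  free from \<open>h y\<close>. The fixed interval may lie on either side of \<open>y\<close>, so
  for each orientation a tuple with \<open>d b\<close> as its first entry is needed.\<close>

lemma rigid_by_relation:
  assumes I: "I = {i}"
    and tup: "\<And>b. \<exists>R t E. R \<notin> I \<and> t \<in> rel N R \<and> set t = insert (d b) E \<and> E \<noteq> {} \<and> (\<forall>e\<in>E. lt b i (d b) e)"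
    and orbit: "g0 \<in> G" "g0 (d True) = d False"
    and h: "h \<in> G" and \<alpha>\<beta>: "lt True i \<alpha> \<beta>"
    and fixed: "\<And>w. lt True i \<alpha> w \<Longrightarrow> lt True i w \<beta> \<Longrightarrow> h w = w"
  shows "h = id"
proof (rule ccontr)
  assume "h \<noteq> id"
  have i: "i \<in> I" using I by simp
  obtain z0 where z0: "h z0 \<noteq> z0" using \<open>h \<noteq> id\<close> by (metis eq_id_iff)
  then have z0U: "z0 \<in> U" "h z0 \<in> U" using G_out[OF h] h by auto
  have dU: "d True \<in> U" using tup[of True] rel_U by blast
  \<comment> \<open>The moved point has to come from the orbit of \<open>d True\<close>. This orbit
    meets the interval between \<open>z0\<close> and \<open>h z0\<close>, where \<open>h\<close>
    moves every point.\<close>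
  have "\<exists>b p q. lt b i p q \<and> (p = z0 \<and> q = h z0)"
    using lt_total[OF i z0U, of True] z0 lt_False by metis
  then obtain b0 where b0: "lt b0 i z0 (h z0)" by blast
  obtain g where g: "g \<in> G" "lt b0 i z0 (g (d True))" "lt b0 i (g (d True)) (h z0)"
    using orbit_interval_point[OF i _ _ b0 dU, of "{}"] by auto
  define y where "y = g (d True)"
  have yU: "y \<in> U" using g dU by (simp add: y_def)
  define z where "z = h y"
  have zy: "z \<noteq> y"
  proof
    assume "z = y"
    then have "lt b0 i (h z0) y" using g(2) lt_G[OF h, of b0 i z0 y] by (simp add: z_def y_def)
    then show False using g(3) lt_asym[OF i] by (simp add: y_def)
  qed
  have y_out: "\<not> (lt True i \<alpha> y \<and> lt True i y \<beta>)" using fixed zy by (auto simp: z_def)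
  have z_out: "\<not> (lt True i \<alpha> z \<and> lt True i z \<beta>)"
    using fixed[of z] zy G_inj[OF h, of z y] by (auto simp: z_def)
  have \<alpha>\<beta>U: "\<alpha> \<in> U" "\<beta> \<in> U" using lt_U[OF \<alpha>\<beta>] by auto
  have "\<exists>b p q. le b i y p \<and> lt b i p q \<and> (\<forall>w. lt b i p w \<and> lt b i w q \<longleftrightarrow> lt True i \<alpha> w \<and> lt True i w \<beta>)"
  proof (cases "lt True i \<alpha> y")
    case True
    then have "le False i y \<beta>" using y_out not_lt[OF i yU \<alpha>\<beta>U(2), of True] le_flip[of True] by auto
    then show ?thesis using \<alpha>\<beta> by (intro exI[of _ False] exI[of _ \<beta>] exI[of _ \<alpha>]) (auto simp: lt_False)
  next
    case False
    then have "le True i y \<alpha>" using not_lt[OF i \<alpha>\<beta>U(1) yU] by blast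
    then show ?thesis using \<alpha>\<beta> by blast
  qed
  then obtain b p q0 where pq0: "le b i y p" "lt b i p q0"
      "\<And>w. lt b i p w \<and> lt b i w q0 \<longleftrightarrow> lt True i \<alpha> w \<and> lt True i w \<beta>" by blast
  obtain q where q: "lt b i p q" "lt b i q q0" using interval_point[OF i _ _ pq0(2), of "{}"] by auto
  have U: "p \<in> U" "q \<in> U" using lt_U[OF q(1)] by auto
  have zq: "z \<noteq> q" using q z_out pq0(3) by blast
  have yq: "lt b i y q" using le_lt_trans[OF i pq0(1) q(1)] .
  have "\<exists>g'\<in>G. y = g' (d b)"
  proof (cases b)
    case False
    then show ?thesis using g(1) orbit
      by (intro bexI[of _ "g \<circ> inv g0"]) (simp_all add: y_def flip: orbit(2))
  qed (use g in \<open>auto simp: y_def\<close>)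
  then obtain g' where g': "g' \<in> G" "y = g' (d b)" by blast
  obtain R t E where t: "R \<notin> I" "t \<in> rel N R" "set t = insert (d b) E" "E \<noteq> {}" "\<And>e. e \<in> E \<Longrightarrow> lt b i (d b) e"
    using tup[of b] by blast
  have EU: "finite E" "E \<subseteq> U" using rel_U[OF t(2)] t(3) by (auto intro: finite_subset[of _ "set t"])
  define E1 where "E1 = g' ` E"
  have E1: "finite E1" "E1 \<subseteq> U" using EU g' by (simp_all add: E1_def)
  have yE1: "lt b i y e" if "e \<in> E1" for e using that t(5) g' by (auto simp: E1_def)
  \<comment> \<open>Two moves bring the remaining entries between \<open>p\<close> and
    \<open>q\<close>: first before \<open>q\<close> over \<open>y\<close>, then beyond
    \<open>p\<close> and free from \<open>z\<close> over \<open>{y, q}\<close>.\<close>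
  obtain c where c: "c \<in> stab {y}" "ord_ind (\<lambda>_. \<not> b) (c ` E1) {y} {q}"
    using existence_oriented[of E1 "{y}" "{q}"] E1 yU U by auto
  define E2 where "E2 = c ` E1"
  have E2: "finite E2" "E2 \<subseteq> U" using E1 c by (simp_all add: E2_def)
  have yE2: "lt b i y e" if "e \<in> E2" for e
    using that yE1 stab_lt(2)[OF c(1), of y] by (auto simp: E2_def)
  have E2q: "lt b i e q" if e: "e \<in> E2" for e
  proof (rule ccontr)
    assume "\<not> lt b i e q"
    then have "le (\<not> b) i e q" using not_lt[OF i, of e q b] e E2 U le_flip by auto
    then have "le (\<not> b) i y q" using ord_indD[OF c(2) i, of e q] e by (auto simp: E2_def)
    then have "le b i q y" using le_flip by blast
    then show False using yq lt_le_trans[OF i] lt_irrefl[OF i] by blast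
  qed
  have "z \<in> U" using yU h by (simp add: z_def)
  then have f: "finite {y, q}" "{y, q} \<subseteq> U" "finite {p, z}" "{p, z} \<subseteq> U" using yU U by auto
  obtain c' where c': "c' \<in> stab {y, q}" "free_ind (c' ` E2) {y, q} {p, z}"
      "ord_ind (\<lambda>_. b) (c' ` E2) {y, q} {p, z}"
    using existence_oriented[OF E2(1) f(1,3) E2(2) f(2,4)] by blast
  define E3 where "E3 = c' ` E2"
  have E3U: "E3 \<subseteq> U" using E2 c' by (auto simp: E3_def)
  have E3: "lt b i y e" "lt b i e q" if e: "e \<in> E3" for e
    using e yE2 E2q stab_lt[OF c'(1)] by (auto simp: E3_def)
  have E3p: "lt b i p e" if e: "e \<in> E3" for e
  proof (rule ccontr)
    assume "\<not> lt b i p e"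
    then have "le b i e p" using not_lt[OF i U(1), of e b] e E3U by auto
    then obtain v where "v \<in> {y, q}" "le b i e v" "le b i v p"
      using ord_indD[OF c'(3) i, of e p] e by (auto simp: E3_def)
    then show False
      using E3(1)[OF e] q(1) lt_le_trans[OF i] lt_irrefl[OF i] by blast
  qed
  have hE3: "h e = e" if "e \<in> E3" for e
    using fixed[of e] pq0(3)[of e] E3p[OF that] E3(2)[OF that] q(2) lt_trans[OF i] by blast
  define t' where "t' = map (c' \<circ> c \<circ> g') t"
  have "c' \<circ> c \<circ> g' \<in> G" using c c' g' by simp
  then have t': "t' \<in> rel N R" using G_rel t(2) unfolding t'_def by blast
  have "c y = y" "c' y = y" using stab_fix[OF c(1), of y] stab_fix[OF c'(1), of y] by simp_all
  then have set_t': "set t' = insert y E3"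
    using g' by (simp add: t'_def t(3) E3_def E2_def E1_def image_comp)
  have "map h t' \<in> rel N R" using G_rel[OF h] t' by blast
  moreover have "h ` E3 = E3" using hE3 by force
  then have set_ht: "set (map h t') = insert z E3" by (simp add: set_t' z_def)
  ultimately have "set (map h t') \<subseteq> E3 \<union> {y, q} \<or> set (map h t') \<subseteq> {y, q} \<union> {p, z}"
    using c'(2) t(1) unfolding free_ind_def E3_def by blast
  moreover obtain e where e: "e \<in> E3" using t(4) by (auto simp: E3_def E2_def E1_def)
  moreover have "z \<notin> E3"
  proof
    assume "z \<in> E3"
    then have "lt b i p z" "lt b i z q0" using E3p E3(2) lt_trans[OF i _ q(2)] by blast+
    then show False using z_out pq0(3) by blast
  qed
  moreover have "e \<noteq> y" "e \<noteq> q" "e \<noteq> p"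
    using E3[OF e] E3p[OF e] lt_irrefl[OF i] by auto
  ultimately show False using zy zq set_ht by blast
qed

end

section \<open>The automorphism group\<close>

context ordered_struc
begin

lemma restrict_G_Bij: "g \<in> G \<Longrightarrow> restrict g U \<in> Bij U"
  using G_image_U[of g U] G_image_U[of "inv g" U]
  by (auto simp: Bij_def bij_betw_def inj_on_def G_inj image_iff) (metis f_inv_G G_U G_inv)

lemma restrict_G_comp: "g \<in> G \<Longrightarrow> h \<in> G \<Longrightarrow> compose U (restrict g U) (restrict h U) = restrict (g \<circ> h) U"
  by (auto simp: compose_def restrict_def fun_eq_iff)

lemma Aut_eq: "Aut N = (\<lambda>g. restrict g U) ` G"
proof (intro equalityI subsetI)
  fix f assume "f \<in> Aut N"
  then have f: "bij_betw f U U" "f \<in> extensional U"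
      "\<And>R t. set t \<subseteq> U \<Longrightarrow> t \<in> rel N R \<longleftrightarrow> map f t \<in> rel N R"
    by (auto simp: Aut_def Bij_def isomorphism_def embedding_def)
  define g where "g x = (if x \<in> U then f x else x)" for x
  have "bij_betw g U U" using f(1) by (rule bij_betw_cong[THEN iffD1, rotated]) (simp add: g_def)
  moreover have "bij_betw g (- U) (- U)" by (rule bij_betwI[of _ _ _ id]) (auto simp: g_def)
  ultimately have "bij_betw g (U \<union> - U) (U \<union> - U)" by (rule bij_betw_combine) simp
  then have "bij g" by simp
  moreover have "map g t \<in> rel N R \<longleftrightarrow> t \<in> rel N R" for R t
  proof (cases "set t \<subseteq> U")
    case True
    then have "map g t = map f t" by (auto simp: g_def)
    then show ?thesis using f(3)[OF True] by metis
  next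
    case False
    then obtain x where x: "x \<in> set t" "x \<notin> U" by blast
    then have "g x \<in> set (map g t)" "g x \<notin> U" by (auto simp: g_def)
    then show ?thesis using x rel_U by blast
  qed
  ultimately have "g \<in> G" by (simp add: G_def g_def)
  moreover have "f = restrict g U" using f(2) by (auto simp: g_def extensional_def fun_eq_iff)
  ultimately show "f \<in> (\<lambda>g. restrict g U) ` G" by blast
next
  fix f assume "f \<in> (\<lambda>g. restrict g U) ` G"
  then obtain g where g: "g \<in> G" "f = restrict g U" by blast
  have "map f t = map g t" if "set t \<subseteq> U" for t using that g by (auto simp: subset_iff)
  then have "t \<in> rel N R \<longleftrightarrow> map f t \<in> rel N R" if "set t \<subseteq> U" for R t
    using G_rel[OF g(1)] that by metis
  moreover have "f \<in> Bij U" using restrict_G_Bij g by blast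
  ultimately show "f \<in> Aut N"
    by (auto simp: Aut_def isomorphism_def embedding_def Bij_def bij_betw_def)
qed

end

context generic_struc
begin

lemma Aut_group_simps:
  "carrier (Aut_group N) = Aut N" "\<one>\<^bsub>Aut_group N\<^esub> = restrict id U"
  "g \<in> G \<Longrightarrow> h \<in> G \<Longrightarrow> restrict g U \<otimes>\<^bsub>Aut_group N\<^esub> restrict h U = restrict (g \<circ> h) U"
  using restrict_G_Bij restrict_G_comp
  by (auto simp: Aut_group_def BijGroup_def restrict_def fun_eq_iff)

lemma Aut_group_group: "group (Aut_group N)"
proof (rule groupI)
  fix x y assume "x \<in> carrier (Aut_group N)" "y \<in> carrier (Aut_group N)"
  then obtain g h where gh: "g \<in> G" "x = restrict g U" "h \<in> G" "y = restrict h U"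
    by (auto simp: Aut_group_simps Aut_eq)
  then show "x \<otimes>\<^bsub>Aut_group N\<^esub> y \<in> carrier (Aut_group N)"
    using G_comp[OF gh(1,3)] by (auto simp: Aut_group_simps Aut_eq)
  fix z assume "z \<in> carrier (Aut_group N)"
  then obtain l where "l \<in> G" "z = restrict l U" by (auto simp: Aut_group_simps Aut_eq)
  then show "x \<otimes>\<^bsub>Aut_group N\<^esub> y \<otimes>\<^bsub>Aut_group N\<^esub> z = x \<otimes>\<^bsub>Aut_group N\<^esub> (y \<otimes>\<^bsub>Aut_group N\<^esub> z)"
    using gh by (simp add: Aut_group_simps o_assoc)
next
  show "\<one>\<^bsub>Aut_group N\<^esub> \<in> carrier (Aut_group N)"
    using G_id by (auto simp: Aut_group_simps Aut_eq)
next
  fix x assume "x \<in> carrier (Aut_group N)"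
  then obtain g where g: "g \<in> G" "x = restrict g U" by (auto simp: Aut_group_simps Aut_eq)
  then show "\<one>\<^bsub>Aut_group N\<^esub> \<otimes>\<^bsub>Aut_group N\<^esub> x = x"
    using Aut_group_simps(3)[OF G_id g(1)] by (simp add: Aut_group_simps(2))
  have "inv g \<circ> g = id" using g by (auto simp: fun_eq_iff)
  then have "restrict (inv g) U \<otimes>\<^bsub>Aut_group N\<^esub> x = \<one>\<^bsub>Aut_group N\<^esub>"
    using Aut_group_simps(3)[OF G_inv[OF g(1)] g(1)] g(2) by (simp add: Aut_group_simps(2))
  then show "\<exists>y\<in>carrier (Aut_group N). y \<otimes>\<^bsub>Aut_group N\<^esub> x = \<one>\<^bsub>Aut_group N\<^esub>"
    using G_inv[OF g(1)] by (auto simp: Aut_group_simps(1) Aut_eq)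
qed

text \<open>Restriction to \<open>U\<close> is an isomorphism of \<open>G\<close> onto
  \<open>Aut N\<close>, so a normal subgroup \<open>K\<close> is pulled back to \<open>H\<close> and
  \<open>normal_subgroup_eq_G\<close> applies.\<close>

theorem Aut_group_simple:
  assumes rigid: "\<exists>i\<in>I. \<forall>h\<in>G. \<forall>\<alpha> \<beta>. lt True i \<alpha> \<beta> \<longrightarrow>
      (\<forall>w. lt True i \<alpha> w \<longrightarrow> lt True i w \<beta> \<longrightarrow> h w = w) \<longrightarrow> h = id"
  shows "is_simple_group (Aut_group N)"
proof -
  interpret A: group "Aut_group N" by (rule Aut_group_group)
  have minv: "m_inv (Aut_group N) (restrict g U) = restrict (inv g) U" if g: "g \<in> G" for g
  proof (rule A.inv_equality)
    have "inv g \<circ> g = id" using g by (auto simp: fun_eq_iff)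
    then show "restrict (inv g) U \<otimes>\<^bsub>Aut_group N\<^esub> restrict g U = \<one>\<^bsub>Aut_group N\<^esub>"
      using Aut_group_simps(3)[OF G_inv[OF g] g] by (simp add: Aut_group_simps(2))
  qed (use g in \<open>auto simp: Aut_group_simps(1) Aut_eq\<close>)
  have "carrier (Aut_group N) \<noteq> {\<one>\<^bsub>Aut_group N\<^esub>}"
  proof -
    obtain x where x: "x \<in> U" using U_ne by blast
    obtain g where g: "g \<in> stab {}" "free_ind {g x} {} {x}" using free_existence_point[of "{}" "{x}" x] x by auto
    then have gx: "g x \<noteq> x" by (auto simp: free_ind_def)
    have "restrict g U \<noteq> restrict id U" using gx x by (metis id_apply restrict_apply')
    moreover have "restrict g U \<in> carrier (Aut_group N)" using g by (auto simp: Aut_group_simps Aut_eq)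
    ultimately show ?thesis by (auto simp: Aut_group_simps(2))
  qed
  moreover have "K = {\<one>\<^bsub>Aut_group N\<^esub>} \<or> K = carrier (Aut_group N)" if K: "K \<lhd> Aut_group N" for K
  proof (cases "K = {\<one>\<^bsub>Aut_group N\<^esub>}")
    case False
    interpret K: normal K "Aut_group N" by (rule K)
    define H where "H = {g \<in> G. restrict g U \<in> K}"
    have KH: "\<exists>g\<in>H. x = restrict g U" if "x \<in> K" for x
      using K.subset that by (auto simp: H_def Aut_group_simps(1) Aut_eq)
    obtain x where x: "x \<in> K" "x \<noteq> \<one>\<^bsub>Aut_group N\<^esub>" using False K.one_closed by blast
    then obtain h0 where h0: "h0 \<in> H" "x = restrict h0 U" using KH by blast
    have "H = G"
    proof (rule normal_subgroup_eq_G[OF rigid])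
      show "H \<subseteq> G" by (auto simp: H_def)
      show "h0 \<in> H" by (rule h0)
      show "h0 \<noteq> id" using x h0 by (auto simp: Aut_group_simps(2))
      show "g \<circ> h \<in> H" if "g \<in> H" "h \<in> H" for g h
        using that K.m_closed[of "restrict g U" "restrict h U"] by (simp add: H_def Aut_group_simps(3))
      show "inv h \<in> H" if "h \<in> H" for h
        using that K.m_inv_closed[of "restrict h U"] by (simp add: H_def minv)
      show "conj_by g h \<in> H" if "g \<in> G" "h \<in> H" for g h
      proof -
        have "restrict g U \<in> carrier (Aut_group N)" using that(1) by (auto simp: Aut_group_simps(1) Aut_eq)
        from K.inv_op_closed2[OF this, of "restrict h U"] show ?thesis
          using that by (simp add: H_def minv Aut_group_simps(3) conj_by_def)
      qed
    qed
    then have "carrier (Aut_group N) \<subseteq> K" by (auto simp: H_def Aut_group_simps(1) Aut_eq)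
    then show ?thesis using K.subset by blast
  qed simp
  ultimately show ?thesis using Aut_group_group by (simp add: is_simple_group_def)
qed

end

section \<open>Structures given by their age\<close>

text \<open>Members of an age live on natural numbers, so finite parts of \<open>N\<close> enter it
  as coded copies.\<close>

definition image_struc :: "('b \<Rightarrow> nat) \<Rightarrow> ('b, 's) struc \<Rightarrow> 'b set \<Rightarrow> (nat, 's) struc" where
  "image_struc f N X = \<lparr>univ = f ` X, rel = (\<lambda>R. map f ` {t \<in> rel N R. set t \<subseteq> X})\<rparr>"

lemma structure_ofD:
  "structure_of L N \<Longrightarrow> t \<in> rel N R \<Longrightarrow> \<exists>k. L R = Some k \<and> length t = k \<and> set t \<subseteq> univ N"
  by (cases "L R") (force simp: structure_of_def dest!: spec[of _ R])+

lemma length_2_iff: "length t = 2 \<longleftrightarrow> (\<exists>p q. t = [p, q])"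
  by (auto simp: numeral_2_eq_2 length_Suc_conv)

lemma structure_ofI:
  assumes "\<And>R t. t \<in> rel N R \<Longrightarrow> L R = Some (length t) \<and> set t \<subseteq> univ N"
  shows "structure_of L N"
  using assms by (force simp: structure_of_def split: option.splits)

lemma map_inj_on_eq:
  "inj_on f X \<Longrightarrow> set t \<subseteq> X \<Longrightarrow> set t' \<subseteq> X \<Longrightarrow> map f t = map f t' \<Longrightarrow> t = t'"
  using inj_on_map_eq_map[of f t t'] inj_on_subset[of f X "set t \<union> set t'"] by simp

lemma image_struc_rel_iff:
  assumes "inj_on f X" "set t \<subseteq> X"
  shows "map f t \<in> rel (image_struc f N X) R \<longleftrightarrow> t \<in> rel N R"
proof
  assume "map f t \<in> rel (image_struc f N X) R"
  then obtain s where s: "s \<in> rel N R" "set s \<subseteq> X" "map f t = map f s" by (auto simp: image_struc_def)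
  then have "t = s" using map_inj_on_eq[OF assms] by blast
  then show "t \<in> rel N R" using s by simp
qed (use assms(2) in \<open>auto simp: image_struc_def\<close>)

lemma image_struc_in_age:
  assumes N: "structure_of L N" and X: "finite X" "X \<subseteq> univ N" and f: "inj_on f X"
  shows "image_struc f N X \<in> age L N"
proof -
  have "structure_of L (image_struc f N X)"
    using structure_ofD[OF N] by (intro structure_ofI) (fastforce simp: image_struc_def)
  then have "image_struc f N X \<in> fin_strucs L" using X by (simp add: fin_strucs_def image_struc_def)
  moreover have "embedding (image_struc f N X) N (inv_into X f)"
    unfolding embedding_def
  proof (intro conjI allI impI)
    show "inj_on (inv_into X f) (univ (image_struc f N X))"
      by (simp add: image_struc_def inj_on_inv_into)
    show "inv_into X f ` univ (image_struc f N X) \<subseteq> univ N"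
      using X f by (auto simp: image_struc_def)
    fix R t assume "set t \<subseteq> univ (image_struc f N X)"
    then have t: "set t \<subseteq> f ` X" by (simp add: image_struc_def)
    then have eq: "map f (map (inv_into X f) t) = t"
      by (auto simp: f_inv_into_f subset_iff intro!: map_idI)
    have "set (map (inv_into X f) t) \<subseteq> X" using t f by (auto simp: subset_iff inv_into_into)
    from image_struc_rel_iff[OF f this, of N R]
    show "t \<in> rel (image_struc f N X) R \<longleftrightarrow> map (inv_into X f) t \<in> rel N R" unfolding eq .
  qed
  ultimately show ?thesis by (auto simp: age_def)
qed

text \<open>The axioms of a strict linear order speak of at most three points and can be checked in
  coded finite substructures.\<close>

lemma strict_order_by_from_age:
  assumes N: "structure_of L N"
    and ord: "\<And>A. A \<in> age L N \<Longrightarrow> strict_order_by A i"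
  shows "strict_order_by N i"
proof -
  define r where "r = {(x, y). [x, y] \<in> rel N i}"
  have *: "\<exists>f s. strict_linear_order_on (f ` X) s \<and> inj_on f X \<and>
      (\<forall>x\<in>X. \<forall>y\<in>X. (f x, f y :: nat) \<in> s \<longleftrightarrow> (x, y) \<in> r)" if X: "finite X" "X \<subseteq> univ N" for X
  proof -
    obtain f :: "'b \<Rightarrow> nat" where f: "inj_on f X" using X(1) finite_imp_inj_to_nat_seg by metis
    define s where "s = {(x, y). [x, y] \<in> rel (image_struc f N X) i}"
    have "strict_linear_order_on (f ` X) s"
      using ord[OF image_struc_in_age[OF N X f]] by (simp add: strict_order_by_def s_def image_struc_def)
    moreover have "(f x, f y) \<in> s \<longleftrightarrow> (x, y) \<in> r" if "x \<in> X" "y \<in> X" for x y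
      using image_struc_rel_iff[OF f, of "[x, y]" N i] that by (simp add: s_def r_def)
    ultimately show ?thesis using f by blast
  qed
  have rU: "(x, y) \<in> r \<Longrightarrow> x \<in> univ N \<and> y \<in> univ N" for x y
    using structure_ofD[OF N, of "[x, y]" i] by (auto simp: r_def)
  have "irrefl r"
  proof (rule irreflI)
    fix x show "(x, x) \<notin> r"
    proof
      assume x: "(x, x) \<in> r"
      then obtain f :: "'b \<Rightarrow> nat" and s where "strict_linear_order_on (f ` {x}) s" "(f x, f x) \<in> s"
        using *[of "{x}"] rU[OF x] by auto
      then show False by (auto simp: strict_linear_order_on_def irrefl_def)
    qed
  qed
  moreover have "trans r"
  proof (rule transI)
    fix x y z assume xy: "(x, y) \<in> r" "(y, z) \<in> r"
    have fin: "finite {x, y, z}" "{x, y, z} \<subseteq> univ N" using rU xy by auto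
    from *[OF fin] obtain f :: "'b \<Rightarrow> nat" and s where s: "strict_linear_order_on (f ` {x, y, z}) s"
        "\<forall>u\<in>{x, y, z}. \<forall>v\<in>{x, y, z}. (f u, f v) \<in> s \<longleftrightarrow> (u, v) \<in> r" 
      by (elim exE conjE) (rule that)
    then have "(f x, f y) \<in> s" "(f y, f z) \<in> s" using xy by auto
    then have "(f x, f z) \<in> s" using s(1) by (meson strict_linear_order_on_def transD)
    then show "(x, z) \<in> r" using s(2) by auto
  qed
  moreover have "total_on (univ N) r"
    unfolding total_on_def
  proof (intro ballI impI)
    fix x y assume xy: "x \<in> univ N" "y \<in> univ N" "x \<noteq> y"
    then have fin: "finite {x, y}" "{x, y} \<subseteq> univ N" by auto
    from *[OF fin] obtain f :: "'b \<Rightarrow> nat" and s where s: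
        "strict_linear_order_on (f ` {x, y}) s" "inj_on f {x, y}"
        "\<forall>u\<in>{x, y}. \<forall>v\<in>{x, y}. (f u, f v) \<in> s \<longleftrightarrow> (u, v) \<in> r"
      by (elim exE conjE) (rule that)
    then have "f x \<noteq> f y" using xy(3) by (auto simp: inj_on_def)
    then have "(f x, f y) \<in> s \<or> (f y, f x) \<in> s"
      using s(1) by (auto simp: strict_linear_order_on_def total_on_def)
    then show "(x, y) \<in> r \<or> (y, x) \<in> r" using s(3) by auto
  qed
  ultimately show ?thesis by (simp add: strict_order_by_def strict_linear_order_on_def r_def)
qed

section \<open>Free one-point extensions with prescribed cuts\<close>

context ordered_struc
begin

text \<open>The one-point extension of the substructure \<open>C\<close> by a copy of \<open>x\<close> over \<open>B\<close> that is free from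
  \<open>C\<close> and fills the cuts \<open>D\<close>; the new point is \<open>0\<close> and \<open>\<eta>\<close> encodes \<open>C\<close> by positive numbers.\<close>

definition one_point_ext :: "('b \<Rightarrow> nat) \<Rightarrow> 'b set \<Rightarrow> 'b set \<Rightarrow> 'b \<Rightarrow> ('s \<Rightarrow> 'b set) \<Rightarrow> (nat, 's) struc" where
  "one_point_ext \<eta> C B x D = \<lparr>univ = insert 0 (\<eta> ` C), rel = (\<lambda>R.
     if R \<in> I then {[\<eta> c, \<eta> c'] |c c'. c \<in> C \<and> c' \<in> C \<and> [c, c'] \<in> rel N R} \<union>
       {[\<eta> c, 0] |c. c \<in> D R} \<union> {[0, \<eta> c] |c. c \<in> C - D R}
     else rel (image_struc (\<eta>(x := 0)) N (insert x B)) R \<union> rel (image_struc \<eta> N C) R)\<rparr>"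

context
  fixes \<eta> :: "'b \<Rightarrow> nat" and C B :: "'b set" and x :: 'b and D :: "'s \<Rightarrow> 'b set"
  assumes \<eta>: "inj_on \<eta> C" "0 \<notin> \<eta> ` C" and C: "finite C" "C \<subseteq> U" "B \<subseteq> C" and x: "x \<in> U" "x \<notin> B"
    and D: "\<And>i. i \<in> I \<Longrightarrow> D i \<subseteq> C"
      "\<And>i c d. i \<in> I \<Longrightarrow> c \<in> C \<Longrightarrow> d \<in> D i \<Longrightarrow> lt True i c d \<Longrightarrow> c \<in> D i"
      "\<And>i b. i \<in> I \<Longrightarrow> b \<in> B \<Longrightarrow> b \<in> D i \<longleftrightarrow> lt True i b x"
begin

lemma inj_\<theta>: "inj_on (\<eta>(x := 0)) (insert x B)"
  using inj_on_subset[OF \<eta>(1) C(3)] \<eta>(2) C(3) x(2) by (auto simp: inj_on_def)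

lemma \<theta>_B: "b \<in> B \<Longrightarrow> (\<eta>(x := 0)) b = \<eta> b"
  using x by auto

lemma \<eta>0: "c \<in> C \<Longrightarrow> \<eta> c \<noteq> 0"
  using \<eta>(2) by force

lemma \<theta>_image_eq:
  assumes t: "set t \<subseteq> insert x B" and t': "set t' \<subseteq> C" and eq: "map (\<eta>(x := 0)) t = map \<eta> t'"
  shows "t = t' \<and> set t \<subseteq> B"
proof -
  have "(\<eta>(x := 0)) z \<in> \<eta> ` C" if "z \<in> set t" for z
  proof -
    have "(\<eta>(x := 0)) z \<in> set (map \<eta> t')" unfolding eq[symmetric] using that by simp
    then show ?thesis using t' by auto
  qed
  then have "x \<notin> set t" using \<eta>(2) by fastforce
  then have tB: "set t \<subseteq> B" using t by auto
  then have "map (\<eta>(x := 0)) t = map \<eta> t" using \<theta>_B by (auto simp: subset_iff)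
  then have "map \<eta> t = map \<eta> t'" using eq by simp
  then have "t = t'" using map_inj_on_eq[OF \<eta>(1) _ t'] tB C(3) by blast
  then show ?thesis using tB by simp
qed

lemma one_point_ext_\<eta>:
  assumes t: "set t \<subseteq> C"
  shows "map \<eta> t \<in> rel (one_point_ext \<eta> C B x D) R \<longleftrightarrow> t \<in> rel N R"
proof (cases "R \<in> I")
  case True
  show ?thesis
  proof
    assume "map \<eta> t \<in> rel (one_point_ext \<eta> C B x D) R"
    then consider c c' where "map \<eta> t = [\<eta> c, \<eta> c']" "c \<in> C" "c' \<in> C" "[c, c'] \<in> rel N R"
      | "0 \<in> set (map \<eta> t)"
      using True by (auto simp: one_point_ext_def)
    then show "t \<in> rel N R"
    proof cases
      case (1 c c')
      then have "t = [c, c']" using map_inj_on_eq[OF \<eta>(1) t, of "[c, c']"] by simp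
      then show ?thesis using 1 by simp
    next
      case 2
      then show ?thesis using t \<eta>(2) by auto
    qed
  next
    assume tR: "t \<in> rel N R"
    from pairs_I[OF True tR] obtain c c' where "t = [c, c']" unfolding length_2_iff by (elim exE)
    then show "map \<eta> t \<in> rel (one_point_ext \<eta> C B x D) R"
      using True tR t by (auto simp: one_point_ext_def)
  qed
next
  case False
  have "t \<in> rel N R" if im: "map \<eta> t \<in> rel (image_struc (\<eta>(x := 0)) N (insert x B)) R"
  proof -
    obtain t' where t': "t' \<in> rel N R" "set t' \<subseteq> insert x B" "map \<eta> t = map (\<eta>(x := 0)) t'"
      using im by (auto simp: image_struc_def)
    then show ?thesis using \<theta>_image_eq[OF t'(2) t] by auto
  qed
  then show ?thesis using image_struc_rel_iff[OF \<eta>(1) t, of N R] False by (auto simp: one_point_ext_def)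
qed

lemma one_point_ext_0:
  assumes "i \<in> I" "c \<in> C"
  shows "[\<eta> c, 0] \<in> rel (one_point_ext \<eta> C B x D) i \<longleftrightarrow> c \<in> D i"
    and "[0, \<eta> c] \<in> rel (one_point_ext \<eta> C B x D) i \<longleftrightarrow> c \<notin> D i"
proof -
  have eq: "\<eta> c = \<eta> c' \<longleftrightarrow> c = c'" if "c' \<in> C" for c'
    using inj_on_eq_iff[OF \<eta>(1) assms(2) that] .
  have DC: "d \<in> D i \<Longrightarrow> d \<in> C" for d using D(1)[OF assms(1)] by blast
  show "[\<eta> c, 0] \<in> rel (one_point_ext \<eta> C B x D) i \<longleftrightarrow> c \<in> D i"
    using assms \<eta>0 DC eq by (fastforce simp: one_point_ext_def)
  show "[0, \<eta> c] \<in> rel (one_point_ext \<eta> C B x D) i \<longleftrightarrow> c \<notin> D i"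
    using assms \<eta>0 DC eq by (fastforce simp: one_point_ext_def)
qed

lemma one_point_ext_00:
  assumes "i \<in> I" shows "[0, 0] \<notin> rel (one_point_ext \<eta> C B x D) i"
  using assms \<eta>0 subsetD[OF D(1)[OF assms]] by (fastforce simp: one_point_ext_def)

lemma one_point_ext_\<theta>:
  assumes t: "set t \<subseteq> insert x B"
  shows "map (\<eta>(x := 0)) t \<in> rel (one_point_ext \<eta> C B x D) R \<longleftrightarrow> t \<in> rel N R"
proof (cases "R \<in> I")
  case True
  show ?thesis
  proof (cases "\<exists>p q. t = [p, q]")
    case False
    then have "t \<notin> rel N R" using pairs_I[OF True, of t] unfolding length_2_iff by blast
    moreover have "map (\<eta>(x := 0)) t \<notin> rel (one_point_ext \<eta> C B x D) R"
      using False True by (auto simp: one_point_ext_def map_eq_Cons_conv)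
    ultimately show ?thesis by simp
  next
    case pq: True
    then obtain p q where pq: "t = [p, q]" by blast
    have lt: "lt True R z x \<longleftrightarrow> [z, x] \<in> rel N R" "lt True R x z \<longleftrightarrow> [x, z] \<in> rel N R" for z
      by (simp_all add: lt_def)
    consider "p \<in> B" "q \<in> B" | "p = x" "q \<in> B" | "p \<in> B" "q = x" | "p = x" "q = x" using t pq by auto
    then show ?thesis
    proof cases
      case 1
      then show ?thesis using one_point_ext_\<eta>[of t R] \<theta>_B pq C(3) by (auto simp del: fun_upd_apply)
    next
      case 2
      then have q: "q \<in> C" "q \<in> U" "q \<noteq> x" using C x by auto
      have "q \<in> D R \<longleftrightarrow> \<not> lt True R x q"
        using D(3)[OF True 2(2)] lt_total[OF True x(1) q(2), of True] lt_asym[OF True] q(3) by blast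
      then show ?thesis using one_point_ext_0(2)[OF True q(1)] 2 pq q lt by simp
    next
      case 3
      then have p: "p \<in> C" "p \<noteq> x" using C x by auto
      then show ?thesis using one_point_ext_0(1)[OF True p(1)] D(3)[OF True 3(1)] 3 pq lt by simp
    next
      case 4
      have "[0, 0] \<notin> rel (one_point_ext \<eta> C B x D) R" using one_point_ext_00[OF True] .
      moreover have "[x, x] \<notin> rel N R" using lt_irrefl[OF True, of True x] by (simp add: lt_def)
      ultimately show ?thesis using 4 pq by simp
    qed
  qed
next
  case False
  have "t \<in> rel N R" if im: "map (\<eta>(x := 0)) t \<in> rel (image_struc \<eta> N C) R"
  proof -
    obtain t' where t': "t' \<in> rel N R" "set t' \<subseteq> C" "map (\<eta>(x := 0)) t = map \<eta> t'"
      using im by (auto simp: image_struc_def)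
    then show ?thesis using \<theta>_image_eq[OF t t'(2)] by auto
  qed
  then show ?thesis using image_struc_rel_iff[OF inj_\<theta> t, of N R] False by (auto simp: one_point_ext_def)
qed

text \<open>Transitivity through the new point, and from old points to it, is the downward closure
  of \<open>D i\<close>.\<close>

lemma one_point_ext_order:
  assumes i: "i \<in> I" shows "strict_order_by (one_point_ext \<eta> C B x D) i"
proof -
  let ?E = "one_point_ext \<eta> C B x D"
  define r where "r = {(u, v). [u, v] \<in> rel ?E i}"
  have \<eta>\<eta>: "(\<eta> c, \<eta> c') \<in> r \<longleftrightarrow> lt True i c c'" if "c \<in> C" "c' \<in> C" for c c'
    using one_point_ext_\<eta>[of "[c, c']" i] that by (simp add: r_def lt_def)
  have r0: "(\<eta> c, 0) \<in> r \<longleftrightarrow> c \<in> D i" "(0, \<eta> c) \<in> r \<longleftrightarrow> c \<notin> D i" if "c \<in> C" for c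
    using one_point_ext_0[OF i that] by (simp_all add: r_def)
  have r00: "(0, 0) \<notin> r" using one_point_ext_00[OF i] by (simp add: r_def)
  have rU: "(u, v) \<in> r \<Longrightarrow> (u = 0 \<or> (\<exists>c\<in>C. u = \<eta> c)) \<and> (v = 0 \<or> (\<exists>c\<in>C. v = \<eta> c))" for u v
    using i D(1)[OF i] by (auto simp: r_def one_point_ext_def)
  have "irrefl r"
    using rU r00 \<eta>\<eta> lt_irrefl[OF i] by (metis irreflI)
  moreover have "trans r"
  proof (rule transI)
    fix u v z assume uv: "(u, v) \<in> r" "(v, z) \<in> r"
    have U: "u = 0 \<or> (\<exists>c\<in>C. u = \<eta> c)" "v = 0 \<or> (\<exists>c\<in>C. v = \<eta> c)" "z = 0 \<or> (\<exists>c\<in>C. z = \<eta> c)"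
      using rU[OF uv(1)] rU[OF uv(2)] by blast+
    show "(u, z) \<in> r"
    proof (cases "v = 0")
      case True
      then obtain a c where a: "a \<in> C" "u = \<eta> a" and c: "c \<in> C" "z = \<eta> c" using U uv r00 by metis
      have ac: "a \<in> D i" "c \<notin> D i" using uv True a c r0 by auto
      then have "\<not> lt True i c a" "a \<noteq> c" using D(2)[OF i c(1)] by auto
      then have "lt True i a c" using lt_total[OF i] a c C(2) by blast
      then show ?thesis using a c \<eta>\<eta> by simp
    next
      case False
      then obtain b where b: "b \<in> C" "v = \<eta> b" using U by blast
      consider "u = 0" "z = 0" | c where "u = 0" "c \<in> C" "z = \<eta> c" | a where "a \<in> C" "u = \<eta> a" "z = 0"
        | a c where "a \<in> C" "u = \<eta> a" "c \<in> C" "z = \<eta> c" using U by blast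
      then show ?thesis
      proof cases
        case 1 then show ?thesis using uv b r0 by auto
      next
        case (2 c)
        then have "b \<notin> D i" "lt True i b c" using uv b r0 \<eta>\<eta> by auto
        then have "c \<notin> D i" using D(2)[OF i b(1)] by blast
        then show ?thesis using 2 r0 by simp
      next
        case (3 a)
        then have "b \<in> D i" "lt True i a b" using uv b r0 \<eta>\<eta> by auto
        then have "a \<in> D i" using D(2)[OF i 3(1)] by blast
        then show ?thesis using 3 r0 by simp
      next
        case (4 a c)
        then have "lt True i a b" "lt True i b c" using uv b \<eta>\<eta> by auto
        then have "lt True i a c" by (rule lt_trans[OF i])
        then show ?thesis using 4 \<eta>\<eta> by simp
      qed
    qed
  qed
  moreover have "total_on (insert 0 (\<eta> ` C)) r"
    unfolding total_on_def
  proof (intro ballI impI)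
    fix u v assume uv: "u \<in> insert 0 (\<eta> ` C)" "v \<in> insert 0 (\<eta> ` C)" "u \<noteq> v"
    then consider c where "u = 0" "c \<in> C" "v = \<eta> c" | c where "v = 0" "c \<in> C" "u = \<eta> c"
      | a c where "a \<in> C" "u = \<eta> a" "c \<in> C" "v = \<eta> c" by blast
    then show "(u, v) \<in> r \<or> (v, u) \<in> r"
    proof cases
      case (3 a c)
      then have "a \<noteq> c" "a \<in> U" "c \<in> U" using uv(3) C(2) by auto
      then show ?thesis using 3 \<eta>\<eta> lt_total[OF i] by metis
    qed (use r0 in auto)
  qed
  ultimately show ?thesis
    by (simp add: strict_order_by_def strict_linear_order_on_def r_def one_point_ext_def)
qed

lemma one_point_ext_fin_strucs:
  assumes N: "structure_of L N" and L: "\<And>i. i \<in> I \<Longrightarrow> L i = Some 2"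
  shows "one_point_ext \<eta> C B x D \<in> fin_strucs L"
proof -
  have "structure_of L (one_point_ext \<eta> C B x D)"
  proof (rule structure_ofI)
    fix R t assume t: "t \<in> rel (one_point_ext \<eta> C B x D) R"
    show "L R = Some (length t) \<and> set t \<subseteq> univ (one_point_ext \<eta> C B x D)"
    proof (cases "R \<in> I")
      case True
      then show ?thesis using t L D(1)[OF True] by (auto simp: one_point_ext_def)
    next
      case False
      then consider s where "s \<in> rel N R" "t = map (\<eta>(x := 0)) s" "set s \<subseteq> insert x B"
        | s where "s \<in> rel N R" "t = map \<eta> s" "set s \<subseteq> C"
        using t by (auto simp: one_point_ext_def image_struc_def)
      then show ?thesis
      proof cases
        case 1
        then show ?thesis using structure_ofD[OF N 1(1)] C(3) by (auto simp: one_point_ext_def)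
      next
        case 2
        then show ?thesis using structure_ofD[OF N 2(1)] by (auto simp: one_point_ext_def)
      qed
    qed
  qed
  then show ?thesis using C(1) by (simp add: fin_strucs_def one_point_ext_def)
qed

end

lemma extend_homogeneous:
  assumes N: "homogeneous L N" and X: "finite X" "X \<subseteq> U" and f: "inj_on f X" "f ` X \<subseteq> U"
    and rel: "\<And>R t. set t \<subseteq> X \<Longrightarrow> map f t \<in> rel N R \<longleftrightarrow> t \<in> rel N R"
  shows "\<exists>g\<in>G. \<forall>x\<in>X. g x = f x"
proof -
  have "isomorphism (substruc N X) (substruc N (f ` X)) f"
    using f(1) rel by (auto simp: isomorphism_def embedding_def substruc_def)
  then have "\<exists>g\<in>Aut N. \<forall>x\<in>X. g x = f x"
    using N X f(2) unfolding homogeneous_def by blast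
  then obtain g where g: "g \<in> G" "\<forall>x\<in>X. restrict g U x = f x" by (auto simp: Aut_eq)
  have "g x = f x" if "x \<in> X" for x
    using that g(2) subsetD[OF X(2) that] by (metis restrict_apply')
  then show ?thesis using g(1) by blast
qed

end

context ordered_struc
begin

text \<open>Homogeneity is used twice: to bring an embedded copy of the extension back so that its
  old part becomes \<open>C\<close>, the new point landing at \<open>y\<close>; and to move
  \<open>x\<close> to \<open>y\<close> over \<open>B\<close>, since both have the same type
  there.\<close>

lemma extension_property:
  assumes N: "homogeneous L N"
    and \<eta>: "inj_on \<eta> C" "0 \<notin> \<eta> ` C" and C: "finite C" "C \<subseteq> U" "B \<subseteq> C" and x: "x \<in> U" "x \<notin> B"
    and D: "\<And>i. i \<in> I \<Longrightarrow> D i \<subseteq> C"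
      "\<And>i c d. i \<in> I \<Longrightarrow> c \<in> C \<Longrightarrow> d \<in> D i \<Longrightarrow> lt True i c d \<Longrightarrow> c \<in> D i"
      "\<And>i b. i \<in> I \<Longrightarrow> b \<in> B \<Longrightarrow> b \<in> D i \<longleftrightarrow> lt True i b x"
    and age: "one_point_ext \<eta> C B x D \<in> age L N"
  shows "\<exists>g\<in>stab B. g x \<notin> C \<and> (\<forall>i\<in>I. \<forall>c\<in>C. lt True i c (g x) \<longleftrightarrow> c \<in> D i) \<and> free_ind {g x} B C"
proof -
  let ?E = "one_point_ext \<eta> C B x D"
  have on_C: "map \<eta> t \<in> rel ?E R \<longleftrightarrow> t \<in> rel N R" if "set t \<subseteq> C" for t R
    using one_point_ext_\<eta>[OF \<eta> C x D that] .
  have on_B: "map (\<eta>(x := 0)) t \<in> rel ?E R \<longleftrightarrow> t \<in> rel N R" if "set t \<subseteq> insert x B" for t R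
    using one_point_ext_\<theta>[OF \<eta> C x D that] .
  obtain e where e: "embedding ?E N e" using age by (auto simp: age_def)
  have univE: "univ ?E = insert 0 (\<eta> ` C)" by (simp add: one_point_ext_def)
  have e_inj: "inj_on e (insert 0 (\<eta> ` C))" and e_U: "e ` insert 0 (\<eta> ` C) \<subseteq> U"
    and e_rel: "\<And>R t. set t \<subseteq> insert 0 (\<eta> ` C) \<Longrightarrow> t \<in> rel ?E R \<longleftrightarrow> map e t \<in> rel N R"
    using e unfolding embedding_def univE by blast+
  define f where "f = inv_into C (e \<circ> \<eta>)"
  have inj: "inj_on (e \<circ> \<eta>) C"
    using comp_inj_on[OF \<eta>(1) inj_on_subset[OF e_inj]] by blast
  have f: "f (e (\<eta> c)) = c" if "c \<in> C" for c
    using inv_into_f_f[OF inj that] by (simp add: f_def)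
  have "\<exists>g\<in>G. \<forall>z\<in>e ` \<eta> ` C. g z = f z"
  proof (rule extend_homogeneous[OF N])
    show "finite (e ` \<eta> ` C)" using C by simp
    show "e ` \<eta> ` C \<subseteq> U" using e_U by blast
    show "inj_on f (e ` \<eta> ` C)" using f by (auto simp: inj_on_def)
    show "f ` e ` \<eta> ` C \<subseteq> U" using f C by auto
    fix R t assume t: "set t \<subseteq> e ` \<eta> ` C"
    define s where "s = map f t"
    have s: "set s \<subseteq> C" using t f by (force simp: s_def)
    have "t = map e (map \<eta> s)" using t f by (force simp: s_def intro!: map_idI[symmetric])
    moreover have "set (map \<eta> s) \<subseteq> insert 0 (\<eta> ` C)" using s by auto
    ultimately have "t \<in> rel N R \<longleftrightarrow> map \<eta> s \<in> rel ?E R" using e_rel by simp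
    also have "\<dots> \<longleftrightarrow> s \<in> rel N R" using on_C[OF s] .
    finally show "map f t \<in> rel N R \<longleftrightarrow> t \<in> rel N R" by (simp add: s_def)
  qed
  then obtain g1 where g1: "g1 \<in> G" "\<forall>z\<in>e ` \<eta> ` C. g1 z = f z" by (elim bexE)
  have g1C: "g1 (e (\<eta> c)) = c" if "c \<in> C" for c using g1(2) f that by simp
  define y where "y = g1 (e 0)"
  have yU: "y \<in> U" using g1(1) e_U by (simp add: y_def)
  have yC: "y \<notin> C"
  proof
    assume "y \<in> C"
    then have "g1 (e 0) = g1 (e (\<eta> y))" using g1C by (simp add: y_def)
    then have "e 0 = e (\<eta> y)" using G_inj[OF g1(1)] by simp
    then have "0 = \<eta> y" using inj_onD[OF e_inj] \<open>y \<in> C\<close> by blast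
    then show False using \<eta>(2) \<open>y \<in> C\<close> by auto
  qed
  have on_y: "t \<in> rel N R \<longleftrightarrow> map (\<eta>(y := 0)) t \<in> rel ?E R" if t: "set t \<subseteq> insert y C" for t R
  proof -
    have "g1 (e ((\<eta>(y := 0)) z)) = z" if "z \<in> set t" for z
      using t that g1C[of z] by (cases "z = y") (auto simp: y_def)
    then have "t = map g1 (map e (map (\<eta>(y := 0)) t))" by (auto intro!: map_idI[symmetric])
    then have "t \<in> rel N R \<longleftrightarrow> map e (map (\<eta>(y := 0)) t) \<in> rel N R" using G_rel[OF g1(1)] by metis
    moreover have "set (map (\<eta>(y := 0)) t) \<subseteq> insert 0 (\<eta> ` C)" using t by auto
    ultimately show ?thesis using e_rel by blast
  qed
  have "\<exists>g\<in>G. \<forall>z\<in>insert x B. g z = (if z = x then y else z)"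
  proof (rule extend_homogeneous[OF N])
    show "finite (insert x B)" using C finite_subset by auto
    show "insert x B \<subseteq> U" using C x by auto
    have "y \<notin> B" using yC C(3) by blast
    then show "inj_on (\<lambda>z. if z = x then y else z) (insert x B)" by (auto simp: inj_on_def)
    show "(\<lambda>z. if z = x then y else z) ` insert x B \<subseteq> U" using yU C by auto
    fix R t assume t: "set t \<subseteq> insert x B"
    define s where "s = map (\<lambda>z. if z = x then y else z) t"
    have "set s \<subseteq> insert y C" using t C(3) by (auto simp: s_def)
    then have "s \<in> rel N R \<longleftrightarrow> map (\<eta>(y := 0)) s \<in> rel ?E R" by (rule on_y)
    also have "map (\<eta>(y := 0)) s = map (\<eta>(x := 0)) t"
      using t \<open>y \<notin> B\<close> by (auto simp: s_def)
    also have "\<dots> \<in> rel ?E R \<longleftrightarrow> t \<in> rel N R" using on_B[OF t] .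
    finally show "map (\<lambda>z. if z = x then y else z) t \<in> rel N R \<longleftrightarrow> t \<in> rel N R" by (simp add: s_def)
  qed
  then obtain g where g: "g \<in> G" "\<forall>z\<in>insert x B. g z = (if z = x then y else z)" by (elim bexE)
  have gx: "g x = y" using g(2) by simp
  have gB: "g \<in> stab B" using g x(2) unfolding stab_def by auto
  have "lt True i c y \<longleftrightarrow> c \<in> D i" if i: "i \<in> I" and c: "c \<in> C" for i c
  proof -
    have "[c, y] \<in> rel N i \<longleftrightarrow> [\<eta> c, 0] \<in> rel ?E i" using on_y[of "[c, y]" i] c yC by auto
    then show ?thesis using one_point_ext_0(1)[OF \<eta> C x D i c] by (simp add: lt_def)
  qed
  moreover have "free_ind {y} B C"
    unfolding free_ind_def
  proof (intro conjI allI impI)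
    show "{y} \<inter> C \<subseteq> B" using yC by blast
    fix R t assume t: "R \<notin> I \<and> t \<in> rel N R \<and> set t \<subseteq> {y} \<union> B \<union> C"
    then have tC: "set t \<subseteq> insert y C" using C(3) by blast
    then have "map (\<eta>(y := 0)) t \<in> rel ?E R" using on_y t by blast
    then have "map (\<eta>(y := 0)) t \<in> rel (image_struc (\<eta>(x := 0)) N (insert x B)) R \<or>
        map (\<eta>(y := 0)) t \<in> rel (image_struc \<eta> N C) R"
      using t by (simp add: one_point_ext_def)
    moreover have "set u \<subseteq> f ` X" if "u \<in> rel (image_struc f N X) R" for u f X
      using that by (fastforce simp: image_struc_def)
    moreover have "(\<eta>(x := 0)) ` insert x B = insert 0 (\<eta> ` B)" using x(2) by auto
    ultimately have "set (map (\<eta>(y := 0)) t) \<subseteq> insert 0 (\<eta> ` B) \<or> set (map (\<eta>(y := 0)) t) \<subseteq> \<eta> ` C"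
      by metis
    then show "set t \<subseteq> {y} \<union> B \<or> set t \<subseteq> B \<union> C"
    proof
      assume a: "set (map (\<eta>(y := 0)) t) \<subseteq> insert 0 (\<eta> ` B)"
      have "z \<in> {y} \<union> B" if z: "z \<in> set t" for z
      proof (cases "z = y")
        case False
        then have zC: "z \<in> C" using tC z by blast
        have "(\<eta>(y := 0)) z \<in> set (map (\<eta>(y := 0)) t)" using z by simp
        then have "\<eta> z \<in> insert 0 (\<eta> ` B)" using a False by auto
        moreover have "\<eta> z \<noteq> 0" using \<eta>(2) zC by force
        ultimately obtain b where "b \<in> B" "\<eta> z = \<eta> b" by auto
        then show ?thesis using inj_onD[OF \<eta>(1) _ zC] C(3) by blast
      qed simp
      then show ?thesis by blast
    next
      assume a: "set (map (\<eta>(y := 0)) t) \<subseteq> \<eta> ` C"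
      have "y \<notin> set t"
      proof
        assume "y \<in> set t"
        then have "(\<eta>(y := 0)) y \<in> set (map (\<eta>(y := 0)) t)" by (metis imageI list.set_map)
        then show False using a \<eta>(2) by auto
      qed
      then show ?thesis using tC by blast
    qed
  qed
  ultimately show ?thesis using gB yC gx by metis
qed

lemma generic_strucI:
  assumes N: "homogeneous L N"
    and age: "\<And>\<eta> C B x D. \<lbrakk>inj_on \<eta> C; 0 \<notin> \<eta> ` C; finite C; C \<subseteq> U; B \<subseteq> C; x \<in> U; x \<notin> B;
      \<And>i. i \<in> I \<Longrightarrow> D i \<subseteq> C;
      \<And>i c d. i \<in> I \<Longrightarrow> c \<in> C \<Longrightarrow> d \<in> D i \<Longrightarrow> lt True i c d \<Longrightarrow> c \<in> D i;
      \<And>i b. i \<in> I \<Longrightarrow> b \<in> B \<Longrightarrow> b \<in> D i \<longleftrightarrow> lt True i b x\<rbrakk>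
      \<Longrightarrow> one_point_ext \<eta> C B x D \<in> age L N"
  shows "generic_struc N I"
proof
  fix X f
  assume X: "finite X" "X \<subseteq> U" and f: "inj_on f X" "f ` X \<subseteq> U"
    and rel: "\<And>R t. R \<notin> I \<Longrightarrow> set t \<subseteq> X \<Longrightarrow> map f t \<in> rel N R \<longleftrightarrow> t \<in> rel N R"
    and lt: "\<And>i x y. i \<in> I \<Longrightarrow> x \<in> X \<Longrightarrow> y \<in> X \<Longrightarrow> lt True i (f x) (f y) \<longleftrightarrow> lt True i x y"
  show "\<exists>g\<in>G. \<forall>x\<in>X. g x = f x"
  proof (rule extend_homogeneous[OF N X f])
    fix R t assume t: "set t \<subseteq> X"
    show "map f t \<in> rel N R \<longleftrightarrow> t \<in> rel N R"
    proof (cases "R \<in> I")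
      case True
      show ?thesis
      proof (cases "length t = 2")
        case len: True
        then obtain p q where "t = [p, q]" unfolding length_2_iff by (elim exE)
        then show ?thesis using lt[OF True, of p q] t by (simp add: lt_def)
      next
        case False
        then show ?thesis using pairs_I[OF True, of t] pairs_I[OF True, of "map f t"] by auto
      qed
    qed (use rel t in blast)
  qed
next
  fix C B x D
  assume C: "finite C" "C \<subseteq> U" "B \<subseteq> C" and x: "x \<in> U" "x \<notin> B"
    and D: "\<And>i. i \<in> I \<Longrightarrow> D i \<subseteq> C"
      "\<And>i c d. i \<in> I \<Longrightarrow> c \<in> C \<Longrightarrow> d \<in> D i \<Longrightarrow> lt True i c d \<Longrightarrow> c \<in> D i"
      "\<And>i b. i \<in> I \<Longrightarrow> b \<in> B \<Longrightarrow> b \<in> D i \<longleftrightarrow> lt True i b x"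
  obtain f :: "'b \<Rightarrow> nat" where f: "inj_on f C" using C(1) finite_imp_inj_to_nat_seg by metis
  \<comment> \<open>The successor keeps 0 free for the new point.\<close>
  define \<eta> where "\<eta> = Suc \<circ> f"
  have \<eta>: "inj_on \<eta> C" "0 \<notin> \<eta> ` C" using f by (auto simp: \<eta>_def inj_on_def)
  show "\<exists>g\<in>stab B. g x \<notin> C \<and> (\<forall>i\<in>I. \<forall>c\<in>C. lt True i c (g x) \<longleftrightarrow> c \<in> D i) \<and> free_ind {g x} B C"
    by (rule extension_property[OF N \<eta> C x D age[OF \<eta> C x D]])
qed

end

section \<open>The two families of structures\<close>

lemma ordered_strucI:
  assumes N: "homogeneous L N" and I: "finite I" "\<And>i. i \<in> I \<Longrightarrow> L i = Some 2"
    and ord: "\<And>A i. A \<in> age L N \<Longrightarrow> i \<in> I \<Longrightarrow> strict_order_by A i"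
    and ne: "A \<in> age L N" "univ A \<noteq> {}"
  shows "ordered_struc N I"
proof
  have L: "structure_of L N" "countable (univ N)" using N by (simp_all add: homogeneous_def)
  show "countable (univ N)" by (rule L)
  show "univ N \<noteq> {}" using ne by (auto simp: age_def embedding_def)
  show "set t \<subseteq> univ N" if "t \<in> rel N R" for t R using structure_ofD[OF L(1) that] by auto
  show "strict_order_by N i" if "i \<in> I" for i using strict_order_by_from_age[OF L(1)] ord that by blast
  show "length t = 2" if "i \<in> I" "t \<in> rel N i" for i t
    using structure_ofD[OF L(1) that(2)] I(2)[OF that(1)] by auto
qed (use I in auto)

text \<open>The age imposes nothing beyond the orders, so it contains all these one-point
  extensions; rigidity for the first order comes from the second.\<close>

lemma Aut_universal_linear_orders_simple:
  assumes n: "n \<ge> 2" and P: "universal_linear_orders n P"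
  shows "is_simple_group (Aut_group P)"
proof -
  let ?L = "orders_lang n"
  let ?I = "{1..n}"
  have homog: "homogeneous ?L P"
    and age: "age ?L P = {A \<in> fin_strucs ?L. \<forall>i\<in>?I. strict_order_by A i}"
    using P by (simp_all add: universal_linear_orders_def fraisse_limit_def)
  have sP: "structure_of ?L P" using homog by (simp add: homogeneous_def)
  have LI: "?L i = Some 2" if "i \<in> ?I" for i using that by (simp add: orders_lang_def)
  define A0 :: "(nat, nat) struc" where "A0 = \<lparr>univ = {0}, rel = \<lambda>_. {}\<rparr>"
  have "A0 \<in> age ?L P" unfolding age
    by (auto simp: A0_def fin_strucs_def structure_of_def strict_order_by_def strict_linear_order_on_def
        irrefl_def trans_def total_on_def split: option.splits)
  then have "ordered_struc P ?I"
    by (intro ordered_strucI[OF homog, where A=A0]) (use LI in \<open>auto simp: age A0_def\<close>)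
  then interpret ordered_struc P ?I .
  have "generic_struc P ?I"
  proof (rule generic_strucI[OF homog])
    fix \<eta> :: "_ \<Rightarrow> nat" and C B x D
    assume ctx: "inj_on \<eta> C" "0 \<notin> \<eta> ` C" "finite C" "C \<subseteq> univ P" "B \<subseteq> C" "x \<in> univ P" "x \<notin> B"
      "\<And>i. i \<in> ?I \<Longrightarrow> D i \<subseteq> C"
      "\<And>i c d. i \<in> ?I \<Longrightarrow> c \<in> C \<Longrightarrow> d \<in> D i \<Longrightarrow> lt True i c d \<Longrightarrow> c \<in> D i"
      "\<And>i b. i \<in> ?I \<Longrightarrow> b \<in> B \<Longrightarrow> b \<in> D i \<longleftrightarrow> lt True i b x"
    have "one_point_ext \<eta> C B x D \<in> fin_strucs ?L"
      by (rule one_point_ext_fin_strucs[OF ctx sP LI])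
    moreover have "strict_order_by (one_point_ext \<eta> C B x D) i" if "i \<in> ?I" for i
      by (rule one_point_ext_order[OF ctx that])
    ultimately show "one_point_ext \<eta> C B x D \<in> age ?L P" unfolding age by blast
  qed
  then interpret generic_struc P ?I .
  show ?thesis
  proof (rule Aut_group_simple)
    have 12: "1 \<in> ?I" "2 \<in> ?I" "(1::nat) \<noteq> 2" using n by auto
    have "h = id" if "h \<in> G" "lt True 1 \<alpha> \<beta>" "\<forall>w. lt True 1 \<alpha> w \<longrightarrow> lt True 1 w \<beta> \<longrightarrow> h w = w" for h \<alpha> \<beta>
      using rigid_by_second_order[OF 12 that(1,2)] that(3) by blast
    then show "\<exists>i\<in>?I. \<forall>h\<in>G. \<forall>\<alpha> \<beta>. lt True i \<alpha> \<beta> \<longrightarrow>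
        (\<forall>w. lt True i \<alpha> w \<longrightarrow> lt True i w \<beta> \<longrightarrow> h w = w) \<longrightarrow> h = id"
      using 12(1) by blast
  qed
qed

text \<open>The reduct of a one-point extension is a free join, hence in the age of
  \<open>M\<close>, and its order may be arbitrary. A non-constant related tuple of
  \<open>M\<close>, ordered with one entry first or last, serves
  \<open>rigid_by_relation\<close>.\<close>

lemma Aut_linear_order_expansion_simple:
  fixes M :: "('a, 'r) struc" and N :: "('b, 'r option) struc"
  assumes free: "free_homogeneous L M" and nontriv: "nontrivial M" and lim: "linear_order_expansion L M N"
  shows "is_simple_group (Aut_group N)"
proof -
  let ?L = "order_lang L"
  let ?I = "{None}"
  define K where "K = age L M"
  have K: "free_amalgamation_class L K" and homogM: "homogeneous L M"
    using free by (auto simp: free_homogeneous_def fraisse_limit_def K_def)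
  have homog: "homogeneous ?L N" and age: "age ?L N = order_expansions L K"
    using lim by (simp_all add: linear_order_expansion_def fraisse_limit_def K_def)
  have sM: "structure_of L M" and sN: "structure_of ?L N" using homogM homog by (simp_all add: homogeneous_def)
  have LI: "?L i = Some 2" if "i \<in> ?I" for i using that by (simp add: order_lang_def)
  have reductK: "reduct A \<in> K" if "A \<in> age ?L N" for A using that by (simp add: age order_expansions_def)
  obtain R t0 x0 y0 where t0: "t0 \<in> rel M R" "x0 \<in> set t0" "y0 \<in> set t0" "x0 \<noteq> y0"
    using nontriv unfolding nontrivial_def by blast
  obtain f0 :: "'a \<Rightarrow> nat" where f0: "inj_on f0 (set t0)"
    using finite_imp_inj_to_nat_seg[of "set t0"] by auto
  \<comment> \<open>The code 0 makes \<open>x0\<close> the least point in the order of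
    \<open>A True\<close> and the greatest in that of \<open>A False\<close>.\<close>
  define f where "f = (Suc \<circ> f0)(x0 := 0)"
  have f: "inj_on f (set t0)" "f x0 = 0" using f0 by (auto simp: f_def inj_on_def)
  have t0M: "set t0 \<subseteq> univ M" using structure_ofD[OF sM t0(1)] by auto
  define A0 where "A0 = image_struc f M (set t0)"
  have A0: "A0 \<in> K" unfolding A0_def K_def by (rule image_struc_in_age[OF sM _ t0M f(1)]) simp
  then have sA0: "structure_of L A0" by (simp add: K_def age_def fin_strucs_def)
  have univA0: "univ A0 = f ` set t0" by (simp add: A0_def image_struc_def)
  have ft0: "map f t0 \<in> rel A0 R" using t0(1) by (auto simp: A0_def image_struc_def)
  define A where "A b = \<lparr>univ = univ A0, rel = (\<lambda>S. case S of
      None \<Rightarrow> {[p, q] |p q. p \<in> univ A0 \<and> q \<in> univ A0 \<and> (if b then p < q else q < p)}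
    | Some S \<Rightarrow> rel A0 S)\<rparr>" for b :: bool
  have univA: "univ (A b) = f ` set t0" for b by (simp add: A_def univA0)
  have A_age: "A b \<in> age ?L N" for b
  proof -
    have "structure_of ?L (A b)"
    proof (rule structure_ofI)
      fix S t assume "t \<in> rel (A b) S"
      then show "?L S = Some (length t) \<and> set t \<subseteq> univ (A b)"
        using structure_ofD[OF sA0] by (cases S) (auto simp: A_def order_lang_def)
    qed
    then have "A b \<in> fin_strucs ?L" by (simp add: fin_strucs_def univA)
    moreover have "reduct (A b) = A0" by (simp add: reduct_def A_def)
    moreover have "strict_order_by (A b) None"
      by (cases b) (auto simp: A_def strict_order_by_def strict_linear_order_on_def irrefl_def trans_def total_on_def)
    ultimately show ?thesis using A0 by (simp add: age order_expansions_def)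
  qed
  have "ordered_struc N ?I"
    by (rule ordered_strucI[OF homog _ LI _ A_age[of True]])
      (use t0 in \<open>auto simp: age order_expansions_def univA\<close>)
  then interpret ordered_struc N ?I .
  have "generic_struc N ?I"
  proof (rule generic_strucI[OF homog])
    fix \<eta> :: "_ \<Rightarrow> nat" and C B x D
    assume ctx: "inj_on \<eta> C" "0 \<notin> \<eta> ` C" "finite C" "C \<subseteq> univ N" "B \<subseteq> C" "x \<in> univ N" "x \<notin> B"
      "\<And>i. i \<in> ?I \<Longrightarrow> D i \<subseteq> C"
      "\<And>i c d. i \<in> ?I \<Longrightarrow> c \<in> C \<Longrightarrow> d \<in> D i \<Longrightarrow> lt True i c d \<Longrightarrow> c \<in> D i"
      "\<And>i b. i \<in> ?I \<Longrightarrow> b \<in> B \<Longrightarrow> b \<in> D i \<longleftrightarrow> lt True i b x"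
    let ?\<theta> = "\<eta>(x := 0)"
    define A1 where "A1 = reduct (image_struc ?\<theta> N (insert x B))"
    define A2 where "A2 = reduct (image_struc \<eta> N C)"
    have finB: "finite (insert x B)" "insert x B \<subseteq> univ N" using ctx finite_subset by auto
    have "inj_on ?\<theta> (insert x B)" by (rule inj_\<theta>[OF ctx])
    then have "A1 \<in> K" unfolding A1_def by (intro reductK image_struc_in_age[OF sN finB])
    moreover have "A2 \<in> K" unfolding A2_def by (intro reductK image_struc_in_age[OF sN ctx(3,4,1)])
    moreover have "substruc A1 (univ A1 \<inter> univ A2) = substruc A2 (univ A1 \<inter> univ A2)"
    proof -
      have \<theta>B: "map ?\<theta> s = map \<eta> s" if "set s \<subseteq> B" for s using that ctx(7) by auto
      have univ: "univ A1 \<inter> univ A2 = \<eta> ` B"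
        using ctx(2,5,7) by (auto simp: A1_def A2_def reduct_def image_struc_def)
      have "t \<in> rel A1 S \<longleftrightarrow> t \<in> rel A2 S" if t: "set t \<subseteq> \<eta> ` B" for t S
      proof
        assume "t \<in> rel A1 S"
        then obtain s where s: "s \<in> rel N (Some S)" "set s \<subseteq> insert x B" "t = map ?\<theta> s"
          by (auto simp: A1_def reduct_def image_struc_def)
        have "x \<notin> set s"
        proof
          assume "x \<in> set s"
          then have "?\<theta> x \<in> set t" unfolding s(3) by (metis imageI list.set_map)
          then show False using t ctx(2,5) by auto
        qed
        then have "set s \<subseteq> B" using s(2) by blast
        then have "t = map \<eta> s" "set s \<subseteq> C" using \<theta>B s(3) ctx(5) by auto
        then show "t \<in> rel A2 S" using s(1) by (auto simp: A2_def reduct_def image_struc_def)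
      next
        assume "t \<in> rel A2 S"
        then obtain s where s: "s \<in> rel N (Some S)" "set s \<subseteq> C" "t = map \<eta> s"
          by (auto simp: A2_def reduct_def image_struc_def)
        have "set s \<subseteq> B"
        proof
          fix z assume z: "z \<in> set s"
          then have "\<eta> z \<in> \<eta> ` B" using t s(3) by auto
          then show "z \<in> B" using inj_on_image_mem_iff[OF ctx(1) _ ctx(5)] z s(2) by blast
        qed
        then have "t = map ?\<theta> s" "set s \<subseteq> insert x B" using \<theta>B s(3) by auto
        then show "t \<in> rel A1 S" using s(1) by (auto simp: A1_def reduct_def image_struc_def)
      qed
      then show ?thesis unfolding univ substruc_def by (auto intro!: ext)
    qed
    ultimately have "free_join A1 A2 \<in> K" using K unfolding free_amalgamation_class_def by blast
    moreover have "reduct (one_point_ext \<eta> C B x D) = free_join A1 A2"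
      using ctx(5,7) by (auto simp: one_point_ext_def free_join_def A1_def A2_def reduct_def image_struc_def)
    moreover have "one_point_ext \<eta> C B x D \<in> fin_strucs ?L"
      by (rule one_point_ext_fin_strucs[OF ctx sN LI])
    moreover have "None \<in> ?I" by simp
    note one_point_ext_order[OF ctx this]
    ultimately show "one_point_ext \<eta> C B x D \<in> age ?L N"
      unfolding age order_expansions_def by simp
  qed
  then interpret generic_struc N ?I .
  have "\<forall>b. \<exists>e. embedding (A b) N e" using A_age by (auto simp: age_def)
  then obtain e where e: "\<And>b. embedding (A b) N (e b)" by metis
  have e_inj: "inj_on (e b) (f ` set t0)" and e_U: "e b ` f ` set t0 \<subseteq> univ N"
    and e_rel: "\<And>S t. set t \<subseteq> f ` set t0 \<Longrightarrow> t \<in> rel (A b) S \<longleftrightarrow> map (e b) t \<in> rel N S" for b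
    using e[of b] unfolding embedding_def univA by blast+
  define d where "d b = e b 0" for b
  have zero: "0 \<in> f ` set t0" using f(2) t0(2) by force
  have dU: "d b \<in> univ N" for b using e_U zero by (auto simp: d_def)
  have tup: "\<exists>R t E. R \<notin> ?I \<and> t \<in> rel N R \<and> set t = insert (d b) E \<and> E \<noteq> {} \<and> (\<forall>e\<in>E. lt b None (d b) e)" for b
  proof (intro exI conjI ballI)
    let ?E = "e b ` (f ` set t0 - {0})"
    show "Some R \<notin> ?I" by simp
    have "map f t0 \<in> rel (A b) (Some R)" using ft0 by (simp add: A_def)
    then show "map (e b) (map f t0) \<in> rel N (Some R)" using e_rel[of "map f t0" b "Some R"] by simp
    have "set (map (e b) (map f t0)) = e b ` insert 0 (f ` set t0 - {0})" 
      using insert_Diff[OF zero] by (simp add: image_image)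
    then show "set (map (e b) (map f t0)) = insert (d b) ?E" unfolding image_insert d_def .
    have "f y0 \<noteq> 0" using t0 f inj_onD[OF f(1), of x0 y0] by auto
    then have "f y0 \<in> f ` set t0 - {0}" using t0(3) by simp
    then show "?E \<noteq> {}" by (metis empty_iff image_is_empty)
    fix v assume "v \<in> ?E"
    then obtain p where p: "p \<in> f ` set t0" "p \<noteq> 0" "v = e b p" by blast
    have "(if b then [0, p] else [p, 0]) \<in> rel (A b) None"
      using p zero by (auto simp: A_def univA0)
    then show "lt b None (d b) v"
      using e_rel[of "[0, p]" b None] e_rel[of "[p, 0]" b None] p zero by (auto simp: lt_def d_def split: if_splits)
  qed
  \<comment> \<open>Both points are copies of \<open>x0\<close>, and on one point the two orderings
    do not differ; so they lie in one orbit.\<close>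
  have "\<exists>g\<in>G. \<forall>z\<in>{d True}. g z = d False"
  proof (rule extend_homogeneous[OF homog])
    fix S t assume t: "set t \<subseteq> {d True}"
    define s where "s = map (\<lambda>_. 0 :: nat) t"
    have s: "set s \<subseteq> f ` set t0" using zero by (auto simp: s_def)
    have "t = map (e True) s" "map (\<lambda>_. d False) t = map (e False) s"
      using t by (auto simp: s_def d_def intro!: map_idI[symmetric])
    moreover have "s \<in> rel (A True) S \<longleftrightarrow> s \<in> rel (A False) S"
    proof (cases S)
      case None
      have "p = q" if "s = [p, q]" for p q using that by (auto simp: s_def map_eq_Cons_conv)
      then show ?thesis using None by (fastforce simp: A_def)
    qed (simp add: A_def)
    ultimately show "map (\<lambda>_. d False) t \<in> rel N S \<longleftrightarrow> t \<in> rel N S" using e_rel[OF s] by metis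
  qed (use dU in auto)
  then obtain g0 where g0: "g0 \<in> G" "g0 (d True) = d False" by auto
  have "h = id" if "h \<in> G" "lt True None \<alpha> \<beta>"
      "\<forall>w. lt True None \<alpha> w \<longrightarrow> lt True None w \<beta> \<longrightarrow> h w = w" for h \<alpha> \<beta>
    using rigid_by_relation[OF refl tup g0 that(1,2)] that(3) by blast
  then show ?thesis by (intro Aut_group_simple) blast
qed

theorem theorem1p5:
  fixes L :: "'r lang"
    and M :: "('a, 'r) struc"
    and N :: "('b, 'r option) struc"
    and P :: "('c, nat) struc"
    and n :: nat
  shows "(free_homogeneous L M \<and> nontrivial M \<and> linear_order_expansion L M N
            \<longrightarrow> is_simple_group (Aut_group N)) \<and>
         (n \<ge> 2 \<and> universal_linear_orders n P
            \<longrightarrow> is_simple_group (Aut_group P))"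
  using Aut_linear_order_expansion_simple Aut_universal_linear_orders_simple by blast

end
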